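(* Let $0<\delta<1$ and let $\phi$ be a twice smooth classifying loss. Suppose $f_\rho^\phi\in Lip^{(r,c_0)}$ for some $r>0$, $c_0>0$, and that $\rho$ satisfies the Tsybakov noise condition with exponent $q\in[0,\infty)$. Let $\lambda=m^{-1}$ and $\sigma=m^{-1/(2r+d)}$. Then for every $0<\nu<\frac{2r(q+1)}{(2r+d)(q+2)}$, with probability at least $1-\delta$, $$\mathcal R(\mathrm{sign}(f_{D,\sigma,\lambda}))-\mathcal R(f_c)\le\hat C\,m^{-\frac{2r(q+1)}{(2r+d)(q+2)}+\nu}\log\frac4\delta,$$ where $\hat C$ is a constant independent of $\delta$ and $m$.
   Context: Setting: $X=[0,1]^d$, $Y=\{-1,1\}$, $\rho$ a Borel probability measure on $Z=X\times Y$ with marginal $\rho_X$; $\eta(x)=\mathbf P[y=1|x]$; sample $D=\{(x_i,y_i)\}_{i=1}^m$ i.i.d. from $\rho$; $\mathcal R(\mathcal C)=\mathbf P[\mathcal C(x)\ne y]$; Bayes rule $f_c(x)=1$ if $\eta(x)\ge1/2$, else $-1$. For a loss $\phi$, $f_\rho^\phi(x)$ is a minimizer over $t\in\mathbf R$ of $\int_Y\phi(yt)d\rho(y|x)$. A classifying loss is a convex $\phi:\mathbf R\to\mathbf R_+$, differentiable at $0$ with $\phi'(0)<0$, whose smallest zero is $1$; a twice smooth classifying loss is additionally differentiable with $|\phi'(u)-\phi'(v)|\le L^*|u-v|$ for all $u,v$ and modulus of convexity $\delta(\epsilon)=\inf\{\frac{\phi(u)+\phi(v)}2-\phi(\frac{u+v}2):|u-v|\ge\epsilon\}\ge\mu\epsilon^2$,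 for some $L^*,\mu>0$. Tsybakov noise condition with exponent $q\in[0,\infty]$: there is $\hat c_q>0$ with $\rho_X(\{x:|2\eta(x)-1|\le\hat c_qt\})\le t^q$ for all $t>0$. $G_\sigma(x,x')=\exp(-\|x-x'\|_2^2/\sigma^2)$ with RKHS $(\mathcal H_\sigma,\|\cdot\|_\sigma)$; $f_{D,\sigma,\lambda}=\arg\min_{f\in\mathcal H_\sigma}\{\frac1m\sum_i\phi(y_if(x_i))+\lambda\|f\|_\sigma^2\}$. $Lip^{(r,c_0)}$ ($r=u+v$, $u\in\mathbf N_0$, $0<v\le1$) is the set of functions on $X$ whose partial derivatives of total order $u$ exist and satisfy $|\partial^\alpha f(x)-\partial^\alpha f(x')|\le c_0\|x-x'\|_2^v$. *)

theory Defs
  imports "HOL-Probability.Probability"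
begin

definition unit_cube :: "(real^'d) set" where
  "unit_cube = {x. \<forall>i. 0 \<le> x$i \<and> x$i \<le> 1}"

definition classifying_loss :: "(real \<Rightarrow> real) \<Rightarrow> bool" where
  "classifying_loss \<phi> \<longleftrightarrow>
     convex_on UNIV \<phi> \<and> (\<forall>u. 0 \<le> \<phi> u) \<and>
     (\<exists>D. (\<phi> has_real_derivative D) (at 0) \<and> D < 0) \<and>
     \<phi> 1 = 0 \<and> (\<forall>u. \<phi> u = 0 \<longrightarrow> 1 \<le> u)"

text \<open>Twice smooth classifying loss: differentiable, Lipschitz derivative with
  constant L, and modulus of convexity bounded below by mu*eps^2 (the inequality
  inf{...} >= mu eps^2 unfolded).\<close>
definition twice_smooth_classifying_loss :: "(real \<Rightarrow> real) \<Rightarrow> bool" where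
  "twice_smooth_classifying_loss \<phi> \<longleftrightarrow>
     classifying_loss \<phi> \<and> (\<forall>u. \<phi> differentiable (at u)) \<and>
     (\<exists>L \<mu>. L > 0 \<and> \<mu> > 0 \<and>
        (\<forall>u v. \<bar>deriv \<phi> u - deriv \<phi> v\<bar> \<le> L * \<bar>u - v\<bar>) \<and>
        (\<forall>\<epsilon>>0. \<forall>u v. \<bar>u - v\<bar> \<ge> \<epsilon> \<longrightarrow>
             (\<phi> u + \<phi> v) / 2 - \<phi> ((u + v) / 2) \<ge> \<mu> * \<epsilon>\<^sup>2))"

text \<open>t minimises the conditional phi-risk at a point with conditional
  probability e = eta(x).\<close>
definition phi_minimizer :: "(real \<Rightarrow> real) \<Rightarrow> real \<Rightarrow> real \<Rightarrow> bool" where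
  "phi_minimizer \<phi> e t \<longleftrightarrow>
     (\<forall>s. e * \<phi> t + (1 - e) * \<phi> (- t) \<le> e * \<phi> s + (1 - e) * \<phi> (- s))"

text \<open>Lip^(r,c0) on X: r = u + v, u natural, 0 < v <= 1; partial derivatives
  Df alpha (alpha a multi-index) of all total orders up to u exist on X
  (one-sided within X at the boundary), and those of order u are v-Hoelder
  with constant c0.\<close>
definition hoelder_class :: "real \<Rightarrow> real \<Rightarrow> (real^'d) set \<Rightarrow> (real^'d \<Rightarrow> real) \<Rightarrow> bool" where
  "hoelder_class r c0 X f \<longleftrightarrow>
    (\<exists>(u::nat) (v::real) (Df :: ('d \<Rightarrow> nat) \<Rightarrow> real^'d \<Rightarrow> real).
       r = real u + v \<and> 0 < v \<and> v \<le> 1 \<and>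
       (\<forall>x\<in>X. Df (\<lambda>_. 0) x = f x) \<and>
       (\<forall>\<alpha> i. sum \<alpha> UNIV < u \<longrightarrow>
          (\<forall>x\<in>X. ((\<lambda>t. Df \<alpha> (x + t *\<^sub>R axis i 1)) has_real_derivative
                      Df (\<alpha>(i := \<alpha> i + 1)) x) (at 0 within {t. x + t *\<^sub>R axis i 1 \<in> X}))) \<and>
       (\<forall>\<alpha>. sum \<alpha> UNIV = u \<longrightarrow>
          (\<forall>x\<in>X. \<forall>x'\<in>X. \<bar>Df \<alpha> x - Df \<alpha> x'\<bar> \<le> c0 * norm (x - x') powr v)))"

text \<open>rho is given by its marginal rho_X and the conditional probability eta:
  rho(A x {1}) = int_A eta d rho_X, rho(A x {-1}) = int_A (1-eta) d rho_X.\<close>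
definition rho_meas :: "(real^'d) measure \<Rightarrow> (real^'d \<Rightarrow> real) \<Rightarrow> ((real^'d) \<times> real) measure" where
  "rho_meas \<rho>X \<eta> = density (\<rho>X \<Otimes>\<^sub>M count_space {-1, 1})
      (\<lambda>z. ennreal (if snd z = 1 then \<eta> (fst z) else 1 - \<eta> (fst z)))"

definition tsybakov :: "(real^'d) measure \<Rightarrow> (real^'d \<Rightarrow> real) \<Rightarrow> real \<Rightarrow> bool" where
  "tsybakov \<rho>X \<eta> q \<longleftrightarrow>
     (\<exists>c>0. \<forall>t>0. measure \<rho>X {x \<in> space \<rho>X. \<bar>2 * \<eta> x - 1\<bar> \<le> c * t} \<le> t powr q)"

definition sample_space :: "(real^'d) measure \<Rightarrow> (real^'d \<Rightarrow> real) \<Rightarrow> nat \<Rightarrow>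
     (nat \<Rightarrow> (real^'d) \<times> real) measure" where
  "sample_space \<rho>X \<eta> m = PiM {..<m} (\<lambda>_. rho_meas \<rho>X \<eta>)"

definition risk :: "((real^'d) \<times> real) measure \<Rightarrow> (real^'d \<Rightarrow> real) \<Rightarrow> real" where
  "risk \<rho> C = measure \<rho> {z \<in> space \<rho>. C (fst z) \<noteq> snd z}"

definition bayes_rule :: "(real^'d \<Rightarrow> real) \<Rightarrow> real^'d \<Rightarrow> real" where
  "bayes_rule \<eta> x = (if \<eta> x \<ge> 1/2 then 1 else -1)"

definition sign_fun :: "(real^'d \<Rightarrow> real) \<Rightarrow> real^'d \<Rightarrow> real" where
  "sign_fun f x = (if f x \<ge> 0 then 1 else -1)"

definition gauss_kernel :: "real \<Rightarrow> real^'d \<Rightarrow> real^'d \<Rightarrow> real" where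
  "gauss_kernel \<sigma> x x' = exp (- (norm (x - x'))\<^sup>2 / \<sigma>\<^sup>2)"

text \<open>Squared RKHS norm of f (restricted to X) in the RKHS of kernel K on X,
  via the dual characterisation ||f||^2 = sup (sum c_i f(x_i))^2 / ||sum c_i K_{x_i}||^2;
  it is infinite iff f is not in the RKHS.\<close>
definition rkhs_norm_sq :: "('a \<Rightarrow> 'a \<Rightarrow> real) \<Rightarrow> 'a set \<Rightarrow> ('a \<Rightarrow> real) \<Rightarrow> ereal" where
  "rkhs_norm_sq K X f = Sup ({0} \<union>
     {ereal ((\<Sum>x\<in>S. c x * f x)\<^sup>2 / (\<Sum>x\<in>S. \<Sum>y\<in>S. c x * c y * K x y)) | S c.
        finite S \<and> S \<subseteq> X \<and> (\<Sum>x\<in>S. \<Sum>y\<in>S. c x * c y * K x y) > 0})"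

definition in_rkhs :: "('a \<Rightarrow> 'a \<Rightarrow> real) \<Rightarrow> 'a set \<Rightarrow> ('a \<Rightarrow> real) \<Rightarrow> bool" where
  "in_rkhs K X f \<longleftrightarrow> rkhs_norm_sq K X f < \<infinity>"

definition reg_objective :: "(real \<Rightarrow> real) \<Rightarrow> ('a \<Rightarrow> 'a \<Rightarrow> real) \<Rightarrow> 'a set \<Rightarrow> real \<Rightarrow> nat \<Rightarrow>
     (nat \<Rightarrow> 'a \<times> real) \<Rightarrow> ('a \<Rightarrow> real) \<Rightarrow> real" where
  "reg_objective \<phi> K X lam m D f =
     (1 / real m) * (\<Sum>i<m. \<phi> (snd (D i) * f (fst (D i)))) + lam * real_of_ereal (rkhs_norm_sq K X f)"

definition erm_solution :: "(real \<Rightarrow> real) \<Rightarrow> ('a \<Rightarrow> 'a \<Rightarrow> real) \<Rightarrow> 'a set \<Rightarrow> real \<Rightarrow> nat \<Rightarrow>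
     (nat \<Rightarrow> 'a \<times> real) \<Rightarrow> ('a \<Rightarrow> real) \<Rightarrow> bool" where
  "erm_solution \<phi> K X lam m D f \<longleftrightarrow> in_rkhs K X f \<and>
     (\<forall>g. in_rkhs K X g \<longrightarrow> reg_objective \<phi> K X lam m D f \<le> reg_objective \<phi> K X lam m D g)"

end

theory Submission
  imports Defs
begin

text \<open>
  The loss is strongly convex with Lipschitz derivative, so its excess risk is comparable to the
  squared \<open>L\<^sup>2\<close> distance to the target. This gives the Bernstein condition (variance at most a
  constant times mean), and the noise condition turns a squared distance \<open>A\<close> into an excess
  misclassification risk of order \<open>A\<close> to the power \<open>(q + 1) / (q + 2)\<close>. Truncating the estimator
  to \<open>[-1, 1]\<close> decreases the empirical loss, so only bounded functions enter the concentration
  argument.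

  Estimation. On a cube of side \<open>\<sigma> m\<^bsup>-\<kappa>\<^esup>\<close> a function in the Gaussian RKHS is determined, up to a
  negative power of \<open>m\<close> as large as desired, by its values at a fixed number of interpolation
  nodes. Hence the relevant ball has a net of log-cardinality \<open>\<sigma>\<^bsup>-d\<^esup>\<close> times an arbitrarily small
  power of \<open>m\<close>. As that small power is affordable, an exponential Markov inequality and a union
  bound over one net replace chaining and peeling.

  Approximation. The approximant averages \<open>f (x + j w)\<close>, weighted by finite-difference
  coefficients, over \<open>w = \<sigma> z + h (c - x)\<close> with \<open>z\<close> Gaussian, \<open>c\<close> the centre of the cube and
  \<open>h = 2 R \<sigma>\<close>. The drift towards \<open>c\<close> keeps all evaluation points in the cube unless \<open>z\<close> exceeds \<open>R\<close>,
  so no smooth extension of the target beyond the cube is needed.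
\<close>

section \<open>Strongly convex losses\<close>

text \<open>The dual formula for the RKHS norm is used as it stands; no Hilbert space is built.
  Bounding a norm means bounding the pairing with every finite combination of point evaluations, and
  each estimate evaluates the kernel form on a suitable combination: two points for continuity, a
  point minus its interpolant for covering, arbitrary points for the approximant, via Cauchy-Schwarz
  against Gaussian features in L2. The average of \<open>f (x + j w)\<close> has bandwidth
  \<open>j \<sigma>\<close> and contracts \<open>x\<close> towards the centre, so it is not a
  smoothing at the bandwidth of the kernel. Rotation invariance repairs this: part of the noise is
  split off and frozen, and the rest smooths a dilated function at bandwidth exactly
  \<open>\<sigma>\<close>. A minimizer depends on the sample and is arbitrary off the cube. The
  event is therefore fixed by the net and the approximant alone, and truncations are set to 0 off
  the cube to make them Borel. A single exponent \<open>\<kappa>\<close> governs all losses: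
  \<open>R = m powr \<kappa>\<close> is the Gaussian cutoff and the oversampling of the grid
  relative to \<open>\<sigma>\<close>, and it also absorbs \<open>ln m\<close>. For the finitely
  many \<open>m\<close> with \<open>R \<sigma>\<close> too large, the constant makes the bound
  trivial.\<close>

definition clip :: "real \<Rightarrow> real" where
  "clip t = max (-1) (min 1 t)"

lemma abs_clip_le: "\<bar>clip t\<bar> \<le> 1"
  by (auto simp: clip_def)

lemma clip_nonneg_iff: "0 \<le> clip t \<longleftrightarrow> 0 \<le> t"
  by (auto simp: clip_def)

lemma clip_diff_le: "\<bar>clip s - clip t\<bar> \<le> \<bar>s - t\<bar>"
  by (auto simp: clip_def)

text \<open>The modulus of convexity enters only at \<open>\<epsilon> = \<bar>u - v\<bar>\<close>,
  which turns it into strong convexity at midpoints.\<close>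

locale smooth_loss =
  fixes \<phi> \<phi>' :: "real \<Rightarrow> real" and L \<mu> :: real
  assumes conv: "convex_on UNIV \<phi>"
    and nonneg: "0 \<le> \<phi> u"
    and one: "\<phi> 1 = 0"
    and der: "(\<phi> has_real_derivative \<phi>' u) (at u)"
    and neg: "\<phi>' 0 < 0"
    and Lpos: "0 < L" and mupos: "0 < \<mu>"
    and lip: "\<bar>\<phi>' u - \<phi>' v\<bar> \<le> L * \<bar>u - v\<bar>"
    and modulus: "\<mu> * (u - v)\<^sup>2 \<le> (\<phi> u + \<phi> v) / 2 - \<phi> ((u + v) / 2)"
begin

lemma pos: assumes "u \<noteq> 1" shows "0 < \<phi> u"
proof -
  have "\<mu> * (u - 1)\<^sup>2 \<le> (\<phi> u + \<phi> 1) / 2 - \<phi> ((u + 1) / 2)" by (rule modulus)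
  moreover have "0 < \<mu> * (u - 1)\<^sup>2" using assms mupos by simp
  ultimately show ?thesis using nonneg[of "(u+1)/2"] one by simp
qed

text \<open>Convexity on the segment from \<open>u\<close> to the zero \<open>1\<close> multiplies
  the value by \<open>1 - s\<close>, with \<open>s > 0\<close>; the decrease is strict because
  \<open>\<phi> u > 0\<close>.\<close>

lemma decreasing: assumes "u < v" "v \<le> 1" shows "\<phi> v < \<phi> u"
proof -
  define s where "s = (v - u) / (1 - u)"
  have u1: "1 - u > 0" using assms by simp
  have s: "0 < s" "s \<le> 1" using assms u1 by (auto simp: s_def field_simps)
  have "v = u + s * (1 - u)" using u1 by (simp add: s_def)
  then have v: "v = (1 - s) * u + s * 1" by (simp add: algebra_simps)
  have "\<phi> ((1 - s) *\<^sub>R u + s *\<^sub>R 1) \<le> (1 - s) * \<phi> u + s * \<phi> 1"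
    using conv s by (intro convex_onD) auto
  then have "\<phi> v \<le> (1 - s) * \<phi> u" using v one by simp
  also have "\<dots> < \<phi> u" using s pos[of u] assms by (simp add: algebra_simps)
  finally show ?thesis .
qed

lemma decreasing_le: assumes "u \<le> v" "v \<le> 1" shows "\<phi> v \<le> \<phi> u"
  using decreasing[of u v] assms by (cases "u = v") auto

text \<open>Clipping is odd, hence commutes with a label. Below -1 it moves the argument right where
  \<open>\<phi>\<close> decreases, and above 1 it moves it to the zero of
  \<open>\<phi>\<close>.\<close>

lemma loss_clip_le:
  assumes "y = 1 \<or> y = -1" shows "\<phi> (y * clip t) \<le> \<phi> (y * t)"
proof -
  have "y * clip t = clip (y * t)" using assms by (auto simp: clip_def max_def min_def)
  moreover have "\<phi> (clip s) \<le> \<phi> s" for s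
  proof (cases "s \<le> 1")
    case True
    show ?thesis
    proof (cases "s < -1")
      case True then show ?thesis using decreasing_le[of s "-1"] by (simp add: clip_def)
    next
      case False then show ?thesis using True by (simp add: clip_def)
    qed
  next
    case False then show ?thesis using nonneg[of s] one by (simp add: clip_def)
  qed
  ultimately show ?thesis by simp
qed

text \<open>Moving a point \<open>s > 1\<close> back to 1 removes \<open>\<phi> s > 0\<close> and
  strictly lowers \<open>\<phi> (- s)\<close>. The case \<open>t < -1\<close> is the same with
  \<open>e\<close> replaced by \<open>1 - e\<close>.\<close>

lemma minimizer_abs_le_1:
  assumes e: "0 \<le> e" "e \<le> 1" and t: "phi_minimizer \<phi> e t" shows "\<bar>t\<bar> \<le> 1"
proof (rule ccontr)
  assume n: "\<not> \<bar>t\<bar> \<le> 1"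
  have A: False if "s > 1" "0 \<le> e'" "e' \<le> 1" 
     "e' * \<phi> s + (1 - e') * \<phi> (- s) \<le> e' * \<phi> 1 + (1 - e') * \<phi> (-1)" for s e'
  proof (cases "e' = 1")
    case True then show ?thesis using that pos[of s] one by simp
  next
    case False
    have "(1 - e') * \<phi> (-1) < (1 - e') * \<phi> (-s)"
      using False that decreasing[of "-s" "-1"] by simp
    moreover have "0 \<le> e' * \<phi> s" using that nonneg by simp
    ultimately show ?thesis using that one by simp
  qed
  show False
  proof (cases "t > 1")
    case True
    then show ?thesis using A[of t e] e t by (simp add: phi_minimizer_def)
  next
    case False
    then have "- t > 1" using n by simp
    moreover have "e * \<phi> t + (1 - e) * \<phi> (- t) \<le> e * \<phi> (-1) + (1 - e) * \<phi> (- (-1))"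
      using t unfolding phi_minimizer_def by blast
    ultimately show ?thesis using A[of "-t" "1 - e"] e by simp
  qed
qed

definition crisk :: "real \<Rightarrow> real \<Rightarrow> real" where
  "crisk e s = e * \<phi> s + (1 - e) * \<phi> (- s)"

lemma crisk_minimizer: "phi_minimizer \<phi> e t \<Longrightarrow> crisk e t \<le> crisk e s"
  by (simp add: phi_minimizer_def crisk_def)

text \<open>Strong convexity is applied at \<open>s\<close>, \<open>t\<close> and at
  \<open>-s\<close>, \<open>-t\<close>, weighted by \<open>e\<close> and \<open>1 - e\<close>;
  minimality bounds the risk at the midpoint from below. Clearing the average gives the factor
  2.\<close>

lemma excess_lower:
  assumes e: "0 \<le> e" "e \<le> 1" and t: "phi_minimizer \<phi> e t"
  shows "2 * \<mu> * (s - t)\<^sup>2 \<le> crisk e s - crisk e t"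
proof -
  have 1: "\<mu> * (s - t)\<^sup>2 \<le> (\<phi> s + \<phi> t) / 2 - \<phi> ((s + t) / 2)" by (rule modulus)
  have "\<mu> * (-s - -t)\<^sup>2 \<le> (\<phi> (-s) + \<phi> (-t)) / 2 - \<phi> ((-s + -t) / 2)" by (rule modulus)
  then have 2: "\<mu> * (s - t)\<^sup>2 \<le> (\<phi> (-s) + \<phi> (-t)) / 2 - \<phi> (- ((s + t) / 2))"
    by (simp add: power2_commute minus_divide_left)
  have "e * (\<mu> * (s - t)\<^sup>2) \<le> e * ((\<phi> s + \<phi> t) / 2 - \<phi> ((s + t) / 2))"
    using 1 e by (intro mult_left_mono) auto
  moreover have "(1 - e) * (\<mu> * (s - t)\<^sup>2) \<le> (1 - e) * ((\<phi> (-s) + \<phi> (-t)) / 2 - \<phi> (- ((s + t) / 2)))"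
    using 2 e by (intro mult_left_mono) auto
  ultimately have "\<mu> * (s - t)\<^sup>2 \<le> (crisk e s + crisk e t) / 2 - crisk e ((s + t) / 2)"
    by (simp add: crisk_def field_simps)
  with crisk_minimizer[OF t, of "(s+t)/2"] show ?thesis by (simp add: field_simps)
qed

lemma crisk_deriv: "(crisk e has_real_derivative (e * \<phi>' s - (1 - e) * \<phi>' (- s))) (at s)"
proof -
  have m: "((\<lambda>s. \<phi> (- s)) has_real_derivative \<phi>' (- s) * - 1) (at s)"
    by (rule DERIV_chain2[OF der]) (auto intro!: derivative_eq_intros)
  show ?thesis unfolding crisk_def by (rule derivative_eq_intros der m | simp)+
qed

lemma minimizer_stationary:
  assumes "phi_minimizer \<phi> e t" shows "e * \<phi>' t = (1 - e) * \<phi>' (- t)"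
proof -
  have "e * \<phi>' t - (1 - e) * \<phi>' (- t) = 0"
    by (rule DERIV_local_min[OF crisk_deriv, where d = 1]) (use crisk_minimizer[OF assms] in auto)
  then show ?thesis by simp
qed

text \<open>The derivative of \<open>crisk e\<close> vanishes at \<open>t\<close>, so by the
  Lipschitz condition it is at most \<open>L \<bar>s - t\<bar>\<close> between \<open>t\<close> and
  \<open>s\<close>; the mean value inequality supplies the second factor.\<close>

lemma excess_upper:
  assumes e: "0 \<le> e" "e \<le> 1" and t: "phi_minimizer \<phi> e t"
  shows "crisk e s - crisk e t \<le> L * (s - t)\<^sup>2"
proof -
  have "norm (crisk e s - crisk e t) \<le> (L * \<bar>s - t\<bar>) * norm (s - t)"
  proof (rule field_differentiable_bound[where S = "closed_segment s t" and f' = "\<lambda>s. e * \<phi>' s - (1 - e) * \<phi>' (- s)"])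
    fix z assume z: "z \<in> closed_segment s t"
    show "(crisk e has_field_derivative e * \<phi>' z - (1 - e) * \<phi>' (- z)) (at z within closed_segment s t)"
      using crisk_deriv has_field_derivative_at_within by blast
    have zt: "\<bar>z - t\<bar> \<le> \<bar>s - t\<bar>" using z by (auto simp: closed_segment_eq_real_ivl split: if_splits)
    have "e * \<phi>' z - (1 - e) * \<phi>' (- z) = e * (\<phi>' z - \<phi>' t) - (1 - e) * (\<phi>' (- z) - \<phi>' (- t))"
      using minimizer_stationary[OF t] by (simp add: algebra_simps)
    also have "\<bar>\<dots>\<bar> \<le> e * \<bar>\<phi>' z - \<phi>' t\<bar> + (1 - e) * \<bar>\<phi>' (- z) - \<phi>' (- t)\<bar>"
      using e abs_triangle_ineq4[of "e * (\<phi>' z - \<phi>' t)" "(1 - e) * (\<phi>' (- z) - \<phi>' (- t))"] by (simp add: abs_mult)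
    also have "\<dots> \<le> e * (L * \<bar>z - t\<bar>) + (1 - e) * (L * \<bar>z - t\<bar>)"
      using e lip[of z t] lip[of "-z" "-t"] by (intro add_mono mult_left_mono) (auto simp: abs_minus_commute)
    also have "\<dots> \<le> L * \<bar>s - t\<bar>" using zt Lpos by (simp add: algebra_simps)
    finally show "norm (e * \<phi>' z - (1 - e) * \<phi>' (- z)) \<le> L * \<bar>s - t\<bar>" by simp
  qed auto
  then show ?thesis by (simp add: power2_eq_square)
qed

text \<open>Comparing the minimizer \<open>t\<close> with \<open>-t\<close> leaves
  \<open>(2 e - 1) (\<phi> t - \<phi> (- t)) \<le> 0\<close>, and \<open>\<phi>\<close> is strictly
  decreasing on \<open>[-1, 1]\<close>, where \<open>t\<close> lies.\<close>

lemma minimizer_sign: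
  assumes e: "0 \<le> e" "e \<le> 1" and t: "phi_minimizer \<phi> e t"
  shows "e > 1/2 \<Longrightarrow> 0 \<le> t" "e < 1/2 \<Longrightarrow> t \<le> 0"
proof -
  have "crisk e t \<le> crisk e (- t)" by (rule crisk_minimizer[OF t])
  then have "e * \<phi> t + (1 - e) * \<phi> (- t) \<le> e * \<phi> (- t) + (1 - e) * \<phi> t" by (simp add: crisk_def)
  then have *: "(2 * e - 1) * (\<phi> t - \<phi> (- t)) \<le> 0" by (simp add: algebra_simps)
  have b: "\<bar>t\<bar> \<le> 1" by (rule minimizer_abs_le_1[OF e t])
  show "0 \<le> t" if "e > 1/2"
  proof (rule ccontr)
    assume "\<not> 0 \<le> t"
    then have "\<phi> (-t) < \<phi> t" using b by (intro decreasing) auto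
    then have "0 < (2 * e - 1) * (\<phi> t - \<phi> (- t))" using that by (intro mult_pos_pos) auto
    then show False using * by simp
  qed
  show "t \<le> 0" if "e < 1/2"
  proof (rule ccontr)
    assume "\<not> t \<le> 0"
    then have "\<phi> t < \<phi> (-t)" using b by (intro decreasing) auto
    then have "0 < (2 * e - 1) * (\<phi> t - \<phi> (- t))" using that by (intro mult_neg_neg) auto
    then show False using * by simp
  qed
qed

text \<open>Stationarity gives \<open>\<bar>2 e - 1\<bar> \<bar>\<phi>' t + \<phi>' (- t)\<bar> =
  \<bar>\<phi>' t - \<phi>' (- t)\<bar> \<le> 2 L \<bar>t\<bar>\<close>. For small \<open>t\<close>
  the factor next to \<open>\<bar>2 e - 1\<bar>\<close> is at least \<open>- \<phi>' 0\<close>; for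
  larger \<open>t\<close> the resulting bound exceeds 1 and is trivial.\<close>

definition margin_const :: real where "margin_const = 2 * L / (- \<phi>' 0)"

lemma margin_const_pos: "0 < margin_const"
  using Lpos neg by (simp add: margin_const_def divide_pos_neg)

lemma noise_le_minimizer:
  assumes e: "0 \<le> e" "e \<le> 1" and t: "phi_minimizer \<phi> e t"
  shows "\<bar>2 * e - 1\<bar> \<le> margin_const * \<bar>t\<bar>"
proof (cases "2 * L * \<bar>t\<bar> \<le> - \<phi>' 0")
  case False
  then have "1 \<le> margin_const * \<bar>t\<bar>" using neg by (simp add: margin_const_def field_simps)
  then show ?thesis using e by (auto simp: abs_if)
next
  case True
  have "(2 * e - 1) * (\<phi>' t + \<phi>' (- t)) = - (\<phi>' t - \<phi>' (- t))"
    using minimizer_stationary[OF t] by (simp add: algebra_simps)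
  then have "\<bar>2 * e - 1\<bar> * \<bar>\<phi>' t + \<phi>' (- t)\<bar> = \<bar>\<phi>' t - \<phi>' (- t)\<bar>"
    by (metis abs_minus_cancel abs_mult)
  also have "\<dots> \<le> L * (2 * \<bar>t\<bar>)" using lip[of t "-t"] by simp
  finally have 1: "\<bar>2 * e - 1\<bar> * \<bar>\<phi>' t + \<phi>' (- t)\<bar> \<le> 2 * L * \<bar>t\<bar>" by simp
  have "- \<phi>' 0 \<le> \<bar>\<phi>' t + \<phi>' (- t)\<bar>" using lip[of t 0] lip[of "-t" 0] True by simp
  then have "\<bar>2 * e - 1\<bar> * (- \<phi>' 0) \<le> \<bar>2 * e - 1\<bar> * \<bar>\<phi>' t + \<phi>' (- t)\<bar>" by (intro mult_left_mono) auto
  with 1 show ?thesis using neg by (simp add: margin_const_def field_simps)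
qed

text \<open>A prediction \<open>s\<close> that disagrees with the Bayes rule lies on the other side
  of 0 from the minimizer, so \<open>\<bar>t\<bar> \<le> \<bar>s - t\<bar>\<close>. At
  \<open>e = 1/2\<close> the sign of \<open>t\<close> is not determined, but the left side is
  0.\<close>

lemma noise_le_distance:
  assumes e: "0 \<le> e" "e \<le> 1" and t: "phi_minimizer \<phi> e t" and ne: "(0 \<le> s) \<noteq> (1/2 \<le> e)"
  shows "\<bar>2 * e - 1\<bar> \<le> margin_const * \<bar>s - t\<bar>"
proof (cases "e = 1/2")
  case True then have "2 * e - 1 = 0" by simp
  then show ?thesis using margin_const_pos by simp
next
  case False
  then have "\<bar>t\<bar> \<le> \<bar>s - t\<bar>" using ne minimizer_sign[OF e t] by fastforce
  then have "margin_const * \<bar>t\<bar> \<le> margin_const * \<bar>s - t\<bar>" using margin_const_pos by simp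
  with noise_le_minimizer[OF e t] show ?thesis by simp
qed

text \<open>A bound for \<open>\<bar>\<phi>'\<bar>\<close> on \<open>[-M, M]\<close>, from its value
  at 0 and its Lipschitz constant.\<close>

definition lip_const :: "real \<Rightarrow> real" where "lip_const M = - \<phi>' 0 + L * M"

lemma loss_lipschitz:
  assumes "\<bar>u\<bar> \<le> M" "\<bar>v\<bar> \<le> M" shows "\<bar>\<phi> u - \<phi> v\<bar> \<le> lip_const M * \<bar>u - v\<bar>"
proof -
  have "norm (\<phi> u - \<phi> v) \<le> lip_const M * norm (u - v)"
  proof (rule field_differentiable_bound[where S = "closed_segment u v" and f' = \<phi>'])
    fix z assume "z \<in> closed_segment u v"
    then have z: "\<bar>z\<bar> \<le> M" using assms by (auto simp: closed_segment_eq_real_ivl split: if_splits)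
    then have "L * \<bar>z\<bar> \<le> L * M" using Lpos by simp
    then show "norm (\<phi>' z) \<le> lip_const M" using lip[of z 0] neg by (simp add: lip_const_def)
    show "(\<phi> has_field_derivative \<phi>' z) (at z within closed_segment u v)"
      using der has_field_derivative_at_within by blast
  qed auto
  then show ?thesis by simp
qed

lemma lip_const_pos: "0 \<le> M \<Longrightarrow> 0 < lip_const M"
  using neg Lpos mult_nonneg_nonneg[of L M] unfolding lip_const_def by linarith

lemma loss_measurable [measurable]: "\<phi> \<in> borel_measurable borel"
  using der DERIV_isCont by (intro borel_measurable_continuous_onI) (auto simp: continuous_on_eq_continuous_at)

end

lemma twice_smooth_imp_smooth_loss:
  assumes "twice_smooth_classifying_loss \<phi>"
  obtains L \<mu> where "smooth_loss \<phi> (deriv \<phi>) L \<mu>"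
proof -
  from assms obtain L \<mu> D where *: "convex_on UNIV \<phi>" "\<forall>u. 0 \<le> \<phi> u" "\<phi> 1 = 0" "\<forall>u. \<phi> differentiable (at u)"
     "L > 0" "\<mu> > 0" "\<forall>u v. \<bar>deriv \<phi> u - deriv \<phi> v\<bar> \<le> L * \<bar>u - v\<bar>"
     "\<forall>\<epsilon>>0. \<forall>u v. \<bar>u - v\<bar> \<ge> \<epsilon> \<longrightarrow> (\<phi> u + \<phi> v) / 2 - \<phi> ((u + v) / 2) \<ge> \<mu> * \<epsilon>\<^sup>2"
     "(\<phi> has_real_derivative D) (at 0)" "D < 0"
    unfolding twice_smooth_classifying_loss_def classifying_loss_def by blast
  have "smooth_loss \<phi> (deriv \<phi>) L \<mu>"
  proof
    show "(\<phi> has_real_derivative deriv \<phi> u) (at u)" for u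
      using *(4) by (metis DERIV_deriv_iff_real_differentiable)
    show "deriv \<phi> 0 < 0" using *(9,10) DERIV_imp_deriv by metis
    show "\<mu> * (u - v)\<^sup>2 \<le> (\<phi> u + \<phi> v) / 2 - \<phi> ((u + v) / 2)" for u v
    proof (cases "u = v")
      case False
      then have "\<bar>u - v\<bar> > 0" by simp
      then have "\<mu> * \<bar>u - v\<bar>\<^sup>2 \<le> (\<phi> u + \<phi> v) / 2 - \<phi> ((u + v) / 2)" using *(8) by blast
      then show ?thesis by simp
    qed simp
  qed (use * in auto)
  then show ?thesis by (rule that)
qed

section \<open>Finite differences of Hoelder functions on the cube\<close>

lemma unit_cube_eq_cbox: "(unit_cube :: (real^'d) set) = cbox 0 1"
  by (auto simp: unit_cube_def mem_box_cart)

lemma convex_unit_cube: "convex (unit_cube :: (real^'d) set)"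
  unfolding unit_cube_eq_cbox by (rule convex_box)


section \<open>Differentiability on the closed cube from one-sided partial derivatives\<close>

definition partials_on :: "(real^'d) set \<Rightarrow> (real^'d \<Rightarrow> real) \<Rightarrow> ('d \<Rightarrow> real^'d \<Rightarrow> real) \<Rightarrow> bool" where
  "partials_on X F D \<longleftrightarrow> (\<forall>i. \<forall>x\<in>X. ((\<lambda>t. F (x + t *\<^sub>R axis i 1)) has_real_derivative D i x)
     (at 0 within {t. x + t *\<^sub>R axis i 1 \<in> X}))"

text \<open>Subtracting the linear function \<open>s a\<close> leaves a derivative of size at most
  \<open>\<epsilon>\<close>, so the mean value inequality applies. The derivative within the cube
  restricts to the segment, which stays inside by convexity.\<close>

lemma partials_on_segment_bound:
  fixes F :: "real^'d \<Rightarrow> real"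
  assumes D: "partials_on unit_cube F D"
    and x: "x \<in> unit_cube" and y: "x + T *\<^sub>R axis i 1 \<in> unit_cube"
    and bd: "\<And>s. s \<in> closed_segment 0 T \<Longrightarrow> \<bar>D i (x + s *\<^sub>R axis i 1) - a\<bar> \<le> \<epsilon>"
  shows "\<bar>F (x + T *\<^sub>R axis i 1) - F x - T * a\<bar> \<le> \<epsilon> * \<bar>T\<bar>"
proof -
  let ?S = "closed_segment 0 T"
  have inX: "x + s *\<^sub>R axis i 1 \<in> unit_cube" if s: "s \<in> ?S" for s
  proof -
    from s obtain u where u: "0 \<le> u" "u \<le> 1" "s = u * T" by (auto simp: in_segment)
    have "(1 - u) *\<^sub>R x + u *\<^sub>R (x + T *\<^sub>R axis i 1) \<in> unit_cube"
      using convex_unit_cube x y u unfolding convex_alt by blast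
    moreover have "(1 - u) *\<^sub>R x + u *\<^sub>R (x + T *\<^sub>R axis i 1) = x + s *\<^sub>R axis i 1"
      using u by (simp add: algebra_simps)
    ultimately show ?thesis by simp
  qed
  let ?k = "\<lambda>s. F (x + s *\<^sub>R axis i 1) - s * a"
  have "norm (?k T - ?k 0) \<le> \<epsilon> * norm (T - 0)"
  proof (rule field_differentiable_bound[where S = ?S and f' = "\<lambda>s. D i (x + s *\<^sub>R axis i 1) - a"])
    fix s assume s: "s \<in> ?S"
    let ?Y = "{t. (x + s *\<^sub>R axis i 1) + t *\<^sub>R axis i 1 \<in> unit_cube}"
    have "((\<lambda>t. F ((x + s *\<^sub>R axis i 1) + t *\<^sub>R axis i 1)) has_real_derivative D i (x + s *\<^sub>R axis i 1)) (at 0 within ?Y)"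
      using D inX[OF s] by (simp add: partials_on_def)
    then have "((\<lambda>t. F (x + (s + t) *\<^sub>R axis i 1)) has_real_derivative D i (x + s *\<^sub>R axis i 1)) (at 0 within ?Y)"
      by (simp add: algebra_simps)
    moreover have "((+) (-s)) ` ?S \<subseteq> ?Y"
      using inX by (auto simp: algebra_simps)
    ultimately have "((\<lambda>t. F (x + (s + t) *\<^sub>R axis i 1)) has_real_derivative D i (x + s *\<^sub>R axis i 1)) (at 0 within ((+) (-s)) ` ?S)"
      by (rule DERIV_subset)
    then have "((\<lambda>t. F (x + (s + t) *\<^sub>R axis i 1)) \<circ> ((+) (-s)) has_real_derivative D i (x + s *\<^sub>R axis i 1) * 1) (at s within ?S)"
      by (intro DERIV_image_chain) (auto intro!: derivative_eq_intros)
    then have "((\<lambda>t. F (x + t *\<^sub>R axis i 1)) has_real_derivative D i (x + s *\<^sub>R axis i 1)) (at s within ?S)"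
      by (simp add: o_def)
    then show "(?k has_real_derivative D i (x + s *\<^sub>R axis i 1) - a) (at s within ?S)"
      by (auto intro!: derivative_eq_intros)
    show "norm (D i (x + s *\<^sub>R axis i 1) - a) \<le> \<epsilon>" using bd[OF s] by simp
  qed auto
  then show ?thesis by (simp add: algebra_simps)
qed

text \<open>The classical argument: pass from \<open>x\<close> to \<open>y\<close> by changing one
  coordinate at a time. In a cube all intermediate points stay inside, so this works up to the
  boundary.\<close>

lemma has_derivative_from_partials:
  fixes F :: "real^'d \<Rightarrow> real"
  assumes D: "partials_on unit_cube F D"
    and cont: "\<And>i. continuous_on unit_cube (D i)" and x: "x \<in> unit_cube"
  shows "(F has_derivative (\<lambda>w. \<Sum>i\<in>UNIV. w$i * D i x)) (at x within unit_cube)"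
  unfolding has_derivative_within_alt
proof (intro conjI allI impI)
  have *: "bounded_linear (\<lambda>w::real^'d. w$i * c)" for i c
    by (rule bounded_linear_compose[OF bounded_linear_mult_left bounded_linear_vec_nth])
  show "bounded_linear (\<lambda>w::real^'d. \<Sum>i\<in>UNIV. w$i * D i x)"
    by (rule bounded_linear_sum) (rule *)
  fix e :: real assume e: "0 < e"
  define \<epsilon> where "\<epsilon> = e / CARD('d)"
  have \<epsilon>: "\<epsilon> > 0" using e by (simp add: \<epsilon>_def)
  have "\<exists>\<delta>>0. \<forall>y\<in>unit_cube. dist y x < \<delta> \<longrightarrow> \<bar>D i y - D i x\<bar> \<le> \<epsilon>" for i
    using cont[of i] x \<epsilon> unfolding continuous_on_iff dist_real_def by (meson less_imp_le)
  then obtain \<delta>' where \<delta>': "\<And>i. \<delta>' i > 0" "\<And>i y. y\<in>unit_cube \<Longrightarrow> dist y x < \<delta>' i \<Longrightarrow> \<bar>D i y - D i x\<bar> \<le> \<epsilon>"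
    by metis
  define \<delta> where "\<delta> = Min (range \<delta>')"
  have \<delta>: "\<delta> > 0" "\<And>i. \<delta> \<le> \<delta>' i" using \<delta>'(1) by (auto simp: \<delta>_def)
  show "\<exists>d>0. \<forall>y\<in>unit_cube. norm (y - x) < d \<longrightarrow>
       norm (F y - F x - (\<Sum>i\<in>UNIV. (y - x)$i * D i x)) \<le> e * norm (y - x)"
  proof (intro exI[of _ \<delta>] conjI ballI impI \<delta>)
    fix y assume y: "y \<in> unit_cube" and yx: "norm (y - x) < \<delta>"
    \<comment> \<open>The intermediate point with the coordinates of \<open>y\<close> in
      \<open>S\<close> and those of \<open>x\<close> elsewhere; the induction adds coordinates to
      \<open>S\<close>.\<close>
    define z where "z S = (\<chi> i. if i \<in> S then y$i else x$i)" for S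
    have zc: "z S \<in> unit_cube" for S using x y by (auto simp: z_def unit_cube_def)
    have "\<bar>F (z S) - F x - (\<Sum>i\<in>S. (y - x)$i * D i x)\<bar> \<le> \<epsilon> * (\<Sum>i\<in>S. \<bar>(y - x)$i\<bar>)" for S
      using finite[of S]
    proof (induction S rule: finite_induct)
      case empty
      have "z {} = x" by (simp add: z_def vec_eq_iff)
      then show ?case by simp
    next
      case (insert i S)
      have zi: "z (insert i S) = z S + (y - x)$i *\<^sub>R axis i 1"
        using insert.hyps by (auto simp: z_def vec_eq_iff axis_def)
      have "\<bar>F (z S + (y - x)$i *\<^sub>R axis i 1) - F (z S) - (y - x)$i * D i x\<bar> \<le> \<epsilon> * \<bar>(y - x)$i\<bar>"
      proof (rule partials_on_segment_bound[OF D zc])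
        show "z S + (y - x) $ i *\<^sub>R axis i 1 \<in> unit_cube" using zc[of "insert i S"] zi by simp
        fix s assume s: "s \<in> closed_segment 0 ((y - x) $ i)"
        let ?p = "z S + s *\<^sub>R axis i 1"
        have comp: "\<bar>(?p - x)$j\<bar> \<le> \<bar>(y - x)$j\<bar> \<and> 0 \<le> ?p$j \<and> ?p$j \<le> 1" for j
        proof -
          have xy: "0 \<le> x$j" "x$j \<le> 1" "0 \<le> y$j" "y$j \<le> 1" using x y by (auto simp: unit_cube_def)
          show ?thesis
          proof (cases "j = i")
            case True
            then have "?p$j = x$j + s" using insert.hyps by (auto simp: z_def axis_def)
            then show ?thesis using s xy True by (auto simp: closed_segment_eq_real_ivl split: if_splits)
          next
            case False
            then have "?p$j = z S $ j" by (auto simp: axis_def)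
            then show ?thesis using xy by (auto simp: z_def)
          qed
        qed
        have "norm (?p - x) \<le> norm (y - x)" by (rule norm_le_componentwise_cart) (use comp in auto)
        then have "dist ?p x < \<delta>' i" using yx \<delta>(2)[of i] by (simp add: dist_norm)
        moreover have "?p \<in> unit_cube" using comp by (auto simp: unit_cube_def)
        ultimately show "\<bar>D i ?p - D i x\<bar> \<le> \<epsilon>" using \<delta>'(2) by blast
      qed
      then show ?case using insert unfolding zi by (simp add: distrib_left)
    qed
    from this[of UNIV] have "\<bar>F y - F x - (\<Sum>i\<in>UNIV. (y - x)$i * D i x)\<bar> \<le> \<epsilon> * (\<Sum>i\<in>UNIV. \<bar>(y - x)$i\<bar>)"
      by (simp add: z_def)
    also have "\<dots> \<le> \<epsilon> * (\<Sum>i\<in>(UNIV::'d set). norm (y - x))"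
      using \<epsilon> by (intro mult_left_mono sum_mono component_le_norm_cart) auto
    also have "\<dots> = e * norm (y - x)" by (simp add: \<epsilon>_def)
    finally show "norm (F y - F x - (\<Sum>i\<in>UNIV. (y - x)$i * D i x)) \<le> e * norm (y - x)" by simp
  qed
qed

text \<open>The derivative clauses of \<open>hoelder_class\<close> with \<open>u\<close>,
  \<open>v\<close> and the family \<open>Df\<close> exposed, so that an induction on
  \<open>u\<close> can shift all multi-indices.\<close>

definition hoelder_tower :: "nat \<Rightarrow> real \<Rightarrow> real \<Rightarrow> (('d \<Rightarrow> nat) \<Rightarrow> real^'d \<Rightarrow> real) \<Rightarrow> bool" where
  "hoelder_tower u v c0 Df \<longleftrightarrow>
     (\<forall>\<alpha>. sum \<alpha> UNIV < u \<longrightarrow> partials_on unit_cube (Df \<alpha>) (\<lambda>i. Df (\<alpha>(i := \<alpha> i + 1)))) \<and>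
     (\<forall>\<alpha>. sum \<alpha> UNIV = u \<longrightarrow> (\<forall>x\<in>unit_cube. \<forall>x'\<in>unit_cube. \<bar>Df \<alpha> x - Df \<alpha> x'\<bar> \<le> c0 * norm (x - x') powr v))"

lemma hoelder_class_tower:
  assumes "hoelder_class r c0 unit_cube (f :: real^'d \<Rightarrow> real)"
  obtains u v Df where "r = real u + v" "0 < v" "v \<le> 1" "hoelder_tower u v c0 Df"
    "\<forall>x\<in>unit_cube. Df (\<lambda>_. 0) x = f x"
proof -
  from assms obtain u v Df where *: "r = real u + v" "0 < v" "v \<le> 1" "\<forall>x\<in>unit_cube. Df (\<lambda>_. 0) x = f x"
     "(\<forall>\<alpha> i. sum \<alpha> UNIV < u \<longrightarrow>
          (\<forall>x\<in>unit_cube. ((\<lambda>t. Df \<alpha> (x + t *\<^sub>R axis i 1)) has_real_derivative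
                      Df (\<alpha>(i := \<alpha> i + 1)) x) (at 0 within {t. x + t *\<^sub>R axis i 1 \<in> unit_cube})))"
     "(\<forall>\<alpha>. sum \<alpha> UNIV = u \<longrightarrow>
          (\<forall>x\<in>unit_cube. \<forall>x'\<in>unit_cube. \<bar>Df \<alpha> x - Df \<alpha> x'\<bar> \<le> c0 * norm (x - x') powr v))"
    unfolding hoelder_class_def by blast
  show ?thesis
    by (rule that[of u v Df]) (use * in \<open>auto simp: hoelder_tower_def partials_on_def\<close>)
qed

lemma sum_fun_upd_Suc: "sum (\<alpha>(i := Suc (\<alpha> i))) (UNIV :: 'd::finite set) = Suc (sum \<alpha> UNIV)"
proof -
  have "sum (\<alpha>(i := Suc (\<alpha> i))) UNIV = Suc (\<alpha> i) + sum (\<alpha>(i := Suc (\<alpha> i))) (UNIV - {i})"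
    by (subst sum.remove[of _ i]) auto
  also have "sum (\<alpha>(i := Suc (\<alpha> i))) (UNIV - {i}) = sum \<alpha> (UNIV - {i})"
    by (rule sum.cong) auto
  also have "Suc (\<alpha> i) + sum \<alpha> (UNIV - {i}) = Suc (sum \<alpha> UNIV)"
    by (subst (2) sum.remove[of _ i]) auto
  finally show ?thesis .
qed

text \<open>Increments of a multi-index commute, so the family shifted by one in direction
  \<open>i\<close> is again a tower, one level shorter, over the \<open>i\<close>-th partial
  derivative.\<close>

lemma hoelder_tower_partial:
  assumes "hoelder_tower (Suc u) v c0 Df"
  shows "hoelder_tower u v c0 (\<lambda>\<alpha>. Df (\<alpha>(i := Suc (\<alpha> i))))"
  unfolding hoelder_tower_def
proof (intro conjI allI impI)
  fix \<alpha> :: "'a \<Rightarrow> nat" assume a: "sum \<alpha> UNIV < u"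
  have "(\<lambda>j. Df ((\<alpha>(i := Suc (\<alpha> i)))(j := (\<alpha>(i := Suc (\<alpha> i))) j + 1))) = (\<lambda>j. Df ((\<alpha>(j := \<alpha> j + 1))(i := Suc ((\<alpha>(j := \<alpha> j + 1)) i))))"
    by (intro ext arg_cong[where f = Df]) (auto simp: fun_eq_iff)
  moreover have "partials_on unit_cube (Df (\<alpha>(i := Suc (\<alpha> i)))) (\<lambda>j. Df ((\<alpha>(i := Suc (\<alpha> i)))(j := (\<alpha>(i := Suc (\<alpha> i))) j + 1)))"
    using assms a unfolding hoelder_tower_def by (simp add: sum_fun_upd_Suc del: fun_upd_apply)
  ultimately show "partials_on unit_cube (Df (\<alpha>(i := Suc (\<alpha> i)))) (\<lambda>j. Df ((\<alpha>(j := \<alpha> j + 1))(i := Suc ((\<alpha>(j := \<alpha> j + 1)) i))))"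
    by simp
next
  fix \<alpha> :: "'a \<Rightarrow> nat" assume a: "sum \<alpha> UNIV = u"
  show "\<forall>x\<in>unit_cube. \<forall>x'\<in>unit_cube. \<bar>Df (\<alpha>(i := Suc (\<alpha> i))) x - Df (\<alpha>(i := Suc (\<alpha> i))) x'\<bar> \<le> c0 * norm (x - x') powr v"
  proof -
    have "sum (\<alpha>(i := Suc (\<alpha> i))) UNIV = Suc u" using a by (simp add: sum_fun_upd_Suc del: fun_upd_apply)
    then show ?thesis using assms unfolding hoelder_tower_def by blast
  qed
qed

lemma hoelder_tower_partials_0:
  assumes "hoelder_tower (Suc u) v c0 Df"
  shows "partials_on unit_cube (Df (\<lambda>_. 0)) (\<lambda>i. Df ((\<lambda>_. 0)(i := Suc 0)))"
  using assms unfolding hoelder_tower_def by fastforce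

text \<open>At level 0 the Hoelder bound suffices. Above it, the first partials are continuous by
  induction, hence the function is differentiable.\<close>

lemma hoelder_tower_continuous:
  assumes "hoelder_tower u v c0 Df" "0 < v"
  shows "continuous_on unit_cube (Df (\<lambda>_. 0))"
  using assms
proof (induction u arbitrary: Df)
  case 0
  have h: "\<bar>Df (\<lambda>_. 0) y - Df (\<lambda>_. 0) x\<bar> \<le> c0 * norm (y - x) powr v" if "x \<in> unit_cube" "y \<in> unit_cube" for x y
    using 0 that by (auto simp: hoelder_tower_def)
  show ?case unfolding continuous_on
  proof
    fix x :: "real^'a" assume x: "x \<in> unit_cube"
    have "((\<lambda>y. norm (y - x)) \<longlongrightarrow> norm (x - x)) (at x within unit_cube)" by (intro tendsto_intros)
    then have "((\<lambda>y. norm (y - x)) \<longlongrightarrow> 0) (at x within unit_cube)" by simp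
    then have "((\<lambda>y. norm (y - x) powr v) \<longlongrightarrow> 0 powr v) (at x within unit_cube)"
      using 0 by (intro tendsto_powr2) (auto intro!: tendsto_intros)
    then have "((\<lambda>y. c0 * norm (y - x) powr v) \<longlongrightarrow> c0 * 0 powr v) (at x within unit_cube)" by (rule tendsto_mult_left)
    then have "((\<lambda>y. c0 * norm (y - x) powr v) \<longlongrightarrow> 0) (at x within unit_cube)" by simp
    then have "((\<lambda>y. Df (\<lambda>_. 0) y - Df (\<lambda>_. 0) x) \<longlongrightarrow> 0) (at x within unit_cube)"
      by (rule Lim_null_comparison[rotated]) (auto simp: eventually_at_filter h x)
    then show "(Df (\<lambda>_. 0) \<longlongrightarrow> Df (\<lambda>_. 0) x) (at x within unit_cube)" by (simp add: LIM_zero_iff)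
  qed
next
  case (Suc u)
  have c: "continuous_on unit_cube (Df ((\<lambda>_. 0)(i := Suc 0)))" for i
    using Suc.IH[OF hoelder_tower_partial[OF Suc.prems(1), of i]] Suc.prems by (simp add: fun_upd_def)
  show ?case unfolding continuous_on_eq_continuous_within
    using has_derivative_from_partials[OF hoelder_tower_partials_0[OF Suc.prems(1)] c] has_derivative_continuous by blast
qed

section \<open>Iterated differences and their Hoelder bound\<close>

primrec fdiff :: "nat \<Rightarrow> ('a::real_vector \<Rightarrow> real) \<Rightarrow> 'a \<Rightarrow> 'a \<Rightarrow> real" where
  "fdiff 0 f w x = f x"
| "fdiff (Suc n) f w x = fdiff n f w (x + w) - fdiff n f w x"

text \<open>Of the signed binomial coefficients only \<open>a 0 = \<plusminus>1\<close> is recorded: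
  it allows \<open>f x\<close> to be solved for in terms of the values at \<open>x + j w\<close>
  with \<open>j \<ge> 1\<close>.\<close>

lemma fdiff_expansion:
  "\<exists>a. a 0 = (-1) ^ n \<and> (\<forall>f w (x::'a::real_vector). fdiff n f w x = (\<Sum>j\<le>n. a j * f (x + real j *\<^sub>R w)))"
proof (induction n)
  case 0 show ?case by (rule exI[of _ "\<lambda>_. 1"]) simp
next
  case (Suc n)
  then obtain a where a: "a 0 = (-1) ^ n" "\<And>f w (x::'a). fdiff n f w x = (\<Sum>j\<le>n. a j * f (x + real j *\<^sub>R w))"
    by blast
  define b where "b j = (case j of 0 \<Rightarrow> 0 | Suc i \<Rightarrow> a i) - (if j \<le> n then a j else 0)" for j
  have "fdiff (Suc n) f w x = (\<Sum>j\<le>Suc n. b j * f (x + real j *\<^sub>R w))" for f w and x :: 'a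
  proof -
    have 1: "(\<Sum>j\<le>Suc n. (case j of 0 \<Rightarrow> 0 | Suc i \<Rightarrow> a i) * f (x + real j *\<^sub>R w)) = fdiff n f w (x + w)"
      unfolding a sum.atMost_Suc_shift by (simp add: algebra_simps)
    have 2: "(\<Sum>j\<le>Suc n. (if j \<le> n then a j else 0) * f (x + real j *\<^sub>R w)) = fdiff n f w x"
      unfolding a by simp
    show ?thesis unfolding fdiff.simps 1[symmetric] 2[symmetric] b_def left_diff_distrib sum_subtractf ..
  qed
  then show ?case using a(1) by (intro exI[of _ b]) (auto simp: b_def)
qed

lemma fdiff_sum:
  "fdiff n (\<lambda>x. \<Sum>i\<in>A. c i * g i x) w x = (\<Sum>i\<in>A. c i * fdiff n (g i) w x)"
  by (induction n arbitrary: x) (auto simp: sum_subtractf right_diff_distrib)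

lemma fdiff_has_derivative:
  assumes "\<And>j. j \<le> n \<Longrightarrow> ((\<lambda>s. f (x + (s + real j) *\<^sub>R w)) has_real_derivative g (x + (s + real j) *\<^sub>R w)) (at s within T)"
  shows "((\<lambda>s. fdiff n f w (x + s *\<^sub>R w)) has_real_derivative fdiff n g w (x + s *\<^sub>R w)) (at s within T)"
proof -
  obtain a where a: "\<And>f w (x::'a). fdiff n f w x = (\<Sum>j\<le>n. a j * f (x + real j *\<^sub>R w))"
    using fdiff_expansion by blast
  have e: "x + s *\<^sub>R w + real j *\<^sub>R w = x + (s + real j) *\<^sub>R w" for s j by (simp add: algebra_simps)
  show ?thesis unfolding a e by (intro DERIV_sum DERIV_cmult assms) auto
qed

text \<open>Induction on \<open>u\<close>: one difference is traded for a derivative in direction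
  \<open>w\<close>, which is \<open>\<Sum>i. w$i\<close> times the \<open>i\<close>-th partial. Each
  trade costs \<open>norm w\<close> and, from the sum over coordinates, a factor
  \<open>CARD('d)\<close>.\<close>

lemma fdiff_bound:
  fixes Df :: "('d::finite \<Rightarrow> nat) \<Rightarrow> real^'d \<Rightarrow> real"
  assumes "hoelder_tower u v c0 Df" "0 < v" "0 \<le> c0" "x \<in> unit_cube" "x + real (Suc u) *\<^sub>R w \<in> unit_cube"
  shows "\<bar>fdiff (Suc u) (Df (\<lambda>_. 0)) w x\<bar> \<le> c0 * real CARD('d) ^ u * norm w powr (real u + v)"
  using assms
proof (induction u arbitrary: Df x)
  case 0 
  then have "\<bar>Df (\<lambda>_. 0) (x + w) - Df (\<lambda>_. 0) x\<bar> \<le> c0 * norm (x + w - x) powr v"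
    unfolding hoelder_tower_def by (metis One_nat_def of_nat_1 scaleR_one sum.neutral_const)
  then show ?case by simp
next
  case (Suc u)
  let ?f = "Df (\<lambda>_. 0)" and ?D = "\<lambda>i. Df ((\<lambda>_. 0)(i := Suc 0))"
  have tower: "hoelder_tower u v c0 (\<lambda>\<alpha>. Df (\<alpha>(i := Suc (\<alpha> i))))" for i
    by (rule hoelder_tower_partial[OF Suc.prems(1)])
  have c: "continuous_on unit_cube (?D i)" for i
    using hoelder_tower_continuous[OF tower] Suc.prems by simp
  have seg: "x + s *\<^sub>R w \<in> unit_cube" if "0 \<le> s" "s \<le> real (Suc (Suc u))" for s
  proof -
    let ?N = "real (Suc (Suc u))"
    have "(1 - s / ?N) *\<^sub>R x + (s / ?N) *\<^sub>R (x + ?N *\<^sub>R w) \<in> unit_cube"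
    proof (rule convexD_alt[OF convex_unit_cube Suc.prems(4,5)])
      show "0 \<le> s / ?N" "s / ?N \<le> 1" using that by auto
    qed
    moreover have "(s / ?N) *\<^sub>R (x + ?N *\<^sub>R w) = (s / ?N) *\<^sub>R x + s *\<^sub>R w"
      by (simp add: scaleR_add_right)
    ultimately show ?thesis by (simp add: algebra_simps)
  qed
  let ?k = "\<lambda>s. fdiff (Suc u) ?f w (x + s *\<^sub>R w)"
  \<comment> \<open>The outermost difference of order \<open>Suc (Suc u)\<close> is the increment
    over \<open>[0, 1]\<close> of the difference of order \<open>Suc u\<close> along
    \<open>w\<close>.\<close>
  have "norm (?k 1 - ?k 0) \<le> (c0 * real CARD('d) ^ Suc u * norm w powr (real (Suc u) + v)) * norm (1 - 0 :: real)"
  proof (rule field_differentiable_bound[where S = "{0..1}" and f' = "\<lambda>s. fdiff (Suc u) (\<lambda>x. \<Sum>i\<in>UNIV. w$i * ?D i x) w (x + s *\<^sub>R w)"])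
    fix s :: real assume s: "s \<in> {0..1}"
    show "(?k has_real_derivative fdiff (Suc u) (\<lambda>x. \<Sum>i\<in>UNIV. w$i * ?D i x) w (x + s *\<^sub>R w)) (at s within {0..1})"
    proof (rule fdiff_has_derivative)
      fix j assume j: "j \<le> Suc u"
      let ?y = "\<lambda>s. x + (s + real j) *\<^sub>R w"
      have yin: "?y ` {0..1} \<subseteq> unit_cube" using seg j by auto
      have "(?f has_derivative (\<lambda>w. \<Sum>i\<in>UNIV. w$i * ?D i (?y s))) (at (?y s) within unit_cube)"
        by (rule has_derivative_from_partials[OF hoelder_tower_partials_0[OF Suc.prems(1)] c]) (use yin s in blast)
      then have "(?f has_derivative (\<lambda>w. \<Sum>i\<in>UNIV. w$i * ?D i (?y s))) (at (?y s) within ?y ` {0..1})"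
        using yin has_derivative_subset by blast
      moreover have "(?y has_derivative (\<lambda>h. h *\<^sub>R w)) (at s within {0..1})"
        by (auto intro!: derivative_eq_intros)
      ultimately have "((\<lambda>s. ?f (?y s)) has_derivative (\<lambda>h. \<Sum>i\<in>UNIV. (h *\<^sub>R w)$i * ?D i (?y s))) (at s within {0..1})"
        by (rule has_derivative_in_compose[rotated])
      moreover have "(\<lambda>h. \<Sum>i\<in>UNIV. (h *\<^sub>R w)$i * ?D i (?y s)) = (*) (\<Sum>i\<in>UNIV. w$i * ?D i (?y s))"
        by (rule ext) (simp add: sum_distrib_left mult_ac)
      ultimately show "((\<lambda>s. ?f (?y s)) has_real_derivative (\<Sum>i\<in>UNIV. w$i * ?D i (?y s))) (at s within {0..1})"
        by (simp add: has_field_derivative_def)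
    qed
    have "\<bar>fdiff (Suc u) (\<lambda>x. \<Sum>i\<in>UNIV. w$i * ?D i x) w (x + s *\<^sub>R w)\<bar> \<le> (\<Sum>i\<in>(UNIV::'d set). \<bar>w$i * fdiff (Suc u) (?D i) w (x + s *\<^sub>R w)\<bar>)"
      unfolding fdiff_sum by (rule sum_abs)
    also have "\<dots> \<le> (\<Sum>i\<in>(UNIV::'d set). norm w * (c0 * real CARD('d) ^ u * norm w powr (real u + v)))"
    proof (rule sum_mono)
      fix i :: 'd
      have e: "x + s *\<^sub>R w + real (Suc u) *\<^sub>R w = x + (s + real (Suc u)) *\<^sub>R w" by (simp add: algebra_simps)
      have "\<bar>fdiff (Suc u) (?D i) w (x + s *\<^sub>R w)\<bar> \<le> c0 * real CARD('d) ^ u * norm w powr (real u + v)"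
        using Suc.IH[OF tower, of "x + s *\<^sub>R w" i] Suc.prems s seg unfolding e by (auto simp: fun_upd_def)
      then show "\<bar>w$i * fdiff (Suc u) (?D i) w (x + s *\<^sub>R w)\<bar> \<le> norm w * (c0 * real CARD('d) ^ u * norm w powr (real u + v))"
        unfolding abs_mult by (intro mult_mono component_le_norm_cart) auto
    qed
    also have "\<dots> = c0 * real CARD('d) ^ Suc u * (norm w * norm w powr (real u + v))" by simp
    also have "norm w * norm w powr (real u + v) = norm w powr (real (Suc u) + v)"
      by (subst powr_mult_base) (auto simp: add.assoc)
    finally show "norm (fdiff (Suc u) (\<lambda>x. \<Sum>i\<in>UNIV. w$i * ?D i x) w (x + s *\<^sub>R w)) \<le> c0 * real CARD('d) ^ Suc u * norm w powr (real (Suc u) + v)"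
      unfolding real_norm_def .
  qed auto
  then show ?case by simp
qed

section \<open>Gaussian averages and features\<close>

lemma nn_integral_lborel_affine:
  fixes t :: "'a::euclidean_space"
  assumes [measurable]: "f \<in> borel_measurable borel" and c: "c \<noteq> 0"
  shows "(\<integral>\<^sup>+x. f x \<partial>lborel) = ennreal (\<bar>c\<bar> ^ DIM('a)) * (\<integral>\<^sup>+x. f (t + c *\<^sub>R x) \<partial>lborel)"
  by (subst lborel_affine[OF c, of t]) (simp add: nn_integral_density nn_integral_distr nn_integral_cmult)

lemma lborel_integral_affine:
  fixes t :: "'a::euclidean_space" and f :: "'a \<Rightarrow> real"
  assumes [measurable]: "f \<in> borel_measurable borel" and c: "c \<noteq> 0"
  shows "(\<integral>x. f x \<partial>lborel) = \<bar>c\<bar> ^ DIM('a) * (\<integral>x. f (t + c *\<^sub>R x) \<partial>lborel)"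
  by (subst lborel_affine[OF c, of t]) (simp add: integral_density integral_distr)

lemma lborel_integrable_affine:
  fixes t :: "'a::euclidean_space" and f :: "'a \<Rightarrow> real"
  assumes f: "integrable lborel f" and c: "c \<noteq> 0"
  shows "integrable lborel (\<lambda>x. f (t + c *\<^sub>R x))"
proof -
  have [measurable]: "f \<in> borel_measurable borel" using f by auto
  have "(\<integral>\<^sup>+x. norm (f x) \<partial>lborel) < \<infinity>" using f by (simp add: integrable_iff_bounded)
  then have "ennreal (\<bar>c\<bar> ^ DIM('a)) * (\<integral>\<^sup>+x. norm (f (t + c *\<^sub>R x)) \<partial>lborel) < \<infinity>"
    by (subst (asm) nn_integral_lborel_affine[OF _ c, of _ t]) auto
  then have "(\<integral>\<^sup>+x. norm (f (t + c *\<^sub>R x)) \<partial>lborel) < \<infinity>"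
    using c by (auto simp: ennreal_mult_less_top ennreal_zero_less_mult_iff)
  then show ?thesis by (simp add: integrable_iff_bounded)
qed

lemma integrable_gaussian_real:
  assumes "0 < a" shows "integrable lborel (\<lambda>x::real. exp (- a * x\<^sup>2))"
proof -
  define s where "s = sqrt (1 / (2 * a))"
  have s2: "s\<^sup>2 = 1 / (2 * a)" using assms by (simp add: s_def)
  have "integrable lborel (\<lambda>x. sqrt (2 * pi * s\<^sup>2) * normal_density 0 s x)"
    using assms by (intro integrable_mult_right integrable_normal_density) (simp add: s_def)
  moreover have "sqrt (2 * pi * s\<^sup>2) * normal_density 0 s x = exp (- a * x\<^sup>2)" for x
    using assms unfolding normal_density_def s2 by (simp add: real_sqrt_divide field_simps)
  ultimately show ?thesis by simp
qed

lemma integrable_gaussian: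
  assumes "0 < a" shows "integrable lborel (\<lambda>x::'a::euclidean_space. exp (- a * (norm x)\<^sup>2))"
proof (rule integrableI_nonneg)
  have "exp (- a * (norm x)\<^sup>2) = (\<Prod>b\<in>Basis. exp (- a * (x \<bullet> b)\<^sup>2))" for x :: 'a
  proof -
    have "(norm x)\<^sup>2 = (\<Sum>b\<in>Basis. (x \<bullet> b)\<^sup>2)"
      unfolding power2_norm_eq_inner by (subst euclidean_inner) (simp add: power2_eq_square)
    then show ?thesis by (simp add: exp_sum[symmetric] sum_distrib_left sum_negf)
  qed
  then have "(\<integral>\<^sup>+x. ennreal (exp (- a * (norm (x::'a))\<^sup>2)) \<partial>lborel) = (\<integral>\<^sup>+x. (\<Prod>b\<in>Basis. ennreal (exp (- a * ((x::'a) \<bullet> b)\<^sup>2))) \<partial>lborel)"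
    by (simp add: prod_ennreal)
  also have "\<dots> = (\<Prod>b\<in>(Basis::'a set). (\<integral>\<^sup>+x. ennreal (exp (- a * x\<^sup>2)) \<partial>lborel))"
    by (rule nn_integral_lborel_prod) auto
  also have "\<dots> < \<infinity>"
    using integrable_gaussian_real[OF assms] by (simp add: power_less_top_ennreal integrable_iff_bounded)
  finally show "(\<integral>\<^sup>+x. ennreal (exp (- a * (norm (x::'a))\<^sup>2)) \<partial>lborel) < \<infinity>" .
qed auto

section \<open>The Gaussian probability measure and its invariance under rotations\<close>

definition gauss_int :: "'a::euclidean_space itself \<Rightarrow> real \<Rightarrow> real" where
  "gauss_int _ a = (\<integral>x. exp (- a * (norm (x::'a))\<^sup>2) \<partial>lborel)"

lemma gauss_int_pos: assumes "0 < a" shows "0 < gauss_int TYPE('a::euclidean_space) a"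
proof -
  have "gauss_int TYPE('a) a \<noteq> 0"
  proof
    assume "gauss_int TYPE('a) a = 0"
    then have "AE x::'a in lborel. exp (- a * (norm x)\<^sup>2) = 0"
      unfolding gauss_int_def by (subst (asm) integral_nonneg_eq_0_iff_AE) (use integrable_gaussian[OF assms, where 'a = 'a] in auto)
    then have "AE x::'a in lborel. False" by simp
    then show False by (simp add: eventually_False ae_filter_eq_bot_iff)
  qed
  moreover have "0 \<le> gauss_int TYPE('a) a" unfolding gauss_int_def by (rule integral_nonneg_AE) auto
  ultimately show ?thesis by simp
qed

text \<open>The exponent 2 is matched to the kernel: translates of
  \<open>exp (- 2 \<bar>u\<bar>^2 / \<sigma>^2)\<close> have L2 inner products proportional to
  \<open>exp (- \<bar>x - x'\<bar>^2 / \<sigma>^2)\<close>.\<close>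

definition gauss_dens :: "'a::euclidean_space \<Rightarrow> real" where
  "gauss_dens z = exp (- 2 * (norm z)\<^sup>2) / gauss_int TYPE('a) 2"

definition gauss_meas :: "'a::euclidean_space measure" where
  "gauss_meas = density lborel (\<lambda>z. ennreal (gauss_dens z))"

lemma gauss_dens_measurable [measurable]: "gauss_dens \<in> borel_measurable borel"
  unfolding gauss_dens_def[abs_def] by measurable

lemma gauss_dens_nonneg: "0 \<le> gauss_dens z"
  using gauss_int_pos[of 2, where 'a = 'a] by (simp add: gauss_dens_def)

lemma sets_gauss_meas [measurable_cong]: "sets gauss_meas = sets borel"
  and space_gauss_meas [simp]: "space gauss_meas = UNIV"
  by (auto simp: gauss_meas_def)

lemma nn_integral_gauss_dens: "(\<integral>\<^sup>+z. ennreal (gauss_dens (z::'a::euclidean_space)) \<partial>lborel) = 1"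
proof -
  have i: "integrable lborel (\<lambda>z::'a. gauss_dens z)"
    unfolding gauss_dens_def by (intro integrable_divide_zero) (use integrable_gaussian[of 2, where 'a = 'a] in auto)
  have "(\<integral>z. gauss_dens (z::'a) \<partial>lborel) = 1"
    using gauss_int_pos[of 2, where 'a = 'a] unfolding gauss_dens_def by (simp add: gauss_int_def)
  then show ?thesis using nn_integral_eq_integral[OF i] by (simp add: gauss_dens_nonneg)
qed

lemma prob_space_gauss_meas: "prob_space (gauss_meas :: 'a::euclidean_space measure)"
  by (rule prob_spaceI) (simp add: gauss_meas_def emeasure_density nn_integral_gauss_dens)

text \<open>With \<open>y = \<alpha> z + \<beta> w\<close> the pair \<open>(z, w)\<close> is rotated
  to \<open>y\<close> and \<open>(z - \<alpha> y) / \<beta>\<close> up to sign, and a rotation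
  preserves the sum of squared norms.\<close>

lemma gauss_dens_rotate:
  fixes y z :: "'a::euclidean_space"
  assumes b: "0 < \<beta>" and ab: "\<alpha>\<^sup>2 + \<beta>\<^sup>2 = 1"
  shows "gauss_dens z * gauss_dens ((1 / \<beta>) *\<^sub>R (y - \<alpha> *\<^sub>R z)) = gauss_dens y * gauss_dens ((1 / \<beta>) *\<^sub>R (z - \<alpha> *\<^sub>R y))"
proof -
  have "\<beta>\<^sup>2 * (norm z)\<^sup>2 + (norm (y - \<alpha> *\<^sub>R z))\<^sup>2 = \<beta>\<^sup>2 * (norm y)\<^sup>2 + (norm (z - \<alpha> *\<^sub>R y))\<^sup>2"
  proof -
    have b2: "\<beta>\<^sup>2 = 1 - \<alpha>\<^sup>2" using ab by simp
    show ?thesis unfolding b2 power2_norm_eq_inner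
      by (simp add: inner_diff_left inner_diff_right inner_commute algebra_simps power2_eq_square)
  qed
  then have "(\<beta>\<^sup>2 * (norm z)\<^sup>2 + (norm (y - \<alpha> *\<^sub>R z))\<^sup>2) / \<beta>\<^sup>2 = (\<beta>\<^sup>2 * (norm y)\<^sup>2 + (norm (z - \<alpha> *\<^sub>R y))\<^sup>2) / \<beta>\<^sup>2" by simp
  then have "(norm z)\<^sup>2 + (norm ((1 / \<beta>) *\<^sub>R (y - \<alpha> *\<^sub>R z)))\<^sup>2 = (norm y)\<^sup>2 + (norm ((1 / \<beta>) *\<^sub>R (z - \<alpha> *\<^sub>R y)))\<^sup>2"
    using b by (simp add: add_divide_distrib power_divide)
  then have "exp (- 2 * ((norm z)\<^sup>2 + (norm ((1 / \<beta>) *\<^sub>R (y - \<alpha> *\<^sub>R z)))\<^sup>2)) = exp (- 2 * ((norm y)\<^sup>2 + (norm ((1 / \<beta>) *\<^sub>R (z - \<alpha> *\<^sub>R y)))\<^sup>2))"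
    by simp
  then show ?thesis unfolding gauss_dens_def by (simp add: exp_add[symmetric] distrib_left del: norm_scaleR)
qed

text \<open>Stability of the Gaussian: substitute \<open>w = (y - \<alpha> z) / \<beta>\<close>,
  exchange the roles of \<open>y\<close> and \<open>z\<close> by \<open>gauss_dens_rotate\<close>,
  and integrate \<open>z\<close> out.\<close>

lemma distr_gauss_meas_rotate:
  assumes b: "0 < \<beta>" and ab: "\<alpha>\<^sup>2 + \<beta>\<^sup>2 = 1"
  shows "distr (gauss_meas \<Otimes>\<^sub>M gauss_meas) borel (\<lambda>(z, w). \<alpha> *\<^sub>R z + \<beta> *\<^sub>R w) = (gauss_meas :: 'a::euclidean_space measure)"
proof (rule measure_eqI)
  interpret prob_space "gauss_meas :: 'a measure" by (rule prob_space_gauss_meas)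
  let ?W = "\<lambda>z::'a. ennreal (gauss_dens z)"
  fix A :: "'a set" assume "A \<in> sets (distr (gauss_meas \<Otimes>\<^sub>M gauss_meas) borel (\<lambda>(z, w). \<alpha> *\<^sub>R z + \<beta> *\<^sub>R w))"
  then have A [measurable]: "A \<in> sets borel" by simp
  have [measurable]: "A \<in> sets gauss_meas" by (simp add: sets_gauss_meas)
  have "emeasure (distr (gauss_meas \<Otimes>\<^sub>M gauss_meas) borel (\<lambda>(z, w). \<alpha> *\<^sub>R z + \<beta> *\<^sub>R w)) A
     = (\<integral>\<^sup>+p. indicator A (\<alpha> *\<^sub>R fst p + \<beta> *\<^sub>R snd p) \<partial>(gauss_meas \<Otimes>\<^sub>M gauss_meas))"
    by (subst nn_integral_indicator[symmetric], simp, subst nn_integral_distr) (auto simp: case_prod_beta)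
  also have "\<dots> = (\<integral>\<^sup>+z. \<integral>\<^sup>+w. indicator A (\<alpha> *\<^sub>R z + \<beta> *\<^sub>R w) \<partial>gauss_meas \<partial>gauss_meas)"
    by (subst nn_integral_fst[symmetric]) auto
  also have "\<dots> = (\<integral>\<^sup>+z. ?W z * (\<integral>\<^sup>+w. ?W w * indicator A (\<alpha> *\<^sub>R z + \<beta> *\<^sub>R w) \<partial>lborel) \<partial>lborel)"
    unfolding gauss_meas_def by (simp add: nn_integral_density)
  also have "\<dots> = (\<integral>\<^sup>+z. ?W z * (ennreal ((1/\<beta>) ^ DIM('a)) * (\<integral>\<^sup>+y. ?W ((1/\<beta>) *\<^sub>R (y - \<alpha> *\<^sub>R z)) * indicator A y \<partial>lborel)) \<partial>lborel)"
  proof (rule nn_integral_cong)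
    fix z :: 'a
    have "(\<integral>\<^sup>+w. ?W w * indicator A (\<alpha> *\<^sub>R z + \<beta> *\<^sub>R w) \<partial>lborel)
      = ennreal (\<bar>1/\<beta>\<bar> ^ DIM('a)) * (\<integral>\<^sup>+y. ?W (- (\<alpha>/\<beta>) *\<^sub>R z + (1/\<beta>) *\<^sub>R y) * indicator A (\<alpha> *\<^sub>R z + \<beta> *\<^sub>R (- (\<alpha>/\<beta>) *\<^sub>R z + (1/\<beta>) *\<^sub>R y)) \<partial>lborel)"
      by (rule nn_integral_lborel_affine) (use b in auto)
    moreover have "- (\<alpha>/\<beta>) *\<^sub>R z + (1/\<beta>) *\<^sub>R y = (1/\<beta>) *\<^sub>R (y - \<alpha> *\<^sub>R z)" for y
      by (simp add: scaleR_diff_right)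
    moreover have "\<alpha> *\<^sub>R z + \<beta> *\<^sub>R ((1/\<beta>) *\<^sub>R (y - \<alpha> *\<^sub>R z)) = y" for y using b by simp
    ultimately show "?W z * (\<integral>\<^sup>+w. ?W w * indicator A (\<alpha> *\<^sub>R z + \<beta> *\<^sub>R w) \<partial>lborel) = ?W z * (ennreal ((1/\<beta>) ^ DIM('a)) * (\<integral>\<^sup>+y. ?W ((1/\<beta>) *\<^sub>R (y - \<alpha> *\<^sub>R z)) * indicator A y \<partial>lborel))"
      using b by simp
  qed
  also have "\<dots> = (\<integral>\<^sup>+z. \<integral>\<^sup>+y. ennreal ((1/\<beta>) ^ DIM('a)) * (?W z * ?W ((1/\<beta>) *\<^sub>R (y - \<alpha> *\<^sub>R z)) * indicator A y) \<partial>lborel \<partial>lborel)"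
  proof (rule nn_integral_cong)
    fix z :: 'a
    have "(\<integral>\<^sup>+y. ennreal ((1/\<beta>) ^ DIM('a)) * (?W z * ?W ((1/\<beta>) *\<^sub>R (y - \<alpha> *\<^sub>R z)) * indicator A y) \<partial>lborel)
      = (\<integral>\<^sup>+y. (?W z * ennreal ((1/\<beta>) ^ DIM('a))) * (?W ((1/\<beta>) *\<^sub>R (y - \<alpha> *\<^sub>R z)) * indicator A y) \<partial>lborel)"
      by (simp add: ac_simps)
    also have "\<dots> = (?W z * ennreal ((1/\<beta>) ^ DIM('a))) * (\<integral>\<^sup>+y. ?W ((1/\<beta>) *\<^sub>R (y - \<alpha> *\<^sub>R z)) * indicator A y \<partial>lborel)"
      by (rule nn_integral_cmult) measurable
    finally show "?W z * (ennreal ((1/\<beta>) ^ DIM('a)) * (\<integral>\<^sup>+y. ?W ((1/\<beta>) *\<^sub>R (y - \<alpha> *\<^sub>R z)) * indicator A y \<partial>lborel))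
      = (\<integral>\<^sup>+y. ennreal ((1/\<beta>) ^ DIM('a)) * (?W z * ?W ((1/\<beta>) *\<^sub>R (y - \<alpha> *\<^sub>R z)) * indicator A y) \<partial>lborel)"
      by (simp add: ac_simps)
  qed
  also have "\<dots> = (\<integral>\<^sup>+z. \<integral>\<^sup>+y. ennreal ((1/\<beta>) ^ DIM('a)) * (?W y * ?W ((1/\<beta>) *\<^sub>R (z - \<alpha> *\<^sub>R y)) * indicator A y) \<partial>lborel \<partial>lborel)"
    by (simp only: ennreal_mult[symmetric] gauss_dens_nonneg gauss_dens_rotate[OF b ab])
  also have "\<dots> = (\<integral>\<^sup>+y. \<integral>\<^sup>+z. ennreal ((1/\<beta>) ^ DIM('a)) * (?W y * ?W ((1/\<beta>) *\<^sub>R (z - \<alpha> *\<^sub>R y)) * indicator A y) \<partial>lborel \<partial>lborel)"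
    by (rule lborel_pair.Fubini') auto
  also have "\<dots> = (\<integral>\<^sup>+y. ?W y * indicator A y \<partial>lborel)"
  proof (rule nn_integral_cong)
    fix y :: 'a
    have "(\<integral>\<^sup>+z. ?W ((1/\<beta>) *\<^sub>R (z - \<alpha> *\<^sub>R y)) \<partial>lborel) = ennreal (\<bar>\<beta>\<bar> ^ DIM('a)) * (\<integral>\<^sup>+z. ?W ((1/\<beta>) *\<^sub>R (\<alpha> *\<^sub>R y + \<beta> *\<^sub>R z - \<alpha> *\<^sub>R y)) \<partial>lborel)"
      by (rule nn_integral_lborel_affine) (use b in auto)
    also have "\<dots> = ennreal (\<beta> ^ DIM('a))" using b by (simp add: nn_integral_gauss_dens)
    finally have I: "(\<integral>\<^sup>+z. ?W ((1/\<beta>) *\<^sub>R (z - \<alpha> *\<^sub>R y)) \<partial>lborel) = ennreal (\<beta> ^ DIM('a))" .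
    have "(\<integral>\<^sup>+z. ennreal ((1/\<beta>) ^ DIM('a)) * (?W y * ?W ((1/\<beta>) *\<^sub>R (z - \<alpha> *\<^sub>R y)) * indicator A y) \<partial>lborel)
      = (\<integral>\<^sup>+z. (ennreal ((1/\<beta>) ^ DIM('a)) * ?W y * indicator A y) * ?W ((1/\<beta>) *\<^sub>R (z - \<alpha> *\<^sub>R y)) \<partial>lborel)"
      by (simp add: ac_simps)
    also have "\<dots> = (ennreal ((1/\<beta>) ^ DIM('a)) * ?W y * indicator A y) * ennreal (\<beta> ^ DIM('a))"
      by (subst nn_integral_cmult) (auto simp: I)
    also have "\<dots> = (ennreal ((1/\<beta>) ^ DIM('a)) * ennreal (\<beta> ^ DIM('a))) * (?W y * indicator A y)"
      by (simp add: ac_simps)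
    also have "ennreal ((1/\<beta>) ^ DIM('a)) * ennreal (\<beta> ^ DIM('a)) = 1"
      using b by (simp add: ennreal_mult[symmetric] power_mult_distrib[symmetric])
    finally show "(\<integral>\<^sup>+z. ennreal ((1/\<beta>) ^ DIM('a)) * (?W y * ?W ((1/\<beta>) *\<^sub>R (z - \<alpha> *\<^sub>R y)) * indicator A y) \<partial>lborel) = ?W y * indicator A y"
      by simp
  qed
  also have "\<dots> = emeasure gauss_meas A" by (simp add: gauss_meas_def emeasure_density)
  finally show "emeasure (distr (gauss_meas \<Otimes>\<^sub>M gauss_meas) borel (\<lambda>(z, w). \<alpha> *\<^sub>R z + \<beta> *\<^sub>R w)) A = emeasure gauss_meas A" .
qed (simp add: sets_gauss_meas)

section \<open>L2 features of the Gaussian kernel\<close>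

lemma integral_Cauchy_Schwarz:
  fixes f g :: "'a \<Rightarrow> real"
  assumes f: "integrable M (\<lambda>x. (f x)\<^sup>2)" and g: "integrable M (\<lambda>x. (g x)\<^sup>2)" and fg: "integrable M (\<lambda>x. f x * g x)"
  shows "(\<integral>x. f x * g x \<partial>M)\<^sup>2 \<le> (\<integral>x. (f x)\<^sup>2 \<partial>M) * (\<integral>x. (g x)\<^sup>2 \<partial>M)"
proof -
  let ?A = "\<integral>x. (f x)\<^sup>2 \<partial>M" and ?B = "\<integral>x. (g x)\<^sup>2 \<partial>M" and ?C = "\<integral>x. f x * g x \<partial>M"
  have q: "0 \<le> t\<^sup>2 * ?A - 2 * t * ?C + ?B" for t
  proof -
    have "0 \<le> (\<integral>x. (t * f x - g x)\<^sup>2 \<partial>M)" by (rule integral_nonneg_AE) auto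
    also have "\<dots> = (\<integral>x. t\<^sup>2 * (f x)\<^sup>2 - (2 * t) * (f x * g x) + (g x)\<^sup>2 \<partial>M)"
      by (rule Bochner_Integration.integral_cong) (auto simp: power2_eq_square algebra_simps)
    also have "\<dots> = t\<^sup>2 * ?A - 2 * t * ?C + ?B"
      using f g fg by (simp add: integral_add integral_diff)
    finally show ?thesis .
  qed
  have A: "0 \<le> ?A" by (rule integral_nonneg_AE) auto
  show ?thesis
  proof (cases "?A = 0")
    case True
    have "?C = 0"
    proof (rule ccontr)
      assume C: "?C \<noteq> 0"
      \<comment> \<open>For \<open>?A = 0\<close> the quadratic is affine in \<open>t\<close>; this
        \<open>t\<close> makes its value -1.\<close>
      have "2 * ((?B + 1) / (2 * ?C)) * ?C = ?B + 1" using C by simp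
      then show False using q[of "(?B + 1) / (2 * ?C)", unfolded True] by linarith
    qed
    then show ?thesis using True by simp
  next
    case False
    then have "?A > 0" using A by (simp add: less_le)
    moreover have "0 \<le> (?C / ?A)\<^sup>2 * ?A - 2 * (?C / ?A) * ?C + ?B" by (rule q)
    ultimately show ?thesis by (simp add: field_simps power2_eq_square)
  qed
qed

text \<open>A feature map of the Gaussian kernel into L2 of Lebesgue measure, up to the constant in
  \<open>gauss_feature_inner\<close>.\<close>

definition gauss_feature :: "real \<Rightarrow> 'a::euclidean_space \<Rightarrow> 'a \<Rightarrow> real" where
  "gauss_feature \<sigma> x u = exp (- 2 * (norm ((1 / \<sigma>) *\<^sub>R (u - x)))\<^sup>2)"

lemma gauss_feature_measurable [measurable]: "gauss_feature \<sigma> x \<in> borel_measurable borel"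
  unfolding gauss_feature_def[abs_def] by measurable

text \<open>The parallelogram identity about the midpoint of \<open>x\<close> and \<open>x'\<close>
  separates the kernel from a Gaussian in \<open>u\<close>.\<close>

lemma gauss_feature_prod:
  fixes x x' :: "real^'d" assumes s: "0 < \<sigma>"
  shows "gauss_feature \<sigma> x u * gauss_feature \<sigma> x' u
    = gauss_kernel \<sigma> x x' * exp (- 4 * (norm ((1 / \<sigma>) *\<^sub>R (u - (1/2) *\<^sub>R (x + x'))))\<^sup>2)"
proof -
  have "2 * (norm (u - x))\<^sup>2 + 2 * (norm (u - x'))\<^sup>2 = (norm (x - x'))\<^sup>2 + 4 * (norm (u - (1/2) *\<^sub>R (x + x')))\<^sup>2"
    unfolding power2_norm_eq_inner
    by (simp add: inner_diff_left inner_diff_right inner_add_left inner_add_right inner_commute algebra_simps)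
  then have "(2 * (norm (u - x))\<^sup>2 + 2 * (norm (u - x'))\<^sup>2) / \<sigma>\<^sup>2 = ((norm (x - x'))\<^sup>2 + 4 * (norm (u - (1/2) *\<^sub>R (x + x')))\<^sup>2) / \<sigma>\<^sup>2"
    by simp
  then show ?thesis unfolding gauss_feature_def gauss_kernel_def exp_add[symmetric] using s
    by (simp add: power_divide add_divide_distrib)
qed

lemma gauss_feature_inner:
  fixes x x' :: "real^'d" assumes s: "0 < \<sigma>"
  shows "integrable lborel (\<lambda>u. gauss_feature \<sigma> x u * gauss_feature \<sigma> x' u)"
    and "(\<integral>u. gauss_feature \<sigma> x u * gauss_feature \<sigma> x' u \<partial>lborel)
         = \<sigma> ^ CARD('d) * gauss_int TYPE(real^'d) 4 * gauss_kernel \<sigma> x x'"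
proof -
  let ?m = "(1/2) *\<^sub>R (x + x')"
  have e: "(1 / \<sigma>) *\<^sub>R (u - ?m) = - ((1/\<sigma>) *\<^sub>R ?m) + (1/\<sigma>) *\<^sub>R u" for u
    by (simp add: scaleR_diff_right)
  have "integrable lborel (\<lambda>u. exp (- 4 * (norm (- ((1/\<sigma>) *\<^sub>R ?m) + (1/\<sigma>) *\<^sub>R u))\<^sup>2))"
    by (rule lborel_integrable_affine[where f = "\<lambda>u::real^'d. exp (- 4 * (norm u)\<^sup>2)"])
       (use integrable_gaussian[of 4, where 'a = "real^'d"] s in auto)
  then show "integrable lborel (\<lambda>u. gauss_feature \<sigma> x u * gauss_feature \<sigma> x' u)"
    unfolding gauss_feature_prod[OF s] e by simp
  have "(\<integral>u. exp (- 4 * (norm ((1 / \<sigma>) *\<^sub>R (u - ?m)))\<^sup>2) \<partial>lborel)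
     = \<bar>\<sigma>\<bar> ^ DIM(real^'d) * (\<integral>z. exp (- 4 * (norm ((1 / \<sigma>) *\<^sub>R (?m + \<sigma> *\<^sub>R z - ?m)))\<^sup>2) \<partial>lborel)"
    by (rule lborel_integral_affine) (use s in auto)
  also have "\<dots> = \<sigma> ^ CARD('d) * gauss_int TYPE(real^'d) 4" using s by (simp add: gauss_int_def)
  finally show "(\<integral>u. gauss_feature \<sigma> x u * gauss_feature \<sigma> x' u \<partial>lborel)
         = \<sigma> ^ CARD('d) * gauss_int TYPE(real^'d) 4 * gauss_kernel \<sigma> x x'"
    unfolding gauss_feature_prod[OF s] by simp
qed

lemma gauss_feature_integrable:
  fixes x :: "real^'d" assumes s: "0 < \<sigma>"
  shows "integrable lborel (gauss_feature \<sigma> x)"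
proof -
  have "integrable lborel (\<lambda>u. exp (- 2 * (norm (- ((1/\<sigma>) *\<^sub>R x) + (1/\<sigma>) *\<^sub>R u))\<^sup>2))"
    by (rule lborel_integrable_affine[where f = "\<lambda>u::real^'d. exp (- 2 * (norm u)\<^sup>2)"])
       (use integrable_gaussian[of 2, where 'a = "real^'d"] s in auto)
  then show ?thesis unfolding gauss_feature_def[abs_def] by (simp add: scaleR_diff_right)
qed

lemma gauss_feature_sum_sq:
  fixes S :: "(real^'d) set" assumes s: "0 < \<sigma>" and S: "finite S"
  shows "integrable lborel (\<lambda>u. (\<Sum>x\<in>S. c x * gauss_feature \<sigma> x u)\<^sup>2)"
    and "(\<integral>u. (\<Sum>x\<in>S. c x * gauss_feature \<sigma> x u)\<^sup>2 \<partial>lborel)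
       = \<sigma> ^ CARD('d) * gauss_int TYPE(real^'d) 4 * (\<Sum>x\<in>S. \<Sum>y\<in>S. c x * c y * gauss_kernel \<sigma> x y)"
proof -
  have e: "(\<Sum>x\<in>S. c x * gauss_feature \<sigma> x u)\<^sup>2 = (\<Sum>x\<in>S. \<Sum>y\<in>S. (c x * c y) * (gauss_feature \<sigma> x u * gauss_feature \<sigma> y u))" for u
    by (simp add: power2_eq_square sum_product ac_simps)
  show "integrable lborel (\<lambda>u. (\<Sum>x\<in>S. c x * gauss_feature \<sigma> x u)\<^sup>2)"
    unfolding e by (intro Bochner_Integration.integrable_sum integrable_mult_right gauss_feature_inner s)
  have "(\<integral>u. (\<Sum>x\<in>S. c x * gauss_feature \<sigma> x u)\<^sup>2 \<partial>lborel)
     = (\<Sum>x\<in>S. \<Sum>y\<in>S. (c x * c y) * (\<sigma> ^ CARD('d) * gauss_int TYPE(real^'d) 4 * gauss_kernel \<sigma> x y))"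
    unfolding e
    by (subst Bochner_Integration.integral_sum,
        (intro Bochner_Integration.integrable_sum integrable_mult_right gauss_feature_inner s),
        subst Bochner_Integration.integral_sum,
        (intro Bochner_Integration.integrable_sum integrable_mult_right gauss_feature_inner s))
       (simp add: gauss_feature_inner[OF s])
  then show "(\<integral>u. (\<Sum>x\<in>S. c x * gauss_feature \<sigma> x u)\<^sup>2 \<partial>lborel)
       = \<sigma> ^ CARD('d) * gauss_int TYPE(real^'d) 4 * (\<Sum>x\<in>S. \<Sum>y\<in>S. c x * c y * gauss_kernel \<sigma> x y)"
    by (simp add: sum_distrib_left ac_simps)
qed

text \<open>The form is a positive multiple of the squared L2 norm of the combined features.\<close>

lemma gauss_kernel_psd:
  fixes S :: "(real^'d) set" assumes s: "0 < \<sigma>" and S: "finite S"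
  shows "0 \<le> (\<Sum>x\<in>S. \<Sum>y\<in>S. c x * c y * gauss_kernel \<sigma> x y)"
proof -
  have "0 \<le> (\<integral>u. (\<Sum>x\<in>S. c x * gauss_feature \<sigma> x u)\<^sup>2 \<partial>lborel)" by (rule integral_nonneg_AE) auto
  moreover have "0 < \<sigma> ^ CARD('d) * gauss_int TYPE(real^'d) 4" using s gauss_int_pos[of 4, where 'a = "real^'d"] by simp
  ultimately show ?thesis unfolding gauss_feature_sum_sq[OF s S] by (simp add: zero_le_mult_iff)
qed

text \<open>A Gaussian average of \<open>p\<close> at bandwidth \<open>\<sigma>\<close> is the inner
  product of \<open>p\<close> with the feature at \<open>x\<close>, divided by
  \<open>\<sigma> ^ d\<close>. Cauchy-Schwarz against the combined features produces the kernel
  form, so the squared RKHS norm of the average is of order \<open>P / \<sigma> ^ d\<close>.\<close>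

lemma gauss_smoothing_dual_bound:
  fixes p :: "real^'d \<Rightarrow> real"
  assumes s: "0 < \<sigma>" and S: "finite S" and [measurable]: "p \<in> borel_measurable borel"
    and pM: "\<And>u. \<bar>p u\<bar> \<le> M" and p2: "integrable lborel (\<lambda>u. (p u)\<^sup>2)" and P: "(\<integral>u. (p u)\<^sup>2 \<partial>lborel) \<le> P"
  shows "(\<Sum>x\<in>S. c x * (\<integral>z. p (x + \<sigma> *\<^sub>R z) \<partial>gauss_meas))\<^sup>2
     \<le> P * gauss_int TYPE(real^'d) 4 / (gauss_int TYPE(real^'d) 2)\<^sup>2 / \<sigma> ^ CARD('d) * (\<Sum>x\<in>S. \<Sum>y\<in>S. c x * c y * gauss_kernel \<sigma> x y)"
proof -
  let ?I = "gauss_int TYPE(real^'d) 2" and ?J = "gauss_int TYPE(real^'d) 4" and ?Q = "\<Sum>x\<in>S. \<Sum>y\<in>S. c x * c y * gauss_kernel \<sigma> x y"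
  let ?T = "\<lambda>u. \<Sum>x\<in>S. c x * gauss_feature \<sigma> x u"
  let ?k = "\<sigma> ^ CARD('d) * ?I"
  have I: "0 < ?I" "0 < ?J" by (auto intro: gauss_int_pos)
  have k: "0 < ?k" using s I by simp
  have ip: "integrable lborel (\<lambda>u. p u * gauss_feature \<sigma> x u)" for x
  proof (rule Bochner_Integration.integrable_bound)
    show "integrable lborel (\<lambda>u. M * gauss_feature \<sigma> x u)" by (intro integrable_mult_right gauss_feature_integrable s)
    show "AE u in lborel. norm (p u * gauss_feature \<sigma> x u) \<le> norm (M * gauss_feature \<sigma> x u)"
    proof (rule AE_I2)
      fix u
      have "\<bar>p u\<bar> \<le> \<bar>M\<bar>" using pM[of u] by simp
      then show "norm (p u * gauss_feature \<sigma> x u) \<le> norm (M * gauss_feature \<sigma> x u)"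
        by (simp add: abs_mult mult_right_mono)
    qed
  qed measurable
  have "(\<integral>z. p (x + \<sigma> *\<^sub>R z) \<partial>gauss_meas) = (\<integral>u. p u * gauss_feature \<sigma> x u \<partial>lborel) / ?k" for x
  proof -
    have "(\<integral>u. p u * gauss_feature \<sigma> x u \<partial>lborel)
       = \<bar>\<sigma>\<bar> ^ DIM(real^'d) * (\<integral>z. p (x + \<sigma> *\<^sub>R z) * gauss_feature \<sigma> x (x + \<sigma> *\<^sub>R z) \<partial>lborel)"
      by (rule lborel_integral_affine) (use s in auto)
    also have "(\<lambda>z. p (x + \<sigma> *\<^sub>R z) * gauss_feature \<sigma> x (x + \<sigma> *\<^sub>R z)) = (\<lambda>z. ?I * (gauss_dens z * p (x + \<sigma> *\<^sub>R z)))"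
      using s I by (auto simp: gauss_feature_def gauss_dens_def)
    also have "(\<integral>z. ?I * (gauss_dens z * p (x + \<sigma> *\<^sub>R z)) \<partial>lborel) = ?I * (\<integral>z. p (x + \<sigma> *\<^sub>R z) \<partial>gauss_meas)"
      unfolding gauss_meas_def by (subst integral_density) (auto simp: gauss_dens_nonneg)
    finally show ?thesis using k s I by (simp add: field_simps)
  qed
  then have "(\<Sum>x\<in>S. c x * (\<integral>z. p (x + \<sigma> *\<^sub>R z) \<partial>gauss_meas)) = (\<Sum>x\<in>S. c x * (\<integral>u. p u * gauss_feature \<sigma> x u \<partial>lborel)) / ?k"
    by (simp add: sum_divide_distrib)
  also have "(\<Sum>x\<in>S. c x * (\<integral>u. p u * gauss_feature \<sigma> x u \<partial>lborel)) = (\<integral>u. (\<Sum>x\<in>S. c x * (p u * gauss_feature \<sigma> x u)) \<partial>lborel)"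
    using ip by (simp add: Bochner_Integration.integral_sum)
  also have "(\<lambda>u. \<Sum>x\<in>S. c x * (p u * gauss_feature \<sigma> x u)) = (\<lambda>u. p u * ?T u)"
    by (simp add: sum_distrib_left ac_simps)
  finally have e: "(\<Sum>x\<in>S. c x * (\<integral>z. p (x + \<sigma> *\<^sub>R z) \<partial>gauss_meas)) = (\<integral>u. p u * ?T u \<partial>lborel) / ?k" .
  have ipT: "integrable lborel (\<lambda>u. p u * ?T u)"
  proof -
    have "integrable lborel (\<lambda>u. \<Sum>x\<in>S. c x * (p u * gauss_feature \<sigma> x u))" using ip by auto
    then show ?thesis by (simp add: sum_distrib_left ac_simps)
  qed
  have "(\<integral>u. p u * ?T u \<partial>lborel)\<^sup>2 \<le> (\<integral>u. (p u)\<^sup>2 \<partial>lborel) * (\<integral>u. (?T u)\<^sup>2 \<partial>lborel)"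
    by (rule integral_Cauchy_Schwarz[OF p2 gauss_feature_sum_sq(1)[OF s S] ipT])
  also have "\<dots> \<le> P * (\<integral>u. (?T u)\<^sup>2 \<partial>lborel)" by (rule mult_right_mono[OF P]) (auto intro: integral_nonneg_AE)
  also have "\<dots> = P * (\<sigma> ^ CARD('d) * ?J * ?Q)" unfolding gauss_feature_sum_sq(2)[OF s S] ..
  finally have "(\<integral>u. p u * ?T u \<partial>lborel)\<^sup>2 / ?k\<^sup>2 \<le> P * (\<sigma> ^ CARD('d) * ?J * ?Q) / ?k\<^sup>2"
    by (rule divide_right_mono) simp
  also have "\<dots> = P * ?J / ?I\<^sup>2 / \<sigma> ^ CARD('d) * ?Q"
    using s I by (simp add: field_simps power2_eq_square)
  finally show ?thesis unfolding e power_divide .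
qed

section \<open>Approximation in the Gaussian RKHS\<close>

lemma rkhs_norm_sq_le:
  assumes "0 \<le> B"
    and "\<And>S c. finite S \<Longrightarrow> S \<subseteq> X \<Longrightarrow> (\<Sum>x\<in>S. c x * f x)\<^sup>2 \<le> B * (\<Sum>x\<in>S. \<Sum>y\<in>S. c x * c y * K x y)"
  shows "rkhs_norm_sq K X f \<le> ereal B"
  unfolding rkhs_norm_sq_def
proof (rule Sup_least)
  fix y assume "y \<in> {0} \<union> {ereal ((\<Sum>x\<in>S. c x * f x)\<^sup>2 / (\<Sum>x\<in>S. \<Sum>y\<in>S. c x * c y * K x y)) | S c.
        finite S \<and> S \<subseteq> X \<and> (\<Sum>x\<in>S. \<Sum>y\<in>S. c x * c y * K x y) > 0}"
  then show "y \<le> ereal B"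
    using assms by (auto simp: divide_le_eq)
qed

lemma (in prob_space) abs_integral_le:
  fixes g :: "'a \<Rightarrow> real"
  assumes "\<And>x. \<bar>g x\<bar> \<le> b" shows "\<bar>\<integral>x. g x \<partial>M\<bar> \<le> b"
proof (cases "integrable M g")
  case True
  have "\<bar>\<integral>x. g x \<partial>M\<bar> \<le> (\<integral>x. \<bar>g x\<bar> \<partial>M)" by (rule integral_abs_bound)
  also have "\<dots> \<le> b" using True assms by (intro integral_le_const) auto
  finally show ?thesis .
next
  \<comment> \<open>A non-integrable function has integral 0 by convention, and \<open>b\<close> is
    nonnegative because it dominates an absolute value.\<close>
  case False
  then have "(\<integral>x. g x \<partial>M) = 0" by (rule not_integrable_integral_eq)
  then show ?thesis using assms[of undefined] by linarith
qed

text \<open>Half of the exponent is spent on \<open>exp (- R^2)\<close>, and the other half keeps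
  the integral finite.\<close>

lemma gauss_meas_tail:
  assumes "0 \<le> R"
  shows "measure (gauss_meas :: 'a::euclidean_space measure) {z. R < norm z}
    \<le> exp (- R\<^sup>2) * (gauss_int TYPE('a) 1 / gauss_int TYPE('a) 2)"
proof -
  let ?I = "gauss_int TYPE('a) 2"
  have I: "0 < ?I" by (rule gauss_int_pos) simp
  have i1: "integrable lborel (\<lambda>z::'a. exp (- R\<^sup>2) / ?I * exp (- 1 * (norm z)\<^sup>2))"
    by (intro integrable_mult_right integrable_gaussian) simp
  have A: "{z::'a. R < norm z} \<in> sets borel" by measurable
  have "emeasure gauss_meas {z::'a. R < norm z} = (\<integral>\<^sup>+z. ennreal (gauss_dens z) * indicator {z::'a. R < norm z} z \<partial>lborel)"
    unfolding gauss_meas_def by (rule emeasure_density) (use A in auto)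
  also have "\<dots> \<le> (\<integral>\<^sup>+z. ennreal (exp (- R\<^sup>2) / ?I * exp (- 1 * (norm (z::'a))\<^sup>2)) \<partial>lborel)"
  proof (rule nn_integral_mono)
    fix z :: 'a
    show "ennreal (gauss_dens z) * indicator {z::'a. R < norm z} z \<le> ennreal (exp (- R\<^sup>2) / ?I * exp (- 1 * (norm z)\<^sup>2))"
    proof (cases "R < norm z")
      case True
      then have "R\<^sup>2 \<le> (norm z)\<^sup>2" using assms by (intro power_mono) auto
      then have "exp (- 2 * (norm z)\<^sup>2) \<le> exp (- R\<^sup>2) * exp (- 1 * (norm z)\<^sup>2)" by (simp add: exp_add[symmetric])
      then have "gauss_dens z \<le> exp (- R\<^sup>2) / ?I * exp (- 1 * (norm z)\<^sup>2)"
        using I unfolding gauss_dens_def by (simp add: divide_right_mono)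
      then show ?thesis using True by (simp add: ennreal_leI)
    qed simp
  qed
  also have "\<dots> = ennreal (\<integral>z. exp (- R\<^sup>2) / ?I * exp (- 1 * (norm (z::'a))\<^sup>2) \<partial>lborel)"
    by (rule nn_integral_eq_integral[OF i1]) (use I in auto)
  also have "(\<integral>z. exp (- R\<^sup>2) / ?I * exp (- 1 * (norm (z::'a))\<^sup>2) \<partial>lborel) = exp (- R\<^sup>2) * (gauss_int TYPE('a) 1 / ?I)"
    by (simp add: gauss_int_def)
  finally show ?thesis unfolding measure_def
    using gauss_int_pos[of 1, where 'a = 'a] I by (intro enn2real_leI) auto
qed

section \<open>Gaussian averages with a drift towards the centre of the cube\<close>

definition cube_center :: "real^'d" where "cube_center = (\<chi> i. 1/2)"

definition gauss_pull :: "real \<Rightarrow> real \<Rightarrow> nat \<Rightarrow> (real^'d \<Rightarrow> real) \<Rightarrow> real^'d \<Rightarrow> real" where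
  "gauss_pull \<sigma> h j g x = (\<integral>z. g (x + real j *\<^sub>R (\<sigma> *\<^sub>R z + h *\<^sub>R (cube_center - x))) \<partial>gauss_meas)"

lemma gauss_pull_measurable [measurable]:
  assumes [measurable]: "g \<in> borel_measurable borel"
  shows "gauss_pull \<sigma> h j g \<in> borel_measurable borel"
proof -
  interpret prob_space "gauss_meas :: (real^'d) measure" by (rule prob_space_gauss_meas)
  show ?thesis unfolding gauss_pull_def[abs_def] by measurable
qed

lemma gauss_pull_abs_le:
  assumes "\<And>x. \<bar>g x\<bar> \<le> M" shows "\<bar>gauss_pull \<sigma> h j g x\<bar> \<le> M"
proof -
  interpret prob_space "gauss_meas :: (real^'d) measure" by (rule prob_space_gauss_meas)
  show ?thesis unfolding gauss_pull_def by (rule abs_integral_le) (rule assms)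
qed

text \<open>The noise is written as \<open>\<beta> w + \<alpha> z\<close> with independent
  \<open>w\<close>, \<open>z\<close>. The evaluation point becomes
  \<open>k w + t (x + \<sigma> z)\<close>, so for each frozen \<open>w\<close> the inner average
  smooths the dilated function \<open>p w\<close> at bandwidth exactly \<open>\<sigma>\<close>. The
  bound for it is uniform in \<open>w\<close> and survives averaging over \<open>w\<close>.\<close>

lemma gauss_pull_dual_bound:
  fixes g :: "real^'d \<Rightarrow> real"
  assumes s: "0 < \<sigma>" and S: "finite S" and g [measurable]: "g \<in> borel_measurable borel"
    and gM: "\<And>u. \<bar>g u\<bar> \<le> M" and g2: "integrable lborel (\<lambda>u. (g u)\<^sup>2)" and P: "(\<integral>u. (g u)\<^sup>2 \<partial>lborel) \<le> P"
    and j: "1 \<le> j" and h: "0 < h" "real j * h \<le> 1/2"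
  shows "(\<Sum>x\<in>S. c x * gauss_pull \<sigma> h j g x)\<^sup>2
     \<le> 2 ^ CARD('d) * P * gauss_int TYPE(real^'d) 4 / (gauss_int TYPE(real^'d) 2)\<^sup>2 / \<sigma> ^ CARD('d) * (\<Sum>x\<in>S. \<Sum>y\<in>S. c x * c y * gauss_kernel \<sigma> x y)"
    (is "_ \<le> ?B * ?Q")
proof -
  interpret G: prob_space "gauss_meas :: (real^'d) measure" by (rule prob_space_gauss_meas)
  interpret GG: pair_prob_space "gauss_meas :: (real^'d) measure" "gauss_meas :: (real^'d) measure" ..
  define t where "t = 1 - real j * h"
  have jh: "0 < real j * h" using j h by simp
  have t: "1/2 \<le> t" "t < 1" using h jh by (auto simp: t_def)
  \<comment> \<open>Chosen so that \<open>j \<alpha> = t\<close>: the coefficient of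
    \<open>\<sigma> z\<close> must equal the factor \<open>t\<close> by which \<open>x\<close> is
    contracted.\<close>
  define \<alpha> where "\<alpha> = t / real j"
  have "\<alpha> < 1" "0 < \<alpha>" using t j by (auto simp: \<alpha>_def divide_less_eq)
  then have "\<alpha>\<^sup>2 < 1" by (simp add: power_less_one_iff abs_square_less_1)
  define \<beta> where "\<beta> = sqrt (1 - \<alpha>\<^sup>2)"
  have \<beta>: "0 < \<beta>" using \<open>\<alpha>\<^sup>2 < 1\<close> by (simp add: \<beta>_def)
  have ab: "\<beta>\<^sup>2 + \<alpha>\<^sup>2 = 1" using \<open>\<alpha>\<^sup>2 < 1\<close> by (simp add: \<beta>_def)
  define k where "k w = (real j * h) *\<^sub>R cube_center + (real j * \<sigma> * \<beta>) *\<^sub>R w" for w :: "real^'d"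
  have k [measurable]: "k \<in> borel_measurable borel" unfolding k_def by measurable
  define p where "p w u = g (k w + t *\<^sub>R u)" for w u
  have p [measurable]: "p w \<in> borel_measurable borel" for w unfolding p_def by measurable
  have pm [measurable]: "(\<lambda>(w, z). p w (x + \<sigma> *\<^sub>R z)) \<in> borel_measurable (gauss_meas \<Otimes>\<^sub>M gauss_meas)" for x
    unfolding p_def case_prod_beta by measurable
  have ip: "integrable (gauss_meas \<Otimes>\<^sub>M gauss_meas) (\<lambda>(w, z). p w (x + \<sigma> *\<^sub>R z))" for x
    by (rule GG.P.integrable_const_bound[of _ M]) (use gM in \<open>auto simp: p_def\<close>)
  have pull: "gauss_pull \<sigma> h j g x = (\<integral>w. (\<integral>z. p w (x + \<sigma> *\<^sub>R z) \<partial>gauss_meas) \<partial>gauss_meas)" for x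
  proof -
    have "gauss_pull \<sigma> h j g x = (\<integral>y. g (x + real j *\<^sub>R (\<sigma> *\<^sub>R y + h *\<^sub>R (cube_center - x)))
        \<partial>(distr (gauss_meas \<Otimes>\<^sub>M gauss_meas) borel (\<lambda>(w, z). \<beta> *\<^sub>R w + \<alpha> *\<^sub>R z)))"
      unfolding gauss_pull_def distr_gauss_meas_rotate[OF \<open>0 < \<alpha>\<close> ab] ..
    also have "\<dots> = (\<integral>q. (case q of (w, z) \<Rightarrow> g (x + real j *\<^sub>R (\<sigma> *\<^sub>R (\<beta> *\<^sub>R w + \<alpha> *\<^sub>R z) + h *\<^sub>R (cube_center - x)))) \<partial>(gauss_meas \<Otimes>\<^sub>M gauss_meas))"
      by (subst integral_distr) (auto simp: case_prod_unfold)
    also have "\<dots> = (\<integral>q. (case q of (w, z) \<Rightarrow> p w (x + \<sigma> *\<^sub>R z)) \<partial>(gauss_meas \<Otimes>\<^sub>M gauss_meas))"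
    proof (rule Bochner_Integration.integral_cong[OF refl])
      fix q :: "(real^'d) \<times> (real^'d)"
      obtain w z where q: "q = (w, z)" by (cases q)
      have j\<alpha>: "real j * \<alpha> = t" using j by (simp add: \<alpha>_def)
      have "x + real j *\<^sub>R (\<sigma> *\<^sub>R (\<beta> *\<^sub>R w + \<alpha> *\<^sub>R z) + h *\<^sub>R (cube_center - x)) = k w + t *\<^sub>R (x + \<sigma> *\<^sub>R z)" (is "?l = ?r")
        unfolding vec_eq_iff
      proof
        fix i
        have "?l $ i - ?r $ i = (real j * \<alpha> - t) * (\<sigma> * z $ i)" by (simp add: k_def t_def algebra_simps)
        then show "?l $ i = ?r $ i" by (simp add: j\<alpha>)
      qed
      then show "(case q of (w, z) \<Rightarrow> g (x + real j *\<^sub>R (\<sigma> *\<^sub>R (\<beta> *\<^sub>R w + \<alpha> *\<^sub>R z) + h *\<^sub>R (cube_center - x)))) = (case q of (w, z) \<Rightarrow> p w (x + \<sigma> *\<^sub>R z))"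
        by (simp add: q p_def)
    qed
    also have "\<dots> = (\<integral>w. (\<integral>z. p w (x + \<sigma> *\<^sub>R z) \<partial>gauss_meas) \<partial>gauss_meas)"
      using GG.integral_fst'[OF ip[of x]] by simp
    finally show ?thesis .
  qed
  have Q: "0 \<le> ?Q" by (rule gauss_kernel_psd[OF s S])
  have "0 \<le> (\<integral>u. (g u)\<^sup>2 \<partial>lborel)" by (rule integral_nonneg_AE) auto
  then have P0: "0 \<le> P" using P by linarith
  have B: "0 \<le> ?B" using P0 gauss_int_pos[of 4, where 'a = "real^'d"] s by (simp add: less_imp_le)
  have "\<bar>\<Sum>x\<in>S. c x * (\<integral>z. p w (x + \<sigma> *\<^sub>R z) \<partial>gauss_meas)\<bar> \<le> sqrt (?B * ?Q)" for w
  proof -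
    have g2': "(\<integral>u. (g u)\<^sup>2 \<partial>lborel) = \<bar>t\<bar> ^ DIM(real^'d) * (\<integral>u. (p w u)\<^sup>2 \<partial>lborel)"
      unfolding p_def by (rule lborel_integral_affine) (use t in auto)
    have p0: "0 \<le> (\<integral>u. (p w u)\<^sup>2 \<partial>lborel)" by (rule integral_nonneg_AE) auto
    \<comment> \<open>Undoing the dilation by \<open>t \<ge> 1/2\<close> enlarges the squared L2
      norm at most by \<open>2 ^ CARD('d)\<close>.\<close>
    have "(1/2) ^ CARD('d) * (\<integral>u. (p w u)\<^sup>2 \<partial>lborel) \<le> t ^ CARD('d) * (\<integral>u. (p w u)\<^sup>2 \<partial>lborel)"
      using t p0 by (intro mult_right_mono power_mono) auto
    also have "\<dots> \<le> P" using g2' P t by simp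
    finally have P': "(\<integral>u. (p w u)\<^sup>2 \<partial>lborel) \<le> 2 ^ CARD('d) * P" by (simp add: power_one_over field_simps)
    have ip2: "integrable lborel (\<lambda>u. (p w u)\<^sup>2)"
      unfolding p_def by (rule lborel_integrable_affine[OF g2]) (use t in auto)
    have "(\<Sum>x\<in>S. c x * (\<integral>z. p w (x + \<sigma> *\<^sub>R z) \<partial>gauss_meas))\<^sup>2 \<le> ?B * ?Q"
      by (rule gauss_smoothing_dual_bound[OF s S p _ ip2 P', of M]) (auto simp: p_def gM)
    then have "sqrt ((\<Sum>x\<in>S. c x * (\<integral>z. p w (x + \<sigma> *\<^sub>R z) \<partial>gauss_meas))\<^sup>2) \<le> sqrt (?B * ?Q)" by (rule real_sqrt_le_mono)
    then show ?thesis by simp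
  qed
  then have "\<bar>\<integral>w. (\<Sum>x\<in>S. c x * (\<integral>z. p w (x + \<sigma> *\<^sub>R z) \<partial>gauss_meas)) \<partial>gauss_meas\<bar> \<le> sqrt (?B * ?Q)"
    by (rule G.abs_integral_le)
  also have "(\<integral>w. (\<Sum>x\<in>S. c x * (\<integral>z. p w (x + \<sigma> *\<^sub>R z) \<partial>gauss_meas)) \<partial>gauss_meas) = (\<Sum>x\<in>S. c x * gauss_pull \<sigma> h j g x)"
    unfolding pull using GG.integrable_fst'[OF ip] by (subst Bochner_Integration.integral_sum) auto
  finally have "\<bar>\<Sum>x\<in>S. c x * gauss_pull \<sigma> h j g x\<bar>\<^sup>2 \<le> (sqrt (?B * ?Q))\<^sup>2" by (intro power_mono) auto
  then show ?thesis unfolding real_sqrt_pow2[OF mult_nonneg_nonneg[OF B Q]] power2_abs .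
qed

text \<open>With \<open>J = j (2 R \<sigma>)\<close> each coordinate is
  \<open>(1 - J) x$i + J / 2\<close> plus noise of size at most \<open>j \<sigma> R = J / 2\<close>;
  the drift leaves exactly the room that the noise may use.\<close>

lemma cube_shift_mem:
  fixes x z :: "real^'d"
  assumes x: "x \<in> unit_cube" and z: "norm z \<le> R" and s: "0 < \<sigma>" and jh: "real j * (2 * R * \<sigma>) \<le> 1"
  shows "x + real j *\<^sub>R (\<sigma> *\<^sub>R z + (2 * R * \<sigma>) *\<^sub>R (cube_center - x)) \<in> unit_cube"
proof -
  have "0 \<le> y \<and> y \<le> 1" if y: "y = (x + real j *\<^sub>R (\<sigma> *\<^sub>R z + (2 * R * \<sigma>) *\<^sub>R (cube_center - x))) $ i" for y i
  proof -
    define J where "J = real j * (2 * R * \<sigma>)"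
    have xi: "0 \<le> x$i" "x$i \<le> 1" using x by (auto simp: unit_cube_def)
    have zi: "\<bar>z$i\<bar> \<le> R" using component_le_norm_cart[of z i] z by simp
    have "\<bar>real j * \<sigma> * z$i\<bar> \<le> real j * \<sigma> * R" using zi s by (auto simp: abs_mult intro!: mult_left_mono)
    then have 1: "\<bar>real j * \<sigma> * z$i\<bar> \<le> J / 2" by (simp add: J_def mult_ac)
    have 2: "y = (1 - J) * x$i + J / 2 + real j * \<sigma> * z$i"
      unfolding y by (simp add: cube_center_def J_def algebra_simps)
    have 3: "0 \<le> (1 - J) * x$i" using jh xi by (simp add: J_def)
    have 4: "(1 - J) * x$i \<le> (1 - J) * 1" using jh xi by (intro mult_left_mono) (auto simp: J_def)
    have "0 \<le> y" using 1 2 3 by linarith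
    moreover have "y \<le> 1" using 1 2 4 by (auto simp: abs_le_iff)
    ultimately show ?thesis ..
  qed
  then show ?thesis unfolding unit_cube_def by blast
qed

text \<open>The error at \<open>x\<close> is the mean of \<open>q z\<close>. For
  \<open>norm z \<le> R\<close> it is, up to sign, a difference of order \<open>u + 1\<close> with
  step of order \<open>R \<sigma>\<close>; for larger \<open>z\<close> it is only bounded, and the
  Gaussian tail pays. The norm bound adds the bounds of the finitely many averages.\<close>

lemma gaussian_approximation:
  fixes f :: "real^'d \<Rightarrow> real"
  assumes tower: "hoelder_tower u v c0 Df" and v: "0 < v" and c0: "0 \<le> c0"
    and Df: "\<forall>x\<in>unit_cube. Df (\<lambda>_. 0) x = f x" and fM: "\<forall>x\<in>unit_cube. \<bar>f x\<bar> \<le> 1"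
  shows "\<exists>C>0. \<forall>\<sigma> R. 0 < \<sigma> \<longrightarrow> 0 < R \<longrightarrow> 4 * real (Suc u) * R * \<sigma> \<le> 1 \<longrightarrow>
    (\<exists>f0. f0 \<in> borel_measurable borel \<and> (\<forall>x. \<bar>f0 x\<bar> \<le> C) \<and>
       (\<forall>x\<in>unit_cube. \<bar>f0 x - f x\<bar> \<le> C * ((R * \<sigma>) powr (real u + v) + exp (- R\<^sup>2))) \<and>
       rkhs_norm_sq (gauss_kernel \<sigma>) unit_cube f0 \<le> ereal (C / \<sigma> ^ CARD('d)))"
proof -
  let ?r = "real u + v" and ?n = "Suc u" and ?d = "real CARD('d)"
  let ?I1 = "gauss_int TYPE(real^'d) 1" and ?I2 = "gauss_int TYPE(real^'d) 2" and ?I4 = "gauss_int TYPE(real^'d) 4"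
  have I: "0 < ?I1" "0 < ?I2" "0 < ?I4" by (auto intro: gauss_int_pos)
  interpret G: prob_space "gauss_meas :: (real^'d) measure" by (rule prob_space_gauss_meas)
  obtain a where a0: "a 0 = (-1) ^ ?n" and a: "\<And>f w (x::real^'d). fdiff ?n f w x = (\<Sum>j\<le>?n. a j * f (x + real j *\<^sub>R w))"
    using fdiff_expansion[of ?n, where 'a = "real^'d"] by blast
  have a0s: "a 0 * a 0 = 1" unfolding a0 by (simp flip: power_mult_distrib)
  \<comment> \<open>Solves the difference for its \<open>j = 0\<close> term: as
    \<open>a 0 * a 0 = 1\<close>, \<open>f x\<close> minus the sum of
    \<open>b j * f (x + j w)\<close> over \<open>j \<ge> 1\<close> equals \<open>a 0\<close> times
    the difference.\<close>
  define b where "b j = - (a 0 * a j)" for j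
  define \<beta> where "\<beta> = (\<Sum>j=1..?n. \<bar>b j\<bar>)"
  have \<beta>0: "0 \<le> \<beta>" by (simp add: \<beta>_def sum_nonneg)
  \<comment> \<open>Extension by 0 makes the target Borel, bounded and square integrable on the
    whole space. The jump at the boundary is met only when \<open>norm z > R\<close>.\<close>
  define g where "g x = (if x \<in> unit_cube then f x else 0)" for x
  have cont: "continuous_on unit_cube f"
    using hoelder_tower_continuous[OF tower v] Df by (subst continuous_on_cong[of _ unit_cube f "Df (\<lambda>_. 0)"]) auto
  have cube [measurable]: "(unit_cube :: (real^'d) set) \<in> sets borel" by (simp add: unit_cube_eq_cbox)
  have g [measurable]: "g \<in> borel_measurable borel"
  proof -
    have "(\<lambda>x. indicator unit_cube x *\<^sub>R f x) \<in> borel_measurable borel"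
      by (rule borel_measurable_continuous_on_indicator[OF cube cont])
    moreover have "(\<lambda>x. indicator unit_cube x *\<^sub>R f x) = g" by (auto simp: g_def indicator_def)
    ultimately show ?thesis by simp
  qed
  have gM: "\<bar>g x\<bar> \<le> 1" for x using fM by (auto simp: g_def)
  have icube: "integrable lborel (indicator unit_cube :: real^'d \<Rightarrow> real)" and mcube: "measure lborel (unit_cube :: (real^'d) set) = 1"
    by (auto simp: unit_cube_eq_cbox content_cbox_if_cart[of 0 "1::real^'d"] box_ne_empty mem_box_cart emeasure_lborel_cbox_eq
        Basis_vec_def inner_axis)
  have g2le: "(g x)\<^sup>2 \<le> indicator unit_cube x" for x using fM by (auto simp: g_def indicator_def abs_square_le_1)
  have g2: "integrable lborel (\<lambda>u. (g u)\<^sup>2)"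
    by (rule Bochner_Integration.integrable_bound[OF icube]) (use g2le in auto)
  have P: "(\<integral>u. (g u)\<^sup>2 \<partial>lborel) \<le> 1"
  proof -
    have "(\<integral>u. (g u)\<^sup>2 \<partial>lborel) \<le> (\<integral>u. indicator unit_cube u \<partial>(lborel :: (real^'d) measure))"
      by (rule integral_mono[OF g2 icube]) (rule g2le)
    then show ?thesis by (simp add: mcube)
  qed
  define B1 where "B1 = 2 ^ CARD('d) * ?I4 / ?I2\<^sup>2"
  have B1: "0 < B1" using I by (simp add: B1_def)
  define A1 where "A1 = c0 * ?d ^ u * (1 + 2 * ?d) powr ?r"
  have A1: "0 \<le> A1" using c0 by (simp add: A1_def)
  define C where "C = 1 + \<beta> + \<beta>\<^sup>2 * B1 + A1 + (1 + \<beta>) * (?I1 / ?I2)"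
  have Cpos: "0 < C" and Cge: "\<beta> \<le> C" "\<beta>\<^sup>2 * B1 \<le> C" "A1 \<le> C" "(1 + \<beta>) * (?I1 / ?I2) \<le> C"
  proof -
    have "0 \<le> \<beta>\<^sup>2 * B1" "0 \<le> (1 + \<beta>) * (?I1 / ?I2)" using B1 I \<beta>0 by auto
    then show "0 < C" "\<beta> \<le> C" "\<beta>\<^sup>2 * B1 \<le> C" "A1 \<le> C" "(1 + \<beta>) * (?I1 / ?I2) \<le> C"
      unfolding C_def using \<beta>0 A1 by linarith+
  qed
  show ?thesis
  proof (intro exI[of _ C] conjI allI impI Cpos)
    fix \<sigma> R :: real assume s: "0 < \<sigma>" and R: "0 < R" and small: "4 * real (Suc u) * R * \<sigma> \<le> 1"
    define h where "h = 2 * R * \<sigma>"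
    have h: "0 < h" using s R by (simp add: h_def)
    have nh: "real j * h \<le> 1/2" if "j \<le> ?n" for j
    proof -
      have "real j * h \<le> real ?n * h" using that h by (intro mult_right_mono) auto
      then show ?thesis using small by (simp add: h_def field_simps)
    qed
    define f0 where "f0 x = (\<Sum>j=1..?n. b j * gauss_pull \<sigma> h j g x)" for x
    show "\<exists>f0. f0 \<in> borel_measurable borel \<and> (\<forall>x. \<bar>f0 x\<bar> \<le> C) \<and>
       (\<forall>x\<in>unit_cube. \<bar>f0 x - f x\<bar> \<le> C * ((R * \<sigma>) powr ?r + exp (- R\<^sup>2))) \<and>
       rkhs_norm_sq (gauss_kernel \<sigma>) unit_cube f0 \<le> ereal (C / \<sigma> ^ CARD('d))"
    proof (intro exI[of _ f0] conjI allI ballI)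
      show "f0 \<in> borel_measurable borel" unfolding f0_def[abs_def] by measurable
      show "\<bar>f0 x\<bar> \<le> C" for x
      proof -
        have "\<bar>f0 x\<bar> \<le> (\<Sum>j=1..?n. \<bar>b j * gauss_pull \<sigma> h j g x\<bar>)" unfolding f0_def by (rule sum_abs)
        also have "\<dots> \<le> (\<Sum>j=1..?n. \<bar>b j\<bar> * 1)"
          unfolding abs_mult by (intro sum_mono mult_left_mono gauss_pull_abs_le gM) auto
        finally show ?thesis using Cge(1) by (simp add: \<beta>_def)
      qed
      show "rkhs_norm_sq (gauss_kernel \<sigma>) unit_cube f0 \<le> ereal (C / \<sigma> ^ CARD('d))"
      proof (rule rkhs_norm_sq_le)
        show "0 \<le> C / \<sigma> ^ CARD('d)" using Cpos s by simp
        fix S :: "(real^'d) set" and c assume S: "finite S" "S \<subseteq> unit_cube"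
        let ?Q = "\<Sum>x\<in>S. \<Sum>y\<in>S. c x * c y * gauss_kernel \<sigma> x y"
        let ?B = "B1 / \<sigma> ^ CARD('d)"
        have Q: "0 \<le> ?Q" by (rule gauss_kernel_psd[OF s S(1)])
        have B: "0 \<le> ?B" using B1 s by simp
        have each: "\<bar>\<Sum>x\<in>S. c x * gauss_pull \<sigma> h j g x\<bar> \<le> sqrt (?B * ?Q)" if "j \<in> {1..?n}" for j
        proof -
          have "(\<Sum>x\<in>S. c x * gauss_pull \<sigma> h j g x)\<^sup>2 \<le> ?B * ?Q"
            using gauss_pull_dual_bound[OF s S(1) g gM g2 P _ h nh, of j c] that by (simp add: B1_def)
          then have "sqrt ((\<Sum>x\<in>S. c x * gauss_pull \<sigma> h j g x)\<^sup>2) \<le> sqrt (?B * ?Q)" by (rule real_sqrt_le_mono)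
          then show ?thesis by simp
        qed
        have "(\<Sum>x\<in>S. c x * f0 x) = (\<Sum>j=1..?n. b j * (\<Sum>x\<in>S. c x * gauss_pull \<sigma> h j g x))"
          unfolding f0_def sum_distrib_left by (subst sum.swap) (simp add: ac_simps)
        also have "\<bar>\<dots>\<bar> \<le> (\<Sum>j=1..?n. \<bar>b j * (\<Sum>x\<in>S. c x * gauss_pull \<sigma> h j g x)\<bar>)" by (rule sum_abs)
        also have "\<dots> \<le> (\<Sum>j=1..?n. \<bar>b j\<bar> * sqrt (?B * ?Q))"
          unfolding abs_mult by (intro sum_mono mult_left_mono each) auto
        also have "\<dots> = \<beta> * sqrt (?B * ?Q)" unfolding \<beta>_def sum_distrib_right ..
        finally have "\<bar>\<Sum>x\<in>S. c x * f0 x\<bar>\<^sup>2 \<le> (\<beta> * sqrt (?B * ?Q))\<^sup>2" by (intro power_mono) auto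
        also have "\<dots> = \<beta>\<^sup>2 * (?B * ?Q)" unfolding power_mult_distrib real_sqrt_pow2[OF mult_nonneg_nonneg[OF B Q]] ..
        also have "\<dots> = (\<beta>\<^sup>2 * B1) / \<sigma> ^ CARD('d) * ?Q" by simp
        also have "\<dots> \<le> C / \<sigma> ^ CARD('d) * ?Q"
          using Cge(2) s Q by (intro mult_right_mono divide_right_mono) auto
        finally show "(\<Sum>x\<in>S. c x * f0 x)\<^sup>2 \<le> C / \<sigma> ^ CARD('d) * ?Q" by simp
      qed
      fix x :: "real^'d" assume x: "x \<in> unit_cube"
      define w where "w z = \<sigma> *\<^sub>R z + h *\<^sub>R (cube_center - x)" for z
      have [measurable]: "w \<in> borel_measurable borel" unfolding w_def by measurable
      define q where "q z = f x - (\<Sum>j=1..?n. b j * g (x + real j *\<^sub>R w z))" for z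
      have q [measurable]: "q \<in> borel_measurable borel" unfolding q_def by measurable
      have ig: "integrable gauss_meas (\<lambda>z. g (x + real j *\<^sub>R w z))" for j
        by (rule G.integrable_const_bound[of _ 1]) (use gM in auto)
      have isum: "integrable gauss_meas (\<lambda>z. \<Sum>j=1..?n. b j * g (x + real j *\<^sub>R w z))"
        by (intro Bochner_Integration.integrable_sum integrable_mult_right ig)
      have "(\<integral>z. (\<Sum>j=1..?n. b j * g (x + real j *\<^sub>R w z)) \<partial>gauss_meas) = f0 x"
        unfolding f0_def gauss_pull_def w_def[symmetric]
        by (subst Bochner_Integration.integral_sum) (intro integrable_mult_right ig, simp del: sum.cl_ivl_Suc)
      then have fq: "f x - f0 x = (\<integral>z. q z \<partial>gauss_meas)"
        unfolding q_def by (subst Bochner_Integration.integral_diff[OF _ isum]) (use G.prob_space in auto)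
      have qbig: "\<bar>q z\<bar> \<le> 1 + \<beta>" for z
      proof -
        have "\<bar>\<Sum>j=1..?n. b j * g (x + real j *\<^sub>R w z)\<bar> \<le> (\<Sum>j=1..?n. \<bar>b j * g (x + real j *\<^sub>R w z)\<bar>)" by (rule sum_abs)
        also have "\<dots> \<le> (\<Sum>j=1..?n. \<bar>b j\<bar> * 1)" unfolding abs_mult by (intro sum_mono mult_left_mono gM) auto
        finally show ?thesis using fM x unfolding q_def \<beta>_def by fastforce
      qed
      have qsmall: "\<bar>q z\<bar> \<le> A1 * (R * \<sigma>) powr ?r" if z: "norm z \<le> R" for z
      proof -
        have mem: "x + real j *\<^sub>R w z \<in> unit_cube" if "j \<le> ?n" for j
          using cube_shift_mem[OF x z s, of j] nh[OF that] unfolding w_def h_def by simp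
        have "q z = a 0 * fdiff ?n (Df (\<lambda>_. 0)) (w z) x"
        proof -
          have "a 0 * fdiff ?n (Df (\<lambda>_. 0)) (w z) x = a 0 * (\<Sum>j\<le>?n. a j * g (x + real j *\<^sub>R w z))"
            unfolding a by (intro arg_cong[where f = "(*) (a 0)"] sum.cong) (use mem Df in \<open>auto simp: g_def\<close>)
          also have "\<dots> = (\<Sum>j\<le>?n. - b j * g (x + real j *\<^sub>R w z))"
            by (simp add: b_def sum_distrib_left mult.assoc del: sum.atMost_Suc)
          also have "{..?n} = insert 0 {1..?n}" by auto
          also have "(\<Sum>j\<in>insert 0 {1..?n}. - b j * g (x + real j *\<^sub>R w z)) = - b 0 * g (x + 0 *\<^sub>R w z) + (\<Sum>j\<in>{1..?n}. - b j * g (x + real j *\<^sub>R w z))"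
            by (subst sum.insert) auto
          also have "\<dots> = q z" using a0s x by (simp add: q_def b_def g_def sum_negf del: sum.cl_ivl_Suc)
          finally show ?thesis by simp
        qed
        then have "\<bar>q z\<bar> = \<bar>fdiff ?n (Df (\<lambda>_. 0)) (w z) x\<bar>" by (simp add: abs_mult a0 power_abs)
        also have "\<dots> \<le> c0 * ?d ^ u * norm (w z) powr ?r"
          by (rule fdiff_bound[OF tower v c0 x mem]) simp
        \<comment> \<open>Each coordinate of \<open>cube_center - x\<close> is at most 1 in size,
          and the drift has strength \<open>h = 2 R \<sigma>\<close>.\<close>
        also have "norm (w z) \<le> (1 + 2 * ?d) * (R * \<sigma>)"
        proof -
          have "norm (cube_center - x) \<le> (\<Sum>i\<in>UNIV. \<bar>(cube_center - x) $ i\<bar>)" by (rule norm_le_l1_cart)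
          also have "\<dots> \<le> (\<Sum>i\<in>(UNIV::'d set). 1)" 
            using x by (intro sum_mono) (auto simp: cube_center_def unit_cube_def abs_le_iff intro: order_trans[of _ "1/2"])
          finally have c: "norm (cube_center - x) \<le> ?d" by simp
          have "norm (w z) \<le> norm (\<sigma> *\<^sub>R z) + norm (h *\<^sub>R (cube_center - x))" unfolding w_def by (rule norm_triangle_ineq)
          also have "\<dots> \<le> \<sigma> * R + h * ?d" using s h z c by (auto intro!: add_mono mult_left_mono)
          finally show ?thesis by (simp add: h_def algebra_simps)
        qed
        then have "norm (w z) powr ?r \<le> ((1 + 2 * ?d) * (R * \<sigma>)) powr ?r" using v by (intro powr_mono2) auto
        then have "c0 * ?d ^ u * norm (w z) powr ?r \<le> c0 * ?d ^ u * ((1 + 2 * ?d) * (R * \<sigma>)) powr ?r"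
          using c0 by (intro mult_left_mono) auto
        also have "\<dots> = A1 * (R * \<sigma>) powr ?r" using R s by (simp add: A1_def powr_mult)
        finally show ?thesis .
      qed
      let ?E = "{z::real^'d. R < norm z}"
      have qb: "\<bar>q z\<bar> \<le> A1 * (R * \<sigma>) powr ?r + (1 + \<beta>) * indicator ?E z" for z
        using qsmall[of z] qbig[of z] A1 by (cases "norm z \<le> R") (auto intro: add_increasing)
      have [measurable]: "?E \<in> sets borel" by measurable
      then have E: "?E \<in> sets gauss_meas" by (simp add: sets_gauss_meas)
      have iq: "integrable gauss_meas q"
        by (rule G.integrable_const_bound[of _ "1 + \<beta>"]) (use qbig in auto)
      have iE: "integrable gauss_meas (indicator ?E :: _ \<Rightarrow> real)" using E by (simp add: G.emeasure_finite less_top[symmetric])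
      have "\<bar>f x - f0 x\<bar> \<le> (\<integral>z. \<bar>q z\<bar> \<partial>gauss_meas)" unfolding fq by (rule integral_abs_bound)
      also have "\<dots> \<le> (\<integral>z. A1 * (R * \<sigma>) powr ?r + (1 + \<beta>) * indicator ?E z \<partial>gauss_meas)"
        by (rule integral_mono) (use iq iE qb in auto)
      also have "\<dots> = A1 * (R * \<sigma>) powr ?r + (1 + \<beta>) * measure gauss_meas ?E"
        using iE E by (subst Bochner_Integration.integral_add) (auto simp: G.prob_space simp flip: space_gauss_meas)
      also have "\<dots> \<le> A1 * (R * \<sigma>) powr ?r + (1 + \<beta>) * (exp (- R\<^sup>2) * (?I1 / ?I2))"
        using R \<beta>0 by (intro add_left_mono mult_left_mono gauss_meas_tail) auto
      also have "\<dots> = A1 * (R * \<sigma>) powr ?r + ((1 + \<beta>) * (?I1 / ?I2)) * exp (- R\<^sup>2)" by simp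
      also have "\<dots> \<le> C * (R * \<sigma>) powr ?r + C * exp (- R\<^sup>2)"
        using Cge by (intro add_mono mult_right_mono) auto
      finally show "\<bar>f0 x - f x\<bar> \<le> C * ((R * \<sigma>) powr ?r + exp (- R\<^sup>2))" by (simp add: distrib_left abs_minus_commute)
    qed
  qed
qed

section \<open>Balls of the RKHS\<close>

text \<open>The dual norm bound, multiplied out and over finite sequences instead of sets. Points
  may repeat, so interpolation nodes may coincide with the point interpolated, and no quotient
  requires a positive form.\<close>

definition rkhs_ball :: "('a \<Rightarrow> 'a \<Rightarrow> real) \<Rightarrow> 'a set \<Rightarrow> real \<Rightarrow> ('a \<Rightarrow> real) set" where
  "rkhs_ball K X B = {f. \<forall>N p c. (\<forall>i<N. p i \<in> X) \<longrightarrow>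
     (\<Sum>i<N. c i * f (p i))\<^sup>2 \<le> B\<^sup>2 * (\<Sum>i<N. \<Sum>j<(N::nat). c i * c j * K (p i) (p j))}"

text \<open>Covers the combinations with vanishing kernel form too, which the supremum in
  \<open>rkhs_norm_sq\<close> leaves out.\<close>

lemma rkhs_norm_sq_dual:
  assumes norm: "rkhs_norm_sq K X f \<le> ereal (B\<^sup>2)"
    and psd: "\<And>S c. finite S \<Longrightarrow> 0 \<le> (\<Sum>x\<in>S. \<Sum>y\<in>S. c x * c y * K x y)"
    and diag: "\<And>x. K x x = 1" and sym: "\<And>x y. K x y = K y x"
    and S: "finite S" "S \<subseteq> X"
  shows "(\<Sum>x\<in>S. c x * f x)\<^sup>2 \<le> B\<^sup>2 * (\<Sum>x\<in>S. \<Sum>y\<in>S. c x * c y * K x y)"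
proof -
  have pos: "(\<Sum>x\<in>S. c x * f x)\<^sup>2 \<le> B\<^sup>2 * (\<Sum>x\<in>S. \<Sum>y\<in>S. c x * c y * K x y)"
    if "0 < (\<Sum>x\<in>S. \<Sum>y\<in>S. c x * c y * K x y)" for c
  proof -
    have "ereal ((\<Sum>x\<in>S. c x * f x)\<^sup>2 / (\<Sum>x\<in>S. \<Sum>y\<in>S. c x * c y * K x y)) \<le> rkhs_norm_sq K X f"
      unfolding rkhs_norm_sq_def by (rule Sup_upper) (use that S in blast)
    also note norm
    finally show ?thesis using that by (simp add: divide_le_eq)
  qed
  show ?thesis
  proof (cases "S = {} \<or> 0 < (\<Sum>x\<in>S. \<Sum>y\<in>S. c x * c y * K x y)")
    case True then show ?thesis using pos[of c] by auto
  next
    case False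
    then have Q0: "(\<Sum>x\<in>S. \<Sum>y\<in>S. c x * c y * K x y) = 0" using psd[OF S(1), of c] by simp
    obtain x0 where x0: "x0 \<in> S" using False by blast
    define b where "b = (\<Sum>x\<in>S. c x * K x x0)"
    \<comment> \<open>With this sign the linear term \<open>2 (e s) b\<close> is nonnegative, so the
      perturbed form is at least \<open>s^2 > 0\<close> for every \<open>s > 0\<close>.\<close>
    define e where "e = (if 0 \<le> b then 1 else -1 :: real)"
    \<comment> \<open>The form vanishes at c, so perturb c in the direction of x0 to reach nearby points where it is positive.\<close>
    have ind: "(\<Sum>x\<in>S. (if x = x0 then t else 0) * g x) = t * g x0" for t :: real and g :: "_ \<Rightarrow> real"
      using S x0 by (subst sum.cong[OF refl, of _ _ "\<lambda>x. if x = x0 then t * g x else 0"]) auto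
    have lin: "(\<Sum>x\<in>S. (c x + (if x = x0 then t else 0)) * g x) = (\<Sum>x\<in>S. c x * g x) + t * g x0" for t g
      unfolding distrib_right sum.distrib ind ..
    have Q: "(\<Sum>x\<in>S. \<Sum>y\<in>S. (c x + (if x = x0 then t else 0)) * (c y + (if y = x0 then t else 0)) * K x y) = 2 * t * b + t\<^sup>2" for t
    proof -
      have "(\<Sum>x\<in>S. \<Sum>y\<in>S. (c x + (if x = x0 then t else 0)) * (c y + (if y = x0 then t else 0)) * K x y)
        = (\<Sum>x\<in>S. (c x + (if x = x0 then t else 0)) * ((\<Sum>y\<in>S. c y * K x y) + t * K x x0))"
        unfolding lin[symmetric] sum_distrib_left by (simp add: ac_simps)
      also have "\<dots> = (\<Sum>x\<in>S. c x * ((\<Sum>y\<in>S. c y * K x y) + t * K x x0)) + t * ((\<Sum>y\<in>S. c y * K x0 y) + t * K x0 x0)"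
        unfolding lin ..
      also have "(\<Sum>x\<in>S. c x * ((\<Sum>y\<in>S. c y * K x y) + t * K x x0)) = (\<Sum>x\<in>S. \<Sum>y\<in>S. c x * c y * K x y) + t * b"
        by (simp add: b_def distrib_left sum.distrib sum_distrib_left ac_simps)
      also have "(\<Sum>y\<in>S. c y * K x0 y) = b" unfolding b_def by (subst sym) simp
      also have "(\<Sum>x\<in>S. \<Sum>y\<in>S. c x * c y * K x y) + t * b + t * (b + t * K x0 x0) = 2 * t * b + t\<^sup>2"
        unfolding Q0 diag by (simp add: power2_eq_square algebra_simps)
      finally show ?thesis .
    qed
    have bound: "((\<Sum>x\<in>S. c x * f x) + (e * s) * f x0)\<^sup>2 \<le> B\<^sup>2 * (2 * (e * s) * b + (e * s)\<^sup>2)" if s: "0 < s" for s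
    proof -
      have "0 \<le> e * b" by (simp add: e_def)
      then have "0 \<le> 2 * (e * s) * b" using s mult_nonneg_nonneg[of s "e * b"] by (simp add: ac_simps)
      moreover have "0 < (e * s)\<^sup>2" using s by (auto simp: e_def)
      ultimately have "0 < 2 * (e * s) * b + (e * s)\<^sup>2" by linarith
      then show ?thesis using pos[of "\<lambda>x. c x + (if x = x0 then e * s else 0)"] unfolding Q lin by blast
    qed
    have "((\<lambda>s. ((\<Sum>x\<in>S. c x * f x) + (e * s) * f x0)\<^sup>2) \<longlongrightarrow> ((\<Sum>x\<in>S. c x * f x) + (e * 0) * f x0)\<^sup>2) (at_right 0)"
      by (intro tendsto_intros)
    moreover have "((\<lambda>s. B\<^sup>2 * (2 * (e * s) * b + (e * s)\<^sup>2)) \<longlongrightarrow> B\<^sup>2 * (2 * (e * 0) * b + (e * 0)\<^sup>2)) (at_right 0)"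
      by (intro tendsto_intros)
    moreover have "\<forall>\<^sub>F s in at_right 0. ((\<Sum>x\<in>S. c x * f x) + (e * s) * f x0)\<^sup>2 \<le> B\<^sup>2 * (2 * (e * s) * b + (e * s)\<^sup>2)"
      using bound by (auto simp: eventually_at_right_less intro: eventually_mono[OF eventually_at_right_less])
    ultimately have "((\<Sum>x\<in>S. c x * f x) + (e * 0) * f x0)\<^sup>2 \<le> B\<^sup>2 * (2 * (e * 0) * b + (e * 0)\<^sup>2)"
      by (intro tendsto_le[OF trivial_limit_at_right_real])
    then show ?thesis by (simp add: Q0)
  qed
qed

text \<open>Repeated points of the sequence are merged by adding their coefficients, which changes
  neither the pairing nor the form.\<close>

lemma rkhs_norm_sq_imp_ball:
  assumes norm: "rkhs_norm_sq K X f \<le> ereal (B\<^sup>2)"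
    and psd: "\<And>S c. finite S \<Longrightarrow> 0 \<le> (\<Sum>x\<in>S. \<Sum>y\<in>S. c x * c y * K x y)"
    and diag: "\<And>x. K x x = 1" and sym: "\<And>x y. K x y = K y x"
  shows "f \<in> rkhs_ball K X B"
  unfolding rkhs_ball_def
proof (intro CollectI allI impI)
  fix N :: nat and p :: "nat \<Rightarrow> 'a" and c :: "nat \<Rightarrow> real" assume p: "\<forall>i<N. p i \<in> X"
  let ?S = "p ` {..<N}"
  define c' where "c' x = (\<Sum>i | i < N \<and> p i = x. c i)" for x
  have grp: "(\<Sum>i<N. c i * g (p i)) = (\<Sum>x\<in>?S. c' x * g x)" for g :: "'a \<Rightarrow> real"
  proof -
    have "(\<Sum>i<N. c i * g (p i)) = (\<Sum>x\<in>?S. \<Sum>i | i \<in> {..<N} \<and> p i = x. c i * g (p i))"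
      by (rule sum.image_gen) simp
    also have "\<dots> = (\<Sum>x\<in>?S. c' x * g x)"
      unfolding c'_def sum_distrib_right by (intro sum.cong) auto
    finally show ?thesis .
  qed
  have "(\<Sum>i<N. \<Sum>j<N. c i * c j * K (p i) (p j)) = (\<Sum>i<N. c i * (\<Sum>j<N. c j * K (p i) (p j)))"
    by (simp add: sum_distrib_left ac_simps)
  also have "\<dots> = (\<Sum>i<N. c i * (\<Sum>y\<in>?S. c' y * K (p i) y))" unfolding grp[of "K (p _)"] ..
  also have "\<dots> = (\<Sum>x\<in>?S. c' x * (\<Sum>y\<in>?S. c' y * K x y))" by (rule grp)
  also have "\<dots> = (\<Sum>x\<in>?S. \<Sum>y\<in>?S. c' x * c' y * K x y)" by (simp add: sum_distrib_left ac_simps)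
  finally have Q: "(\<Sum>i<N. \<Sum>j<N. c i * c j * K (p i) (p j)) = (\<Sum>x\<in>?S. \<Sum>y\<in>?S. c' x * c' y * K x y)" .
  show "(\<Sum>i<N. c i * f (p i))\<^sup>2 \<le> B\<^sup>2 * (\<Sum>i<N. \<Sum>j<N. c i * c j * K (p i) (p j))"
    unfolding Q grp by (rule rkhs_norm_sq_dual[OF norm psd diag sym]) (use p in auto)
qed

lemma rkhs_ballD:
  assumes "f \<in> rkhs_ball K X B" "\<And>i. i < N \<Longrightarrow> p i \<in> X"
  shows "(\<Sum>i<N. c i * f (p i))\<^sup>2 \<le> B\<^sup>2 * (\<Sum>i<N. \<Sum>j<(N::nat). c i * c j * K (p i) (p j))"
  using assms by (simp add: rkhs_ball_def)

lemma rkhs_ball_diff: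
  assumes f: "f \<in> rkhs_ball K X B" and g: "g \<in> rkhs_ball K X B"
  shows "(\<lambda>x. f x - g x) \<in> rkhs_ball K X (2 * B)"
  unfolding rkhs_ball_def
proof (intro CollectI allI impI)
  fix N :: nat and p :: "nat \<Rightarrow> 'a" and c :: "nat \<Rightarrow> real" assume p: "\<forall>i<N. p i \<in> X"
  let ?f = "\<Sum>i<N. c i * f (p i)" and ?g = "\<Sum>i<N. c i * g (p i)" and ?Q = "\<Sum>i<N. \<Sum>j<N. c i * c j * K (p i) (p j)"
  have "(\<Sum>i<N. c i * (f (p i) - g (p i))) = ?f - ?g" by (simp add: right_diff_distrib sum_subtractf)
  moreover have "(?f - ?g)\<^sup>2 \<le> 2 * ?f\<^sup>2 + 2 * ?g\<^sup>2"
    using zero_le_power2[of "?f + ?g"] by (simp add: power2_eq_square algebra_simps)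
  moreover have "?f\<^sup>2 \<le> B\<^sup>2 * ?Q" "?g\<^sup>2 \<le> B\<^sup>2 * ?Q" using rkhs_ballD[OF f] rkhs_ballD[OF g] p by auto
  ultimately show "(\<Sum>i<N. c i * (f (p i) - g (p i)))\<^sup>2 \<le> (2 * B)\<^sup>2 * ?Q" by (simp add: power_mult_distrib)
qed

lemma rkhs_ball_abs_le:
  assumes f: "f \<in> rkhs_ball K X B" and "0 \<le> B" "x \<in> X" "K x x = 1"
  shows "\<bar>f x\<bar> \<le> B"
  using rkhs_ballD[OF f, of 1 "\<lambda>_. x" "\<lambda>_. 1"] assms by (simp add: power2_le_iff_abs_le)

lemma gauss_kernel_diag [simp]: "gauss_kernel \<sigma> x x = 1"
  and gauss_kernel_sym: "gauss_kernel \<sigma> x y = gauss_kernel \<sigma> y x"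
  by (simp_all add: gauss_kernel_def norm_minus_commute)

text \<open>The form of the evaluation at \<open>y\<close> minus the evaluation at \<open>x\<close>
  is \<open>2 - 2 K(y, x)\<close>, which tends to 0. This is the source of Borel measurability for
  truncated members of the ball.\<close>

lemma gauss_rkhs_ball_continuous:
  assumes f: "f \<in> rkhs_ball (gauss_kernel \<sigma>) X B"
  shows "continuous_on X f"
  unfolding continuous_on
proof
  fix x assume x: "x \<in> X"
  have b: "\<bar>f y - f x\<bar> \<le> \<bar>B\<bar> * sqrt (2 - 2 * gauss_kernel \<sigma> y x)" if "y \<in> X" for y
  proof -
    have "(f y - f x)\<^sup>2 \<le> B\<^sup>2 * (2 - 2 * gauss_kernel \<sigma> y x)"
      using rkhs_ballD[OF f, of 2 "\<lambda>i. if i = 0 then y else x" "\<lambda>i. if i = 0 then 1 else -1"] x that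
      by (simp add: numeral_2_eq_2 gauss_kernel_sym[of \<sigma> x y] algebra_simps)
    then have "sqrt ((f y - f x)\<^sup>2) \<le> sqrt (B\<^sup>2 * (2 - 2 * gauss_kernel \<sigma> y x))" by (rule real_sqrt_le_mono)
    then show ?thesis by (simp add: real_sqrt_mult)
  qed
  have "((\<lambda>y. \<bar>B\<bar> * sqrt (2 - 2 * exp (- (norm (y - x))\<^sup>2 / \<sigma>\<^sup>2))) \<longlongrightarrow> \<bar>B\<bar> * sqrt (2 - 2 * exp (- (norm (x - x))\<^sup>2 * inverse (\<sigma>\<^sup>2)))) (at x within X)"
    unfolding divide_inverse by (intro tendsto_intros)
  then have "((\<lambda>y. \<bar>B\<bar> * sqrt (2 - 2 * gauss_kernel \<sigma> y x)) \<longlongrightarrow> 0) (at x within X)"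
    by (simp add: gauss_kernel_def)
  then have "((\<lambda>y. f y - f x) \<longlongrightarrow> 0) (at x within X)"
    by (rule Lim_null_comparison[rotated]) (auto simp: eventually_at_filter b)
  then show "(f \<longlongrightarrow> f x) (at x within X)" by (simp add: LIM_zero_iff)
qed

text \<open>The difference of both sides has degree below \<open>N\<close> and vanishes at the
  \<open>N\<close> distinct nodes.\<close>

lemma lagrange_interpolation:
  fixes \<xi> :: "nat \<Rightarrow> real"
  assumes inj: "inj_on \<xi> {..<N}"
  defines "l \<equiv> (\<lambda>k t. \<Prod>i\<in>{..<N} - {k}. (t - \<xi> i) / (\<xi> k - \<xi> i))"
  assumes q: "degree q < N"
  shows "poly q t = (\<Sum>k<N. l k t * poly q (\<xi> k))"
proof -
  define lp where "lp k = (\<Prod>i\<in>{..<N} - {k}. smult (1 / (\<xi> k - \<xi> i)) [:- \<xi> i, 1:])" for k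
  have lp: "poly (lp k) t = l k t" for k t
    by (simp add: lp_def l_def poly_prod diff_divide_distrib)
  have deg: "degree (lp k) < N" if "k < N" for k
  proof -
    have "degree (lp k) \<le> (\<Sum>i\<in>{..<N} - {k}. degree (smult (1 / (\<xi> k - \<xi> i)) [:- \<xi> i, 1:]))"
      unfolding lp_def by (rule order_trans[OF degree_prod_sum_le]) (simp_all add: o_def)
    also have "\<dots> \<le> (\<Sum>i\<in>{..<N} - {k}. 1)" by (rule sum_mono) (auto simp: degree_smult_eq)
    also have "\<dots> = N - 1" using that by simp
    finally show ?thesis using that by simp
  qed
  define Q where "Q = q - (\<Sum>k<N. smult (poly q (\<xi> k)) (lp k))"
  have lk: "l k (\<xi> i) = (if i = k then 1 else 0)" if "k < N" "i < N" for i k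
  proof (cases "i = k")
    case True
    have "l k (\<xi> k) = (\<Prod>i\<in>{..<N} - {k}. 1)" unfolding l_def
      by (rule prod.cong) (use inj that in \<open>auto simp: inj_on_def\<close>)
    then show ?thesis using True by simp
  next
    case False
    then have "l k (\<xi> i) = 0" unfolding l_def using that by (intro prod_zero) auto
    then show ?thesis using False by simp
  qed
  have "poly Q (\<xi> i) = 0" if i: "i < N" for i
  proof -
    have "(\<Sum>k<N. poly q (\<xi> k) * l k (\<xi> i)) = (\<Sum>k<N. if k = i then poly q (\<xi> k) else 0)"
      by (rule sum.cong) (use lk i in auto)
    also have "\<dots> = poly q (\<xi> i)" using i by simp
    finally show ?thesis by (simp add: Q_def poly_sum lp)
  qed
  then have sub: "\<xi> ` {..<N} \<subseteq> {x. poly Q x = 0}" by auto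
  have dQ: "degree Q < N"
  proof -
    have N: "0 < N" using q by simp
    have "degree (\<Sum>k<N. smult (poly q (\<xi> k)) (lp k)) \<le> N - 1"
      using deg N by (intro degree_sum_le) (auto simp: less_eq_Suc_le intro!: order_trans[OF degree_smult_le] , fastforce)
    then show ?thesis unfolding Q_def using q N degree_diff_less[of q N] by simp
  qed
  have "Q = 0"
  proof (rule ccontr)
    assume Q: "Q \<noteq> 0"
    have "N = card (\<xi> ` {..<N})" using inj by (simp add: card_image)
    also have "\<dots> \<le> card {x. poly Q x = 0}" by (rule card_mono[OF poly_roots_finite[OF Q] sub])
    also have "\<dots> \<le> degree Q" by (rule card_poly_roots_bound[OF Q])
    finally show False using dQ by simp
  qed
  then have "poly Q t = 0" by simp
  then show ?thesis by (simp add: Q_def poly_sum lp ac_simps)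
qed

section \<open>Covering numbers\<close>

text \<open>To be read as \<open>n\<close> cells of length \<open>1 / n\<close> with
  \<open>N\<close> equally spaced nodes each: the index \<open>i * N + k\<close> is node
  \<open>k\<close> of cell \<open>i\<close>.\<close>

definition grid :: "nat \<Rightarrow> nat \<Rightarrow> real set" where
  "grid n N = (\<lambda>l. real l / (real n * real N)) ` {..<n * N}"

text \<open>A crude bound for the Lebesgue constant of \<open>N\<close> equally spaced nodes: each
  of the \<open>N\<close> Lagrange polynomials is a product of fewer than \<open>N\<close> factors
  of size at most \<open>N\<close>.\<close>

definition lebesgue_const :: "nat \<Rightarrow> real" where
  "lebesgue_const N = real N * real N ^ N"

lemma grid_bounds: assumes "s \<in> grid n N" shows "0 \<le> s" "s \<le> 1"
  using assms by (auto simp: grid_def divide_le_eq simp flip: of_nat_mult)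

lemma card_grid_le: "finite (grid n N)" "card (grid n N) \<le> n * N"
  using card_image_le[of "{..<n * N}" "\<lambda>l. real l / (real n * real N)"] by (auto simp: grid_def)

lemma exp_taylor_bound:
  fixes y :: real assumes "\<bar>y\<bar> \<le> 1" shows "\<bar>exp y - (\<Sum>m<K. y ^ m / fact m)\<bar> \<le> 3 * \<bar>y\<bar> ^ K"
proof -
  obtain t where t: "\<bar>t\<bar> \<le> \<bar>y\<bar>" "exp y = (\<Sum>m<K. y ^ m / fact m) + exp t / fact K * y ^ K"
    using Maclaurin_exp_le[of y K] by blast
  have "exp t \<le> exp 1" using t assms by simp
  also have "\<dots> \<le> 3" by (rule exp_le)
  finally have "exp t / fact K \<le> 3 / 1" by (intro frac_le) (auto simp: fact_ge_1)
  then have "\<bar>exp t / fact K\<bar> * \<bar>y ^ K\<bar> \<le> 3 * \<bar>y ^ K\<bar>" by (intro mult_right_mono) auto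
  then show ?thesis using t(2) by (simp add: abs_mult power_abs)
qed

lemma cell_exists:
  fixes t :: real assumes "0 \<le> t" "t \<le> 1" "1 \<le> n"
  obtains i where "i < n" "real i / real n \<le> t" "t \<le> (real i + 1) / real n"
proof (cases "t = 1")
  case True
  show ?thesis using assms True by (intro that[of "n - 1"]) (auto simp: of_nat_diff)
next
  case False
  define i where "i = nat \<lfloor>real n * t\<rfloor>"
  have "0 \<le> real n * t" using assms by simp
  then have i: "real i \<le> real n * t" "real n * t < real i + 1"
    unfolding i_def by (auto simp: of_nat_nat)
  have "real n * t < real n * 1" using assms False by (intro mult_strict_left_mono) auto
  then have "i < n" using i(1) by simp
  then show ?thesis using that[of i] i assms by (auto simp: field_simps)
qed

text \<open>Bounds the kernel form of the functional
  \<open>F t - (\<Sum>k<N. l k * F (\<xi> k))\<close>. The Taylor polynomial of a kernel section in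
  the second argument has degree at most \<open>2 (K - 1) < N\<close> and is reproduced exactly, so
  only a remainder of order \<open>(1 / (n \<sigma>)) ^ (2 K)\<close> is left. Weights and nodes
  depend on \<open>t\<close>, not on \<open>\<sigma>\<close>.\<close>

lemma gauss_interpolation_weights:
  assumes t: "0 \<le> t" "t \<le> 1" and n: "1 \<le> n" and K: "1 \<le> K" and N: "N = 2 * K"
  shows "\<exists>l \<xi>. (\<forall>k<N. \<xi> k \<in> grid n N) \<and> (\<Sum>k<N. \<bar>l k\<bar>) \<le> lebesgue_const N \<and>
    (\<forall>\<sigma>>0. 1 \<le> real n * \<sigma> \<longrightarrow> (\<forall>c p. c = case_nat 1 (\<lambda>k. - l k) \<longrightarrow> p = case_nat t \<xi> \<longrightarrow>
      (\<Sum>i<Suc N. \<Sum>j<Suc N. c i * c j * exp (- (p i - p j)\<^sup>2 / \<sigma>\<^sup>2))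
        \<le> 3 * (1 + lebesgue_const N)\<^sup>2 * (1 / (real n * \<sigma>)) ^ (2 * K)))"
proof -
  obtain i where i: "i < n" "real i / real n \<le> t" "t \<le> (real i + 1) / real n"
    using cell_exists[OF t n] by blast
  have N0: "0 < N" using K N by simp
  let ?I = "{real i / real n .. (real i + 1) / real n}"
  \<comment> \<open>The nodes of the cell containing \<open>t\<close>; they and \<open>t\<close> lie
    within \<open>1 / n\<close> of each other.\<close>
  define \<xi> where "\<xi> k = real (i * N + k) / (real n * real N)" for k
  have \<xi>': "\<xi> k = (real i + real k / real N) / real n" for k
    using N0 n by (simp add: \<xi>_def field_simps)
  have \<xi>I: "\<xi> k \<in> ?I" if "k < N" for k
    using that N0 n unfolding \<xi>' by (auto simp: divide_right_mono)
  have \<xi>G: "\<xi> k \<in> grid n N" if "k < N" for k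
  proof -
    have "i * N + k < i * N + N" using that by simp
    also have "\<dots> = Suc i * N" by simp
    also have "\<dots> \<le> n * N" using i by (intro mult_le_mono1) simp
    finally show ?thesis unfolding grid_def \<xi>_def by blast
  qed
  have tI: "t \<in> ?I" using i by simp
  have diam: "\<bar>a - b\<bar> \<le> 1 / real n" if "a \<in> ?I" "b \<in> ?I" for a b
    using that by (auto simp: add_divide_distrib abs_le_iff)
  have inj: "inj_on \<xi> {..<N}" using N0 n by (auto simp: inj_on_def \<xi>_def)
  define l where "l k = (\<Prod>j\<in>{..<N} - {k}. (t - \<xi> j) / (\<xi> k - \<xi> j))" for k
  have lag: "poly q t = (\<Sum>k<N. l k * poly q (\<xi> k))" if "degree q < N" for q
    using lagrange_interpolation[OF inj that, of t] by (simp add: l_def)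
  have lk: "\<bar>l k\<bar> \<le> real N ^ N" if k: "k < N" for k
  proof -
    have "\<bar>l k\<bar> = (\<Prod>j\<in>{..<N} - {k}. \<bar>(t - \<xi> j) / (\<xi> k - \<xi> j)\<bar>)" by (simp add: l_def abs_prod)
    also have "\<dots> \<le> (\<Prod>j\<in>{..<N} - {k}. real N)"
    proof (rule prod_mono)
      fix j assume j: "j \<in> {..<N} - {k}"
      have "\<bar>real k - real j\<bar> \<ge> 1" using j by auto
      moreover have "\<xi> k - \<xi> j = (real k - real j) / (real n * real N)"
        using N0 n by (simp add: \<xi>_def field_simps)
      ultimately have d: "\<bar>\<xi> k - \<xi> j\<bar> \<ge> 1 / (real n * real N)"
        by (simp add: abs_mult divide_right_mono)
      have nm: "\<bar>t - \<xi> j\<bar> \<le> 1 / real n" by (rule diam[OF tI \<xi>I]) (use j in auto)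
      have "\<bar>(t - \<xi> j) / (\<xi> k - \<xi> j)\<bar> \<le> (1 / real n) / (1 / (real n * real N))"
        unfolding abs_divide by (rule frac_le) (use nm d N0 n in auto)
      also have "\<dots> = real N" using n N0 by simp
      finally show "0 \<le> \<bar>(t - \<xi> j) / (\<xi> k - \<xi> j)\<bar> \<and> \<bar>(t - \<xi> j) / (\<xi> k - \<xi> j)\<bar> \<le> real N" by simp
    qed
    also have "\<dots> = real N ^ (N - 1)" using k by simp
    also have "\<dots> \<le> real N ^ N" using N0 by (intro power_increasing) auto
    finally show ?thesis .
  qed
  let ?L = "lebesgue_const N"
  have L0: "0 \<le> ?L" by (simp add: lebesgue_const_def)
  have suml: "(\<Sum>k<N. \<bar>l k\<bar>) \<le> ?L"
    using sum_mono[of "{..<N}" "\<lambda>k. \<bar>l k\<bar>" "\<lambda>_. real N ^ N"] lk by (simp add: lebesgue_const_def)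
  \<comment> \<open>The functional has total weight at most \<open>1 + ?L\<close>; this is applied
    once in each argument of the kernel.\<close>
  have wsum: "\<bar>e - (\<Sum>k<N. l k * E k)\<bar> \<le> (1 + ?L) * b" if "\<bar>e\<bar> \<le> b" "\<And>k. k < N \<Longrightarrow> \<bar>E k\<bar> \<le> b" for e b E
  proof -
    have b: "0 \<le> b" using that(1) by linarith
    have "\<bar>\<Sum>k<N. l k * E k\<bar> \<le> (\<Sum>k<N. \<bar>l k\<bar> * b)"
      using that(2) by (intro order_trans[OF sum_abs] sum_mono) (auto simp: abs_mult intro: mult_left_mono)
    also have "\<dots> \<le> ?L * b" unfolding sum_distrib_right[symmetric] by (intro mult_right_mono suml b)
    finally show ?thesis using that(1) by (simp add: distrib_right)
  qed
  show ?thesis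
  proof (rule exI[of _ l], rule exI[of _ \<xi>], intro conjI allI impI \<xi>G suml)
    fix \<sigma> :: real and c p assume s: "0 < \<sigma>" "1 \<le> real n * \<sigma>" and c: "c = case_nat 1 (\<lambda>k. - l k)" and p: "p = case_nat t \<xi>"
    define \<theta> where "\<theta> = 1 / (real n * \<sigma>)"
    have \<theta>: "0 \<le> \<theta>" "\<theta> \<le> 1" using s n by (auto simp: \<theta>_def)
    let ?k = "\<lambda>a s. exp (- (a - s)\<^sup>2 / \<sigma>\<^sup>2)"
    \<comment> \<open>The interpolation error at \<open>t\<close> of the kernel section centred at
      \<open>a\<close>.\<close>
    define D where "D a = ?k a t - (\<Sum>k<N. l k * ?k a (\<xi> k))" for a
    have Da: "\<bar>D a\<bar> \<le> (1 + ?L) * (3 * \<theta> ^ (2 * K))" if a: "a \<in> ?I" for a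
    proof -
      define q where "q = (\<Sum>m<K. smult ((- 1 / \<sigma>\<^sup>2) ^ m / fact m) ([:- a, 1:] ^ (2 * m)))"
      have dq: "degree q < N"
      proof -
        have "degree q \<le> 2 * (K - 1)" unfolding q_def
          by (intro degree_sum_le order_trans[OF degree_smult_le]) (auto simp: degree_linear_power)
        then show ?thesis using K N by simp
      qed
      have pq: "poly q s = (\<Sum>m<K. (- (a - s)\<^sup>2 / \<sigma>\<^sup>2) ^ m / fact m)" for s
      proof -
        have "(- 1 / \<sigma>\<^sup>2) ^ m * (s - a) ^ (2 * m) = (- (a - s)\<^sup>2 / \<sigma>\<^sup>2) ^ m" for m
        proof -
          have "- (a - s)\<^sup>2 / \<sigma>\<^sup>2 = (- 1 / \<sigma>\<^sup>2) * (s - a)\<^sup>2" by (simp add: power2_commute)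
          then show ?thesis by (simp only: power_mult_distrib power_mult)
        qed
        then show ?thesis by (simp add: q_def poly_sum)
      qed
      define E where "E s = ?k a s - poly q s" for s
      have E: "\<bar>E s\<bar> \<le> 3 * \<theta> ^ (2 * K)" if s': "s \<in> ?I" for s
      proof -
        have "\<bar>a - s\<bar> / \<sigma> \<le> (1 / real n) / \<sigma>" using diam[OF a s'] s by (intro divide_right_mono) auto
        then have "\<bar>a - s\<bar> / \<sigma> \<le> \<theta>" by (simp add: \<theta>_def)
        then have "(\<bar>a - s\<bar> / \<sigma>)\<^sup>2 \<le> \<theta>\<^sup>2" using s by (intro power_mono) auto
        then have y: "\<bar>- (a - s)\<^sup>2 / \<sigma>\<^sup>2\<bar> \<le> \<theta>\<^sup>2" by (simp add: power_divide)
        also have "\<theta>\<^sup>2 \<le> 1" using \<theta> by (simp add: power_le_one)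
        finally have "\<bar>E s\<bar> \<le> 3 * \<bar>- (a - s)\<^sup>2 / \<sigma>\<^sup>2\<bar> ^ K" unfolding E_def pq by (rule exp_taylor_bound)
        also have "\<dots> \<le> 3 * (\<theta>\<^sup>2) ^ K" using y by (intro mult_left_mono power_mono) auto
        finally show ?thesis by (simp add: power_mult)
      qed
      have "D a = E t - (\<Sum>k<N. l k * E (\<xi> k))"
        unfolding D_def E_def right_diff_distrib sum_subtractf lag[OF dq] by simp
      then show ?thesis using wsum[of "E t" "3 * \<theta> ^ (2 * K)" "\<lambda>k. E (\<xi> k)"] E tI \<xi>I by simp
    qed
    \<comment> \<open>The inner sum of the form is the functional in the second argument, that is
      \<open>D\<close>; the outer sum applies it again in the first. Index 0 stands for
      \<open>t\<close> with weight 1, index \<open>Suc k\<close> for node \<open>k\<close> with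
      weight \<open>- l k\<close>.\<close>
    have "(\<Sum>i<Suc N. \<Sum>j<Suc N. c i * c j * ?k (p i) (p j)) = (\<Sum>i<Suc N. c i * (\<Sum>j<Suc N. c j * ?k (p i) (p j)))"
      unfolding sum_distrib_left by (simp only: mult.assoc)
    also have "(\<lambda>i. \<Sum>j<Suc N. c j * ?k (p i) (p j)) = (\<lambda>i. D (p i))"
      unfolding sum.lessThan_Suc_shift by (simp add: c p D_def sum_negf)
    also have "(\<Sum>i<Suc N. c i * D (p i)) = D t - (\<Sum>k<N. l k * D (\<xi> k))"
      unfolding sum.lessThan_Suc_shift by (simp add: c p sum_negf)
    also have "\<dots> \<le> \<bar>D t - (\<Sum>k<N. l k * D (\<xi> k))\<bar>" by simp
    also have "\<dots> \<le> (1 + ?L) * ((1 + ?L) * (3 * \<theta> ^ (2 * K)))"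
      by (rule wsum) (use Da tI \<xi>I in auto)
    finally show "(\<Sum>i<Suc N. \<Sum>j<Suc N. c i * c j * ?k (p i) (p j)) \<le> 3 * (1 + ?L)\<^sup>2 * (1 / (real n * \<sigma>)) ^ (2 * K)"
      unfolding \<theta>_def by (simp add: power2_eq_square ac_simps)
  qed
qed

section \<open>Interpolation on the cube, one coordinate at a time\<close>

definition set_coord :: "real^'d \<Rightarrow> 'd \<Rightarrow> real \<Rightarrow> real^'d" where
  "set_coord x i s = (\<chi> j. if j = i then s else x $ j)"

lemma set_coord_mem: "x \<in> unit_cube \<Longrightarrow> 0 \<le> s \<Longrightarrow> s \<le> 1 \<Longrightarrow> set_coord x i s \<in> unit_cube"
  by (auto simp: unit_cube_def set_coord_def)

lemma set_coord_same [simp]: "set_coord x i (x $ i) = x"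
  by (simp add: set_coord_def vec_eq_iff)

lemma gauss_kernel_set_coord:
  "gauss_kernel \<sigma> (set_coord x i s) (set_coord x i t) = exp (- (s - t)\<^sup>2 / \<sigma>\<^sup>2)"
proof -
  have "set_coord x i s - set_coord x i t = axis i (s - t)"
    by (auto simp: set_coord_def axis_def vec_eq_iff)
  moreover have "(norm (axis i (s - t) :: real^'a))\<^sup>2 = (s - t)\<^sup>2"
    unfolding power2_norm_eq_inner by (simp add: inner_axis_axis power2_eq_square)
  ultimately show ?thesis by (simp add: gauss_kernel_def)
qed

text \<open>On a line parallel to an axis the Gaussian kernel is the one-dimensional one, so the
  bound for the interpolation functional applies. The square root turns the exponent
  \<open>2 K\<close> into \<open>K\<close>.\<close>

lemma rkhs_ball_interpolate_coord:
  assumes F: "F \<in> rkhs_ball (gauss_kernel \<sigma>) unit_cube B" and B: "0 \<le> B" and x: "x \<in> unit_cube"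
    and n: "1 \<le> n" and K: "1 \<le> K" and N: "N = 2 * K" and s: "0 < \<sigma>" "1 \<le> real n * \<sigma>"
  shows "\<exists>l \<xi>. (\<forall>k<N. \<xi> k \<in> grid n N) \<and> (\<Sum>k<N. \<bar>l k\<bar>) \<le> lebesgue_const N \<and>
    \<bar>F x - (\<Sum>k<N. l k * F (set_coord x i (\<xi> k)))\<bar> \<le> 2 * B * (1 + lebesgue_const N) * (1 / (real n * \<sigma>)) ^ K"
proof -
  have xi: "0 \<le> x$i" "x$i \<le> 1" using x by (auto simp: unit_cube_def)
  let ?L = "lebesgue_const N" and ?\<theta> = "1 / (real n * \<sigma>)"
  obtain l \<xi> where l: "\<forall>k<N. \<xi> k \<in> grid n N" "(\<Sum>k<N. \<bar>l k\<bar>) \<le> ?L"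
    and Q: "\<And>c p. c = case_nat 1 (\<lambda>k. - l k) \<Longrightarrow> p = case_nat (x$i) \<xi> \<Longrightarrow>
      (\<Sum>i<Suc N. \<Sum>j<Suc N. c i * c j * exp (- (p i - p j)\<^sup>2 / \<sigma>\<^sup>2)) \<le> 3 * (1 + ?L)\<^sup>2 * ?\<theta> ^ (2 * K)"
    using gauss_interpolation_weights[OF xi n K N] s by blast
  define c where "c = case_nat 1 (\<lambda>k. - l k)"
  define p where "p = case_nat (x$i) \<xi>"
  have "(\<Sum>j<Suc N. c j * F (set_coord x i (p j)))\<^sup>2
     \<le> B\<^sup>2 * (\<Sum>j<Suc N. \<Sum>k<Suc N. c j * c k * gauss_kernel \<sigma> (set_coord x i (p j)) (set_coord x i (p k)))"
  proof (rule rkhs_ballD[OF F])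
    fix j assume "j < Suc N"
    then show "set_coord x i (p j) \<in> unit_cube"
      unfolding p_def using l(1) grid_bounds xi x by (cases j) (auto intro!: set_coord_mem)
  qed
  also have "\<dots> \<le> B\<^sup>2 * (3 * (1 + ?L)\<^sup>2 * ?\<theta> ^ (2 * K))"
    unfolding gauss_kernel_set_coord by (intro mult_left_mono Q c_def p_def) auto
  \<comment> \<open>The constant 3 is raised to 4 to obtain a perfect square.\<close>
  also have "\<dots> \<le> B\<^sup>2 * (4 * (1 + ?L)\<^sup>2 * ?\<theta> ^ (2 * K))"
    using s by (intro mult_left_mono mult_right_mono) auto
  also have "\<dots> = (2 * B * (1 + ?L) * ?\<theta> ^ K)\<^sup>2"
    by (simp add: power_mult_distrib power_mult[symmetric] power_even_eq mult.commute)
  finally have "\<bar>\<Sum>j<Suc N. c j * F (set_coord x i (p j))\<bar> \<le> \<bar>2 * B * (1 + ?L) * ?\<theta> ^ K\<bar>"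
    by (simp only: abs_le_square_iff)
  moreover have "0 \<le> 2 * B * (1 + ?L) * ?\<theta> ^ K" using B s by (simp add: lebesgue_const_def)
  ultimately have "\<bar>\<Sum>j<Suc N. c j * F (set_coord x i (p j))\<bar> \<le> 2 * B * (1 + ?L) * ?\<theta> ^ K" by (simp only: abs_of_nonneg)
  moreover have "(\<Sum>j<Suc N. c j * F (set_coord x i (p j))) = F x - (\<Sum>k<N. l k * F (set_coord x i (\<xi> k)))"
    unfolding sum.lessThan_Suc_shift by (simp add: c_def p_def sum_negf)
  ultimately show ?thesis using l by auto
qed

text \<open>Induction on the set \<open>S\<close> of coordinates that are off the grid.
  Interpolating in one of them costs the error \<open>e\<close> and multiplies the bound for the
  smaller set by at most the Lebesgue constant.\<close>

lemma rkhs_ball_grid_bound: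
  assumes F: "F \<in> rkhs_ball (gauss_kernel \<sigma>) unit_cube B" and B: "0 \<le> B"
    and n: "1 \<le> n" and K: "1 \<le> K" and N: "N = 2 * K" and s: "0 < \<sigma>" "1 \<le> real n * \<sigma>"
    and grid: "\<And>x. (\<And>i. x$i \<in> grid n N) \<Longrightarrow> \<bar>F x\<bar> \<le> \<epsilon>" and \<epsilon>: "0 \<le> \<epsilon>"
    and x: "x \<in> (unit_cube :: (real^'d) set)"
  shows "\<bar>F x\<bar> \<le> (1 + lebesgue_const N) ^ CARD('d) *
    (\<epsilon> + real CARD('d) * (2 * B * (1 + lebesgue_const N) * (1 / (real n * \<sigma>)) ^ K))"
proof -
  let ?L = "lebesgue_const N"
  define e where "e = 2 * B * (1 + ?L) * (1 / (real n * \<sigma>)) ^ K"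
  have L: "0 \<le> ?L" by (simp add: lebesgue_const_def)
  have e: "0 \<le> e" using B L s by (simp add: e_def)
  have "\<bar>F x\<bar> \<le> (1 + ?L) ^ card S * (\<epsilon> + real (card S) * e)" if "x \<in> unit_cube" "\<forall>i. i \<notin> S \<longrightarrow> x$i \<in> grid n N" for S x
    using finite[of S] that
  proof (induction S arbitrary: x rule: finite_induct)
    case empty then show ?case using grid by simp
  next
    case (insert i S)
    obtain l \<xi> where l: "\<forall>k<N. \<xi> k \<in> grid n N" "(\<Sum>k<N. \<bar>l k\<bar>) \<le> ?L"
      "\<bar>F x - (\<Sum>k<N. l k * F (set_coord x i (\<xi> k)))\<bar> \<le> e"
      using rkhs_ball_interpolate_coord[OF F B insert.prems(1) n K N s] unfolding e_def by blast
    let ?b = "(1 + ?L) ^ card S * (\<epsilon> + real (card S) * e)"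
    have b: "0 \<le> ?b" using L \<epsilon> e by simp
    have "\<bar>F (set_coord x i (\<xi> k))\<bar> \<le> ?b" if k: "k < N" for k
    proof (rule insert.IH)
      show "set_coord x i (\<xi> k) \<in> unit_cube" using l(1) k grid_bounds insert.prems by (intro set_coord_mem) auto
      show "\<forall>j. j \<notin> S \<longrightarrow> set_coord x i (\<xi> k) $ j \<in> grid n N"
        using l(1) k insert.prems by (auto simp: set_coord_def)
    qed
    then have "\<bar>\<Sum>k<N. l k * F (set_coord x i (\<xi> k))\<bar> \<le> (\<Sum>k<N. \<bar>l k\<bar> * ?b)"
      by (intro order_trans[OF sum_abs] sum_mono) (auto simp: abs_mult intro: mult_left_mono)
    also have "\<dots> \<le> ?L * ?b" unfolding sum_distrib_right[symmetric] by (intro mult_right_mono l(2) b)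
    finally have "\<bar>F x\<bar> \<le> e + ?L * ?b" using l(3) by linarith
    also have "\<dots> \<le> (1 + ?L) ^ Suc (card S) * e + (1 + ?L) * ?b"
    proof -
      have "1 * e \<le> (1 + ?L) ^ Suc (card S) * e" using e L by (intro mult_right_mono one_le_power) auto
      then show ?thesis using b by (simp add: distrib_right)
    qed
    also have "\<dots> = (1 + ?L) ^ Suc (card S) * (\<epsilon> + real (Suc (card S)) * e)" by (simp add: algebra_simps)
    finally show ?case using insert.hyps by simp
  qed
  from this[of x UNIV] x show ?thesis by (simp add: e_def)
qed

lemma card_grid_points:
  "finite {x::real^'d. \<forall>i. x$i \<in> grid n N}" "card {x::real^'d. \<forall>i. x$i \<in> grid n N} \<le> (n * N) ^ CARD('d)"
proof -
  have eq: "{x::real^'d. \<forall>i. x$i \<in> grid n N} = vec_lambda ` (PiE UNIV (\<lambda>_. grid n N))"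
  proof (intro set_eqI iffI)
    fix x :: "real^'d" assume "x \<in> {x. \<forall>i. x$i \<in> grid n N}"
    then show "x \<in> vec_lambda ` (PiE UNIV (\<lambda>_. grid n N))"
      by (intro image_eqI[of _ _ "vec_nth x"]) auto
  qed auto
  have fin: "finite (PiE (UNIV::'d set) (\<lambda>_. grid n N))" by (intro finite_PiE) (auto simp: card_grid_le)
  then show "finite {x::real^'d. \<forall>i. x$i \<in> grid n N}" unfolding eq by simp
  have "card {x::real^'d. \<forall>i. x$i \<in> grid n N} \<le> card (PiE (UNIV::'d set) (\<lambda>_. grid n N))"
    unfolding eq by (rule card_image_le[OF fin])
  also have "\<dots> = card (grid n N) ^ CARD('d)" by (simp add: card_PiE)
  also have "\<dots> \<le> (n * N) ^ CARD('d)" by (intro power_mono card_grid_le) simp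
  finally show "card {x::real^'d. \<forall>i. x$i \<in> grid n N} \<le> (n * N) ^ CARD('d)" .
qed

text \<open>Rounding the values at the grid points gives finitely many codes. Two functions with
  equal codes differ by at most \<open>\<epsilon>\<close> on the grid, and their difference lies in
  the ball of radius \<open>2 B\<close>, so \<open>rkhs_ball_grid_bound\<close> extends this to the
  cube; hence \<open>4 B\<close> in the error.\<close>

lemma gauss_rkhs_ball_covering:
  assumes B: "0 < B" and n: "1 \<le> n" and K: "1 \<le> K" and N: "N = 2 * K" and s: "0 < \<sigma>" "1 \<le> real n * \<sigma>" and \<epsilon>: "0 < \<epsilon>"
  shows "\<exists>T. finite T \<and> T \<subseteq> rkhs_ball (gauss_kernel \<sigma>) (unit_cube :: (real^'d) set) B \<and>
    real (card T) \<le> (2 * B / \<epsilon> + 3) ^ ((n * N) ^ CARD('d)) \<and>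
    (\<forall>f \<in> rkhs_ball (gauss_kernel \<sigma>) unit_cube B. \<exists>g\<in>T. \<forall>x\<in>unit_cube.
       \<bar>f x - g x\<bar> \<le> (1 + lebesgue_const N) ^ CARD('d) *
         (\<epsilon> + real CARD('d) * (4 * B * (1 + lebesgue_const N) * (1 / (real n * \<sigma>)) ^ K)))"
proof -
  let ?H = "rkhs_ball (gauss_kernel \<sigma>) (unit_cube :: (real^'d) set) B"
  let ?G = "{x::real^'d. \<forall>i. x$i \<in> grid n N}"
  have Gc: "x \<in> unit_cube" if "x \<in> ?G" for x using that by (auto simp: unit_cube_def intro: grid_bounds[of _ n N])
  define code where "code f = restrict (\<lambda>x. \<lfloor>f x / \<epsilon>\<rfloor>) ?G" for f :: "real^'d \<Rightarrow> real"
  \<comment> \<open>The lower end is a bound for the floor of \<open>- B / \<epsilon>\<close>; the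
    interval has at most \<open>2 B / \<epsilon> + 3\<close> elements.\<close>
  let ?R = "{- \<lfloor>B / \<epsilon>\<rfloor> - 1 .. \<lfloor>B / \<epsilon>\<rfloor>}"
  have R: "code f \<in> PiE ?G (\<lambda>_. ?R)" if f: "f \<in> ?H" for f
  proof -
    have "\<lfloor>f x / \<epsilon>\<rfloor> \<in> ?R" if "x \<in> ?G" for x
    proof -
      have "\<bar>f x\<bar> \<le> B" using rkhs_ball_abs_le[OF f _ Gc[OF that]] B by simp
      then have "f x / \<epsilon> \<le> B / \<epsilon>" "- (B / \<epsilon>) \<le> f x / \<epsilon>" using \<epsilon> by (auto simp: field_simps abs_le_iff)
      then show ?thesis by (auto intro: floor_mono) linarith
    qed
    then show ?thesis unfolding code_def by auto
  qed
  have finR: "finite (PiE ?G (\<lambda>_. ?R))" by (intro finite_PiE card_grid_points) auto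
  have sub: "code ` ?H \<subseteq> PiE ?G (\<lambda>_. ?R)" using R by blast
  then have finC: "finite (code ` ?H)" using finR finite_subset by blast
  \<comment> \<open>One representative per code, taken inside the ball, so that members of the net
    are themselves continuous on the cube.\<close>
  define T where "T = inv_into ?H code ` (code ` ?H)"
  have fT: "finite T" unfolding T_def using finC by simp
  have TH: "T \<subseteq> ?H" unfolding T_def by (auto intro: inv_into_into)
  have "0 \<le> B / \<epsilon>" using B \<epsilon> by simp
  then have cR: "real (card ?R) \<le> 2 * B / \<epsilon> + 3" by (simp add: of_nat_nat) linarith
  have cR1: "1 \<le> 2 * B / \<epsilon> + 3" using \<open>0 \<le> B / \<epsilon>\<close> by simp
  have "card T \<le> card (code ` ?H)" unfolding T_def by (rule card_image_le[OF finC])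
  also have "\<dots> \<le> card (PiE ?G (\<lambda>_. ?R))" by (rule card_mono[OF finR sub])
  also have "\<dots> = card ?R ^ card ?G" by (simp add: card_PiE card_grid_points)
  finally have "real (card T) \<le> real (card ?R) ^ card ?G" by (simp only: of_nat_le_iff flip: of_nat_power)
  also have "\<dots> \<le> (2 * B / \<epsilon> + 3) ^ card ?G" by (intro power_mono cR) simp
  also have "\<dots> \<le> (2 * B / \<epsilon> + 3) ^ ((n * N) ^ CARD('d))"
    by (intro power_increasing card_grid_points cR1)
  finally have cT: "real (card T) \<le> (2 * B / \<epsilon> + 3) ^ ((n * N) ^ CARD('d))" .
  have cover: "\<exists>g\<in>T. \<forall>x\<in>unit_cube. \<bar>f x - g x\<bar> \<le> (1 + lebesgue_const N) ^ CARD('d) *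
         (\<epsilon> + real CARD('d) * (4 * B * (1 + lebesgue_const N) * (1 / (real n * \<sigma>)) ^ K))" if f: "f \<in> ?H" for f
  proof -
    define g where "g = inv_into ?H code (code f)"
    have gT: "g \<in> T" unfolding T_def g_def using f by blast
    have gc: "code g = code f" unfolding g_def by (rule f_inv_into_f[of "code f" code ?H]) (use f in blast)
    have close: "\<bar>f x - g x\<bar> \<le> \<epsilon>" if "\<And>i. x$i \<in> grid n N" for x
    proof -
      have "\<lfloor>f x / \<epsilon>\<rfloor> = \<lfloor>g x / \<epsilon>\<rfloor>" using fun_cong[OF gc, of x] that by (simp add: code_def)
      then have "\<bar>f x / \<epsilon> - g x / \<epsilon>\<bar> \<le> 1" by linarith
      then show ?thesis using \<epsilon> by (simp add: abs_divide flip: diff_divide_distrib)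
    qed
    have fg: "(\<lambda>x. f x - g x) \<in> rkhs_ball (gauss_kernel \<sigma>) unit_cube (2 * B)"
      using rkhs_ball_diff[OF f, of g] gT TH by blast
    have "\<bar>f x - g x\<bar> \<le> (1 + lebesgue_const N) ^ CARD('d) *
         (\<epsilon> + real CARD('d) * (2 * (2 * B) * (1 + lebesgue_const N) * (1 / (real n * \<sigma>)) ^ K))" if x: "x \<in> unit_cube" for x
      using rkhs_ball_grid_bound[OF fg _ n K N s, of \<epsilon> x] close x B \<epsilon> by simp
    then show ?thesis using gT by auto
  qed
  show ?thesis using fT TH cT cover by blast
qed

section \<open>Concentration and the data distribution\<close>

text \<open>Chernoff's argument: exponential Markov inequality, with the moment generating function
  of the sum factored by independence.\<close>

lemma exp_product_tail_bound:
  assumes M: "prob_space M" and h [measurable]: "h \<in> borel_measurable M"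
    and E: "(\<integral>\<^sup>+z. ennreal (exp (h z)) \<partial>M) \<le> ennreal (exp b)"
  shows "measure (PiM {..<m} (\<lambda>_. M)) {D \<in> space (PiM {..<m} (\<lambda>_. M)). real m * b + t \<le> (\<Sum>i<m. h (D i))} \<le> exp (- t)"
proof -
  interpret prob_space M by (rule M)
  interpret P: product_sigma_finite "\<lambda>_::nat. M" ..
  let ?P = "PiM {..<m} (\<lambda>_. M)"
  let ?B = "{D \<in> space ?P. real m * b + t \<le> (\<Sum>i<m. h (D i))}"
  have B [measurable]: "?B \<in> sets ?P" by measurable
  have prod: "(\<integral>\<^sup>+D. (\<Prod>i<m. ennreal (exp (h (D i)))) \<partial>?P) \<le> ennreal (exp (real m * b))"
  proof -
    have "(\<integral>\<^sup>+D. (\<Prod>i<m. ennreal (exp (h (D i)))) \<partial>?P) = (\<Prod>i<m. (\<integral>\<^sup>+z. ennreal (exp (h z)) \<partial>M))"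
      by (rule P.product_nn_integral_prod) auto
    also have "\<dots> \<le> (\<Prod>i<m. ennreal (exp b))" by (intro prod_mono_ennreal E)
    also have "\<dots> = ennreal (exp (real m * b))" by (simp add: ennreal_power exp_of_nat_mult)
    finally show ?thesis .
  qed
  have "emeasure ?P ?B = (\<integral>\<^sup>+D. indicator ?B D \<partial>?P)" by simp
  also have "\<dots> \<le> (\<integral>\<^sup>+D. ennreal (exp (- (real m * b + t))) * (\<Prod>i<m. ennreal (exp (h (D i)))) \<partial>?P)"
  proof (rule nn_integral_mono)
    fix D
    show "indicator ?B D \<le> ennreal (exp (- (real m * b + t))) * (\<Prod>i<m. ennreal (exp (h (D i))))"
    proof (cases "D \<in> ?B")
      case True
      have "1 \<le> exp (- (real m * b + t) + (\<Sum>i<m. h (D i)))" using True by simp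
      also have "\<dots> = exp (- (real m * b + t)) * (\<Prod>i<m. exp (h (D i)))" by (simp add: exp_add exp_sum)
      finally have "ennreal 1 \<le> ennreal (exp (- (real m * b + t)) * (\<Prod>i<m. exp (h (D i))))" by (rule ennreal_leI)
      then show ?thesis using True by (simp add: ennreal_mult prod_nonneg prod_ennreal)
    qed simp
  qed
  also have "\<dots> = ennreal (exp (- (real m * b + t))) * (\<integral>\<^sup>+D. (\<Prod>i<m. ennreal (exp (h (D i)))) \<partial>?P)"
    by (rule nn_integral_cmult) measurable
  also have "\<dots> \<le> ennreal (exp (- (real m * b + t))) * ennreal (exp (real m * b))"
    by (intro mult_left_mono prod) simp
  also have "\<dots> = ennreal (exp (- t))" by (simp add: ennreal_mult[symmetric] exp_add[symmetric])
  finally show ?thesis unfolding measure_def by (intro enn2real_leI) auto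
qed

lemma (in prob_space) mgf_bernstein:
  assumes h [measurable]: "h \<in> borel_measurable M" and H: "\<And>z. z \<in> space M \<Longrightarrow> \<bar>h z\<bar> \<le> H"
    and V: "(\<integral>z. (h z)\<^sup>2 \<partial>M) \<le> V * (\<integral>z. h z \<partial>M)" and E0: "0 \<le> (\<integral>z. h z \<partial>M)"
    and s: "\<bar>s\<bar> * H \<le> 1" "6 * \<bar>s\<bar> * V \<le> 1"
  shows "(\<integral>\<^sup>+z. ennreal (exp (s * h z)) \<partial>M) \<le> ennreal (exp (s * (\<integral>z. h z \<partial>M) + \<bar>s\<bar> * (\<integral>z. h z \<partial>M) / 2))"
proof -
  let ?E = "\<integral>z. h z \<partial>M"
  have ih: "integrable M h" by (rule integrable_const_bound[of _ H]) (use H in auto)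
  have ih2: "integrable M (\<lambda>z. (h z)\<^sup>2)"
  proof (rule integrable_const_bound[of _ "H\<^sup>2"])
    show "AE z in M. norm ((h z)\<^sup>2) \<le> H\<^sup>2"
      using H by (intro AE_I2) (metis abs_ge_zero norm_power power_mono real_norm_def)
  qed auto
  have ie: "integrable M (\<lambda>z. 1 + s * h z + (3 * s\<^sup>2) * (h z)\<^sup>2)" using ih ih2 by auto
  have pt: "exp (s * h z) \<le> 1 + s * h z + (3 * s\<^sup>2) * (h z)\<^sup>2" if z: "z \<in> space M" for z
  proof -
    have "\<bar>s * h z\<bar> \<le> \<bar>s\<bar> * H" unfolding abs_mult by (intro mult_left_mono H z) auto
    then have "\<bar>exp (s * h z) - (\<Sum>m<2. (s * h z) ^ m / fact m)\<bar> \<le> 3 * \<bar>s * h z\<bar> ^ 2"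
      using s by (intro exp_taylor_bound) simp
    moreover have "(\<Sum>m<2. (s * h z) ^ m / fact m) = 1 + s * h z" by (simp add: numeral_2_eq_2)
    moreover have "\<bar>s * h z\<bar> ^ 2 = s\<^sup>2 * (h z)\<^sup>2" by (simp add: power_mult_distrib)
    ultimately show ?thesis by (simp only: abs_le_iff) linarith
  qed
  have "(\<integral>\<^sup>+z. ennreal (exp (s * h z)) \<partial>M) \<le> (\<integral>\<^sup>+z. ennreal (1 + s * h z + (3 * s\<^sup>2) * (h z)\<^sup>2) \<partial>M)"
    by (intro nn_integral_mono ennreal_leI pt)
  also have "\<dots> = ennreal (\<integral>z. 1 + s * h z + (3 * s\<^sup>2) * (h z)\<^sup>2 \<partial>M)"
    by (rule nn_integral_eq_integral[OF ie]) (intro AE_I2 order_trans[OF _ pt], auto)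
  also have "(\<integral>z. 1 + s * h z + (3 * s\<^sup>2) * (h z)\<^sup>2 \<partial>M) = 1 + s * ?E + (3 * s\<^sup>2) * (\<integral>z. (h z)\<^sup>2 \<partial>M)"
    using ih ih2 by (simp add: prob_space)
  also have "\<dots> \<le> exp (s * ?E + \<bar>s\<bar> * ?E / 2)"
  proof -
    have "(3 * s\<^sup>2) * (\<integral>z. (h z)\<^sup>2 \<partial>M) \<le> (3 * s\<^sup>2) * (V * ?E)" by (intro mult_left_mono V) auto
    also have "\<dots> = (6 * \<bar>s\<bar> * V) * (\<bar>s\<bar> * ?E) / 2" by (simp add: power2_eq_square)
    also have "\<dots> \<le> 1 * (\<bar>s\<bar> * ?E) / 2" using s E0 by (intro divide_right_mono mult_right_mono) auto
    finally have "1 + s * ?E + (3 * s\<^sup>2) * (\<integral>z. (h z)\<^sup>2 \<partial>M) \<le> 1 + (s * ?E + \<bar>s\<bar> * ?E / 2)" by simp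
    also have "\<dots> \<le> exp (s * ?E + \<bar>s\<bar> * ?E / 2)" by (rule exp_ge_add_one_self)
    finally show ?thesis .
  qed
  finally show ?thesis by (simp add: ennreal_leI)
qed

section \<open>The joint distribution of points and labels\<close>

locale classification =
  fixes \<rho>X :: "(real^'d) measure" and \<eta> :: "real^'d \<Rightarrow> real"
  assumes prob_\<rho>X: "prob_space \<rho>X" and sets_\<rho>X [measurable_cong]: "sets \<rho>X = sets borel"
    and cube_full: "measure \<rho>X unit_cube = 1"
    and eta_meas [measurable]: "\<eta> \<in> borel_measurable borel"
    and eta_range: "\<And>x. x \<in> unit_cube \<Longrightarrow> 0 \<le> \<eta> x" "\<And>x. x \<in> unit_cube \<Longrightarrow> \<eta> x \<le> 1"
begin

sublocale X: prob_space \<rho>X by (rule prob_\<rho>X)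

abbreviation Y :: "real measure" where "Y \<equiv> count_space {-1, 1}"
abbreviation \<rho> :: "((real^'d) \<times> real) measure" where "\<rho> \<equiv> rho_meas \<rho>X \<eta>"

lemma space_\<rho>X [simp]: "space \<rho>X = UNIV"
  using sets_eq_imp_space_eq[OF sets_\<rho>X] by simp

lemma cube_sets [measurable]: "(unit_cube :: (real^'d) set) \<in> sets borel" by (simp add: unit_cube_eq_cbox)

lemma AE_cube: "AE x in \<rho>X. x \<in> unit_cube"
  using X.AE_in_set_eq_1[of unit_cube] cube_full by (simp add: sets_\<rho>X)

text \<open>Off the cube \<open>\<eta>\<close> may leave \<open>[0, 1]\<close>, where
  \<open>ennreal\<close> would truncate the weights; the cube has full mass, so it is enough to
  argue inside it.\<close>

lemma AE_cubeI: "(\<And>x. x \<in> unit_cube \<Longrightarrow> P x) \<Longrightarrow> AE x in \<rho>X. P x"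
  using AE_cube by (rule eventually_mono)

lemma sets_\<rho> [measurable_cong]: "sets \<rho> = sets (borel \<Otimes>\<^sub>M Y)"
  unfolding rho_meas_def sets_density by (rule sets_pair_measure_cong[OF sets_\<rho>X refl])

lemma space_\<rho>: "space \<rho> = UNIV \<times> {-1, 1}"
  using sets_eq_imp_space_eq[OF sets_\<rho>] by (simp add: space_pair_measure)

lemma label_eq_measurable [measurable]: "Measurable.pred (borel \<Otimes>\<^sub>M Y) (\<lambda>z. snd z = c)"
proof -
  have "{y \<in> {-1, 1}. y = c} \<in> sets Y" by auto
  then show ?thesis
    using measurable_compose[OF measurable_snd[of borel Y], of "\<lambda>y. y = c" "count_space UNIV"] by simp
qed

lemma label_measurable [measurable]: "snd \<in> borel_measurable (borel \<Otimes>\<^sub>M Y)"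
  by (rule measurable_compose[OF measurable_snd]) simp

lemma pair_const_measurable: "y \<in> {-1, 1} \<Longrightarrow> (\<lambda>x. (x, y)) \<in> measurable borel (borel \<Otimes>\<^sub>M Y)"
  by (rule measurable_Pair) auto

lemma nn_integral_\<rho>:
  assumes g [measurable]: "g \<in> borel_measurable (borel \<Otimes>\<^sub>M Y)"
  shows "(\<integral>\<^sup>+z. g z \<partial>\<rho>) = (\<integral>\<^sup>+x. ennreal (\<eta> x) * g (x, 1) + ennreal (1 - \<eta> x) * g (x, -1) \<partial>\<rho>X)"
proof -
  interpret C: finite_measure Y by (rule finite_measure_count_space) simp
  have g' [measurable]: "g \<in> borel_measurable (\<rho>X \<Otimes>\<^sub>M Y)"
    using g measurable_cong_sets[OF sets_pair_measure_cong[OF sets_\<rho>X refl, of Y] refl] by blast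
  have w [measurable]: "(\<lambda>z. ennreal (if snd z = 1 then \<eta> (fst z) else 1 - \<eta> (fst z))) \<in> borel_measurable (\<rho>X \<Otimes>\<^sub>M Y)"
  proof -
    have "(\<lambda>z. ennreal (if snd z = 1 then \<eta> (fst z) else 1 - \<eta> (fst z))) \<in> borel_measurable (borel \<Otimes>\<^sub>M Y)"
      by measurable
    then show ?thesis using measurable_cong_sets[OF sets_pair_measure_cong[OF sets_\<rho>X refl, of Y] refl] by blast
  qed
  have "(\<integral>\<^sup>+z. g z \<partial>\<rho>) = (\<integral>\<^sup>+z. ennreal (if snd z = 1 then \<eta> (fst z) else 1 - \<eta> (fst z)) * g z \<partial>(\<rho>X \<Otimes>\<^sub>M Y))"
    unfolding rho_meas_def by (rule nn_integral_density) measurable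
  also have "\<dots> = (\<integral>\<^sup>+x. \<integral>\<^sup>+y. ennreal (if snd (x, y) = 1 then \<eta> (fst (x, y)) else 1 - \<eta> (fst (x, y))) * g (x, y) \<partial>Y \<partial>\<rho>X)"
    by (rule C.nn_integral_fst[symmetric]) measurable
  also have "\<dots> = (\<integral>\<^sup>+x. ennreal (\<eta> x) * g (x, 1) + ennreal (1 - \<eta> x) * g (x, -1) \<partial>\<rho>X)"
    by (intro nn_integral_cong) (subst nn_integral_count_space_finite, auto simp: add.commute)
  finally show ?thesis .
qed

lemma prob_\<rho>: "prob_space \<rho>"
proof (rule prob_spaceI)
  have "emeasure \<rho> (space \<rho>) = (\<integral>\<^sup>+z. 1 \<partial>\<rho>)" by simp
  also have "\<dots> = (\<integral>\<^sup>+x. ennreal (\<eta> x) * 1 + ennreal (1 - \<eta> x) * 1 \<partial>\<rho>X)" by (rule nn_integral_\<rho>) simp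
  also have "\<dots> = (\<integral>\<^sup>+x. 1 \<partial>\<rho>X)"
    by (intro nn_integral_cong_AE AE_cubeI) (auto simp: eta_range simp flip: ennreal_plus)
  finally show "emeasure \<rho> (space \<rho>) = 1" using X.emeasure_space_1 by simp
qed

sublocale Z: prob_space \<rho> by (rule prob_\<rho>)

text \<open>For a nonnegative integrand both Bochner integrals are the real parts of the same
  extended integral, so integrability is no hypothesis.\<close>

lemma integral_\<rho>_nonneg:
  assumes g [measurable]: "g \<in> borel_measurable (borel \<Otimes>\<^sub>M Y)" and g0: "\<And>x y. y \<in> {-1, 1} \<Longrightarrow> 0 \<le> g (x, y)"
  shows "(\<integral>z. g z \<partial>\<rho>) = (\<integral>x. \<eta> x * g (x, 1) + (1 - \<eta> x) * g (x, -1) \<partial>\<rho>X)"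
proof -
  have g' [measurable]: "g \<in> borel_measurable \<rho>" using g measurable_cong_sets[OF sets_\<rho> refl] by blast
  have [measurable]: "(\<lambda>x. g (x, 1)) \<in> borel_measurable borel" "(\<lambda>x. g (x, -1)) \<in> borel_measurable borel"
    by (rule measurable_compose[OF pair_const_measurable g]; simp)+
  have "(\<integral>z. g z \<partial>\<rho>) = enn2real (\<integral>\<^sup>+z. ennreal (g z) \<partial>\<rho>)"
    by (rule integral_eq_nn_integral[OF g']) (use g0 in \<open>auto simp: space_\<rho> intro!: AE_I2\<close>)
  also have "(\<integral>\<^sup>+z. ennreal (g z) \<partial>\<rho>) = (\<integral>\<^sup>+x. ennreal (\<eta> x) * ennreal (g (x, 1)) + ennreal (1 - \<eta> x) * ennreal (g (x, -1)) \<partial>\<rho>X)"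
    by (rule nn_integral_\<rho>) measurable
  also have "\<dots> = (\<integral>\<^sup>+x. ennreal (\<eta> x * g (x, 1) + (1 - \<eta> x) * g (x, -1)) \<partial>\<rho>X)"
    by (intro nn_integral_cong_AE AE_cubeI) (auto simp: eta_range g0 ennreal_mult)
  also have "enn2real \<dots> = (\<integral>x. \<eta> x * g (x, 1) + (1 - \<eta> x) * g (x, -1) \<partial>\<rho>X)"
    by (rule integral_eq_nn_integral[symmetric])
       (measurable, intro AE_cubeI, auto simp: eta_range g0)
  finally show ?thesis .
qed

lemma integral_\<rho>:
  assumes g [measurable]: "g \<in> borel_measurable (borel \<Otimes>\<^sub>M Y)" and gM: "\<And>x y. y \<in> {-1, 1} \<Longrightarrow> \<bar>g (x, y)\<bar> \<le> M"
  shows "(\<integral>z. g z \<partial>\<rho>) = (\<integral>x. \<eta> x * g (x, 1) + (1 - \<eta> x) * g (x, -1) \<partial>\<rho>X)"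
proof -
  have g' [measurable]: "g \<in> borel_measurable \<rho>" using g measurable_cong_sets[OF sets_\<rho> refl] by blast
  have [measurable]: "(\<lambda>x. g (x, 1)) \<in> borel_measurable borel" "(\<lambda>x. g (x, -1)) \<in> borel_measurable borel"
    by (rule measurable_compose[OF pair_const_measurable g]; simp)+
  have ig: "integrable \<rho> g"
    by (rule Z.integrable_const_bound[of _ M]) (use gM in \<open>auto simp: space_\<rho> intro!: AE_I2\<close>)
  let ?G = "\<lambda>x. \<eta> x * g (x, 1) + (1 - \<eta> x) * g (x, -1)"
  have iG: "integrable \<rho>X ?G"
  proof (rule X.integrable_const_bound[of _ "M"])
    have "\<bar>?G x\<bar> \<le> M" if x: "x \<in> unit_cube" for x
    proof -
      have "\<bar>?G x\<bar> \<le> \<eta> x * \<bar>g (x, 1)\<bar> + (1 - \<eta> x) * \<bar>g (x, -1)\<bar>"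
        using eta_range[OF x] abs_triangle_ineq[of "\<eta> x * g (x, 1)" "(1 - \<eta> x) * g (x, -1)"] by (simp add: abs_mult)
      also have "\<dots> \<le> \<eta> x * M + (1 - \<eta> x) * M" using eta_range[OF x] gM by (intro add_mono mult_left_mono) auto
      finally show ?thesis by (simp add: algebra_simps)
    qed
    then show "AE x in \<rho>X. norm (?G x) \<le> M" by (intro AE_cubeI) auto
  qed measurable
  \<comment> \<open>Shifting a bounded integrand by \<open>M\<close> reduces to the nonnegative
    case.\<close>
  have "(\<integral>z. g z + M \<partial>\<rho>) = (\<integral>x. \<eta> x * (g (x, 1) + M) + (1 - \<eta> x) * (g (x, -1) + M) \<partial>\<rho>X)"
  proof (rule integral_\<rho>_nonneg[where g = "\<lambda>z. g z + M"])
    show "0 \<le> g (x, y) + M" if "y \<in> {-1, 1}" for x y using gM[OF that, of x] by linarith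
  qed measurable
  also have "\<dots> = (\<integral>x. ?G x + M \<partial>\<rho>X)"
    by (rule Bochner_Integration.integral_cong[OF refl]) (simp add: algebra_simps)
  finally have "(\<integral>z. g z + M \<partial>\<rho>) = (\<integral>x. ?G x + M \<partial>\<rho>X)" .
  moreover have "(\<integral>z. g z + M \<partial>\<rho>) = (\<integral>z. g z \<partial>\<rho>) + M"
    using Z.prob_space by (subst Bochner_Integration.integral_add[OF ig]) auto
  moreover have "(\<integral>x. ?G x + M \<partial>\<rho>X) = (\<integral>x. ?G x \<partial>\<rho>X) + M"
    using X.prob_space by (subst Bochner_Integration.integral_add[OF iG]) auto
  ultimately show ?thesis by linarith
qed

lemma pred_cube_\<rho> [measurable]: "Measurable.pred \<rho> (\<lambda>z. fst z \<notin> unit_cube)"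
proof -
  have "Measurable.pred (borel \<Otimes>\<^sub>M Y) (\<lambda>z::(real^'d) \<times> real. fst z \<notin> unit_cube)" by measurable
  then show ?thesis using measurable_cong_sets[OF sets_\<rho> refl] by blast
qed

lemma AE_\<rho>_cube: "AE z in \<rho>. fst z \<in> unit_cube"
proof -
  have "emeasure \<rho> {z \<in> space \<rho>. fst z \<notin> unit_cube} = (\<integral>\<^sup>+z. indicator {z \<in> space \<rho>. fst z \<notin> unit_cube} z \<partial>\<rho>)"
    by (rule nn_integral_indicator[symmetric]) measurable
  also have "\<dots> = (\<integral>\<^sup>+z. indicator {z. fst z \<notin> unit_cube} z \<partial>\<rho>)"
    by (intro nn_integral_cong) (auto simp: indicator_def)
  also have "\<dots> = (\<integral>\<^sup>+x. ennreal (\<eta> x) * indicator {z. fst z \<notin> unit_cube} (x, 1::real) + ennreal (1 - \<eta> x) * indicator {z. fst z \<notin> unit_cube} (x, -1::real) \<partial>\<rho>X)"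
    by (rule nn_integral_\<rho>) measurable
  also have "\<dots> = (\<integral>\<^sup>+x. 0 \<partial>\<rho>X)" by (intro nn_integral_cong_AE AE_cubeI) auto
  finally show ?thesis by (subst AE_iff_measurable[OF _ refl]) auto
qed

end

section \<open>Excess loss\<close>

locale learning_problem = smooth_loss \<phi> \<phi>' L \<mu> + classification \<rho>X \<eta>
  for \<phi> \<phi>' :: "real \<Rightarrow> real" and L \<mu> :: real and \<rho>X :: "(real^'d) measure" and \<eta> :: "real^'d \<Rightarrow> real" +
  fixes f :: "real^'d \<Rightarrow> real"
  assumes f_meas [measurable]: "f \<in> borel_measurable borel"
    and f_min: "\<And>x. x \<in> unit_cube \<Longrightarrow> phi_minimizer \<phi> (\<eta> x) (f x)"
begin

lemma f_abs_le: "x \<in> unit_cube \<Longrightarrow> \<bar>f x\<bar> \<le> 1"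
  using minimizer_abs_le_1[OF eta_range f_min] by blast

text \<open>Set to 0 off the cube, so that bounds hold at every point of the sample space, as
  \<open>mgf_bernstein\<close> asks, and not just almost everywhere.\<close>

definition excess_loss :: "(real^'d \<Rightarrow> real) \<Rightarrow> (real^'d) \<times> real \<Rightarrow> real" where
  "excess_loss G z = (if fst z \<in> unit_cube then \<phi> (snd z * G (fst z)) - \<phi> (snd z * f (fst z)) else 0)"

definition dist2 :: "(real^'d \<Rightarrow> real) \<Rightarrow> real" where
  "dist2 G = (\<integral>x. (if x \<in> unit_cube then (G x - f x)\<^sup>2 else 0) \<partial>\<rho>X)"

lemma excess_loss_measurable' [measurable]:
  assumes [measurable]: "G \<in> borel_measurable borel"
  shows "excess_loss G \<in> borel_measurable (borel \<Otimes>\<^sub>M Y)"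
  unfolding excess_loss_def[abs_def] by measurable

lemma excess_loss_measurable [measurable]:
  assumes [measurable]: "G \<in> borel_measurable borel"
  shows "excess_loss G \<in> borel_measurable \<rho>"
  using excess_loss_measurable'[OF assms] measurable_cong_sets[OF sets_\<rho> refl] by blast

lemma excess_loss_lipschitz:
  assumes y: "y \<in> {-1, 1}" and M: "1 \<le> M" and G: "x \<in> unit_cube \<Longrightarrow> \<bar>G x\<bar> \<le> M" and H: "x \<in> unit_cube \<Longrightarrow> \<bar>H x\<bar> \<le> M"
    and e: "x \<in> unit_cube \<Longrightarrow> \<bar>G x - H x\<bar> \<le> e" and e0: "0 \<le> e"
  shows "\<bar>excess_loss G (x, y) - excess_loss H (x, y)\<bar> \<le> lip_const M * e"
proof (cases "x \<in> unit_cube")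
  case True
  have "\<bar>\<phi> (y * G x) - \<phi> (y * H x)\<bar> \<le> lip_const M * \<bar>y * G x - y * H x\<bar>"
    by (rule loss_lipschitz) (use y G H True in auto)
  also have "\<bar>y * G x - y * H x\<bar> = \<bar>G x - H x\<bar>" using y by auto
  also have "lip_const M * \<bar>G x - H x\<bar> \<le> lip_const M * e"
    using e[OF True] lip_const_pos[of M] M by (intro mult_left_mono) auto
  finally show ?thesis using True by (simp add: excess_loss_def)
next
  case False
  then show ?thesis using lip_const_pos[of M] M e0 by (simp add: excess_loss_def)
qed

context
  fixes G :: "real^'d \<Rightarrow> real" and M :: real
  assumes G_meas [measurable]: "G \<in> borel_measurable borel" and M: "1 \<le> M" and GM: "\<And>x. x \<in> unit_cube \<Longrightarrow> \<bar>G x\<bar> \<le> M"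
begin

lemma excess_loss_abs_le_dist:
  assumes "y \<in> {-1, 1}" "x \<in> unit_cube" shows "\<bar>excess_loss G (x, y)\<bar> \<le> lip_const M * \<bar>G x - f x\<bar>"
proof -
  have "\<bar>excess_loss G (x, y) - excess_loss f (x, y)\<bar> \<le> lip_const M * \<bar>G x - f x\<bar>"
    using assms GM f_abs_le[OF assms(2)] M by (intro excess_loss_lipschitz) auto
  then show ?thesis using assms(2) by (simp add: excess_loss_def)
qed

lemma excess_loss_abs_le:
  assumes "y \<in> {-1, 1}" shows "\<bar>excess_loss G (x, y)\<bar> \<le> lip_const M * (2 * M)"
proof (cases "x \<in> unit_cube")
  case True
  have "\<bar>G x - f x\<bar> \<le> 2 * M" using GM[OF True] f_abs_le[OF True] M by linarith
  then have "lip_const M * \<bar>G x - f x\<bar> \<le> lip_const M * (2 * M)" using lip_const_pos[of M] M by (intro mult_left_mono) auto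
  then show ?thesis using excess_loss_abs_le_dist[OF assms True] by linarith
next
  case False
  then show ?thesis using lip_const_pos[of M] M by (simp add: excess_loss_def)
qed

lemma dist2_integrable: "integrable \<rho>X (\<lambda>x. if x \<in> unit_cube then (G x - f x)\<^sup>2 else 0)"
proof (rule X.integrable_const_bound[of _ "(2 * M)\<^sup>2"])
  show "AE x in \<rho>X. norm (if x \<in> unit_cube then (G x - f x)\<^sup>2 else 0) \<le> (2 * M)\<^sup>2"
  proof (rule AE_cubeI)
    fix x :: "real^'d" assume x: "x \<in> unit_cube"
    have "\<bar>G x - f x\<bar> \<le> \<bar>2 * M\<bar>" using GM[OF x] f_abs_le[OF x] M by linarith
    then show "norm (if x \<in> unit_cube then (G x - f x)\<^sup>2 else 0) \<le> (2 * M)\<^sup>2"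
      using x by (simp only: abs_le_square_iff) simp
  qed
qed measurable

lemma excess_expectation:
  "(\<integral>z. excess_loss G z \<partial>\<rho>) = (\<integral>x. (if x \<in> unit_cube then crisk (\<eta> x) (G x) - crisk (\<eta> x) (f x) else 0) \<partial>\<rho>X)"
proof -
  have "(\<integral>z. excess_loss G z \<partial>\<rho>) = (\<integral>x. \<eta> x * excess_loss G (x, 1) + (1 - \<eta> x) * excess_loss G (x, -1) \<partial>\<rho>X)"
    by (rule integral_\<rho>[where M = "lip_const M * (2 * M)"]) (measurable, rule excess_loss_abs_le)
  also have "\<dots> = (\<integral>x. (if x \<in> unit_cube then crisk (\<eta> x) (G x) - crisk (\<eta> x) (f x) else 0) \<partial>\<rho>X)"
    by (intro Bochner_Integration.integral_cong) (auto simp: excess_loss_def crisk_def algebra_simps)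
  finally show ?thesis .
qed

text \<open>The pointwise bounds \<open>excess_lower\<close> and \<open>excess_upper\<close>,
  integrated. The lower one converts risk into distance, and the upper one prices the approximation
  error.\<close>

lemma excess_expectation_bounds:
  "2 * \<mu> * dist2 G \<le> (\<integral>z. excess_loss G z \<partial>\<rho>)" "(\<integral>z. excess_loss G z \<partial>\<rho>) \<le> L * dist2 G"
proof -
  let ?e = "\<lambda>x. if x \<in> unit_cube then crisk (\<eta> x) (G x) - crisk (\<eta> x) (f x) else 0"
  let ?d = "\<lambda>x. if x \<in> unit_cube then (G x - f x)\<^sup>2 else 0"
  have [measurable]: "(\<lambda>x. crisk (\<eta> x) (G x)) \<in> borel_measurable borel" "(\<lambda>x. crisk (\<eta> x) (f x)) \<in> borel_measurable borel"
    unfolding crisk_def by measurable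
  have lo: "2 * \<mu> * ?d x \<le> ?e x" and up: "?e x \<le> L * ?d x" for x
    using excess_lower[OF eta_range f_min, of x "G x"] excess_upper[OF eta_range f_min, of x "G x"] by auto
  have id: "integrable \<rho>X (\<lambda>x. c * ?d x)" for c using dist2_integrable by (rule integrable_mult_right)
  have ie: "integrable \<rho>X ?e"
  proof (rule Bochner_Integration.integrable_bound[OF id[of L]])
    show "AE x in \<rho>X. norm (?e x) \<le> norm (L * ?d x)"
    proof (rule AE_I2)
      fix x
      have "0 \<le> 2 * \<mu> * ?d x" using mupos by simp
      then show "norm (?e x) \<le> norm (L * ?d x)" using lo[of x] up[of x] unfolding real_norm_def by linarith
    qed
  qed measurable
  have "(\<integral>x. 2 * \<mu> * ?d x \<partial>\<rho>X) \<le> (\<integral>x. ?e x \<partial>\<rho>X)" by (rule integral_mono[OF id ie lo])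
  then show "2 * \<mu> * dist2 G \<le> (\<integral>z. excess_loss G z \<partial>\<rho>)" unfolding excess_expectation dist2_def by simp
  have "(\<integral>x. ?e x \<partial>\<rho>X) \<le> (\<integral>x. L * ?d x \<partial>\<rho>X)" by (rule integral_mono[OF ie id up])
  then show "(\<integral>z. excess_loss G z \<partial>\<rho>) \<le> L * dist2 G" unfolding excess_expectation dist2_def by simp
qed

lemma dist2_nonneg: "0 \<le> dist2 G"
  unfolding dist2_def by (rule integral_nonneg_AE) auto

lemma excess_expectation_nonneg: "0 \<le> (\<integral>z. excess_loss G z \<partial>\<rho>)"
proof -
  have "0 \<le> 2 * \<mu> * dist2 G" using dist2_nonneg mupos by simp
  then show ?thesis using excess_expectation_bounds(1) by linarith
qed

text \<open>The Bernstein condition: the Lipschitz bound makes the second moment at most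
  \<open>(lip_const M)^2\<close> times \<open>dist2 G\<close>, and strong convexity bounds
  \<open>dist2 G\<close> by the mean over \<open>2 \<mu>\<close>.\<close>

lemma excess_variance:
  "(\<integral>z. (excess_loss G z)\<^sup>2 \<partial>\<rho>) \<le> (lip_const M)\<^sup>2 / (2 * \<mu>) * (\<integral>z. excess_loss G z \<partial>\<rho>)"
proof -
  let ?d = "\<lambda>x. if x \<in> unit_cube then (G x - f x)\<^sup>2 else 0" and ?C = "lip_const M"
  have C: "0 \<le> ?C" using lip_const_pos[of M] M by simp
  have sq: "(excess_loss G (x, y))\<^sup>2 \<le> ?C\<^sup>2 * ?d x" if y: "y \<in> {-1, 1}" for x y
  proof (cases "x \<in> unit_cube")
    case True
    have "\<bar>excess_loss G (x, y)\<bar> \<le> \<bar>?C * (G x - f x)\<bar>" using excess_loss_abs_le_dist[OF y True] C by (simp add: abs_mult)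
    then have "(excess_loss G (x, y))\<^sup>2 \<le> (?C * (G x - f x))\<^sup>2" by (simp only: abs_le_square_iff)
    then show ?thesis using True by (simp add: power_mult_distrib)
  qed (simp add: excess_loss_def)
  have [measurable]: "(\<lambda>x. excess_loss G (x, 1)) \<in> borel_measurable borel" "(\<lambda>x. excess_loss G (x, -1)) \<in> borel_measurable borel"
    by (rule measurable_compose[OF pair_const_measurable excess_loss_measurable'[OF G_meas]]; simp)+
  have id: "integrable \<rho>X (\<lambda>x. ?C\<^sup>2 * ?d x)" using dist2_integrable by (rule integrable_mult_right)
  let ?v = "\<lambda>x. \<eta> x * (excess_loss G (x, 1))\<^sup>2 + (1 - \<eta> x) * (excess_loss G (x, -1))\<^sup>2"
  have v: "0 \<le> ?v x \<and> ?v x \<le> ?C\<^sup>2 * ?d x" if x: "x \<in> unit_cube" for x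
  proof -
    have "?v x \<le> \<eta> x * (?C\<^sup>2 * ?d x) + (1 - \<eta> x) * (?C\<^sup>2 * ?d x)"
      using eta_range[OF x] by (intro add_mono mult_left_mono sq) auto
    also have "\<dots> = ?C\<^sup>2 * ?d x" by (simp add: left_diff_distrib)
    finally show ?thesis using eta_range[OF x] by simp
  qed
  have iv: "integrable \<rho>X ?v"
    by (rule Bochner_Integration.integrable_bound[OF id]) (measurable, rule AE_cubeI, use v in fastforce)
  have "(\<integral>z. (excess_loss G z)\<^sup>2 \<partial>\<rho>) = (\<integral>x. ?v x \<partial>\<rho>X)"
    by (rule integral_\<rho>_nonneg) auto
  also have "\<dots> \<le> (\<integral>x. ?C\<^sup>2 * ?d x \<partial>\<rho>X)"
    by (rule integral_mono_AE[OF iv id]) (rule AE_cubeI, use v in blast)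
  also have "\<dots> = ?C\<^sup>2 * dist2 G" by (simp add: dist2_def)
  also have "\<dots> \<le> ?C\<^sup>2 * ((\<integral>z. excess_loss G z \<partial>\<rho>) / (2 * \<mu>))"
    using excess_expectation_bounds(1) mupos by (intro mult_left_mono) (auto simp: field_simps)
  finally show ?thesis by simp
qed

end

text \<open>The largest \<open>s\<close> allowed by the two conditions of
  \<open>mgf_bernstein\<close> with \<open>H = lip_const M * (2 * M)\<close> and
  \<open>V = (lip_const M)^2 / (2 * \<mu>)\<close>.\<close>

definition conc_rate :: "real \<Rightarrow> real" where
  "conc_rate M = min (1 / (lip_const M * (2 * M))) (\<mu> / (3 * (lip_const M)\<^sup>2))"

lemma conc_rate_pos: "1 \<le> M \<Longrightarrow> 0 < conc_rate M"
  using lip_const_pos[of M] mupos by (simp add: conc_rate_def)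

lemma excess_tail:
  fixes G :: "real^'d \<Rightarrow> real"
  assumes G [measurable]: "G \<in> borel_measurable borel" and M: "1 \<le> M" and GM: "\<And>x. x \<in> unit_cube \<Longrightarrow> \<bar>G x\<bar> \<le> M"
    and s: "\<bar>s\<bar> \<le> conc_rate M"
  shows "measure (PiM {..<m} (\<lambda>_. \<rho>)) {D \<in> space (PiM {..<m} (\<lambda>_. \<rho>)).
     real m * (s * (\<integral>z. excess_loss G z \<partial>\<rho>) + \<bar>s\<bar> * (\<integral>z. excess_loss G z \<partial>\<rho>) / 2) + t \<le> (\<Sum>i<m. s * excess_loss G (D i))} \<le> exp (- t)"
proof (rule exp_product_tail_bound[OF prob_\<rho>])
  let ?C = "lip_const M"
  have C: "0 < ?C" using lip_const_pos[of M] M by simp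
  show "(\<integral>\<^sup>+z. ennreal (exp (s * excess_loss G z)) \<partial>\<rho>) \<le> ennreal (exp (s * (\<integral>z. excess_loss G z \<partial>\<rho>) + \<bar>s\<bar> * (\<integral>z. excess_loss G z \<partial>\<rho>) / 2))"
  proof (rule Z.mgf_bernstein[OF _ _ excess_variance[OF G M GM] excess_expectation_nonneg[OF G M GM]])
    show "\<bar>excess_loss G z\<bar> \<le> ?C * (2 * M)" if "z \<in> space \<rho>" for z
      using excess_loss_abs_le[OF G M GM, of "snd z" "fst z"] that by (auto simp: space_\<rho>)
    have "\<bar>s\<bar> \<le> 1 / (?C * (2 * M))" using s by (simp add: conc_rate_def)
    then show "\<bar>s\<bar> * (?C * (2 * M)) \<le> 1" using C M by (simp add: field_simps)
    have "\<bar>s\<bar> \<le> \<mu> / (3 * ?C\<^sup>2)" using s by (simp add: conc_rate_def)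
    then show "6 * \<bar>s\<bar> * (?C\<^sup>2 / (2 * \<mu>)) \<le> 1" using C mupos by (simp add: field_simps)
  qed measurable
qed measurable

text \<open>Negative \<open>s\<close> bounds the mean by the empirical mean on the net, positive
  \<open>s\<close> does the reverse for \<open>f0\<close>. The failure probability is
  \<open>\<delta> / 2\<close> for the net, shared by its members, \<open>\<delta> / 2\<close> for
  \<open>f0\<close>, and 0 for sample points off the cube.\<close>

lemma oracle_event:
  assumes T: "finite T" "\<forall>g\<in>T. g \<in> borel_measurable borel" "\<forall>g\<in>T. \<forall>x\<in>unit_cube. \<bar>g x\<bar> \<le> 1"
    and f0 [measurable]: "f0 \<in> borel_measurable borel" and M: "1 \<le> M" and f0M: "\<forall>x\<in>unit_cube. \<bar>f0 x\<bar> \<le> M"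
    and N: "real (card T) \<le> N" "1 \<le> N" and \<delta>: "0 < \<delta>" and m: "1 \<le> m"
  defines "s \<equiv> min (conc_rate 1) (conc_rate M)"
  shows "\<exists>E \<in> sets (sample_space \<rho>X \<eta> m). 1 - \<delta> \<le> measure (sample_space \<rho>X \<eta> m) E \<and>
    (\<forall>D\<in>E. (\<forall>i<m. fst (D i) \<in> unit_cube \<and> snd (D i) \<in> {-1, 1}) \<and>
      (\<forall>g\<in>T. (\<integral>z. excess_loss g z \<partial>\<rho>) \<le> 2 / real m * (\<Sum>i<m. excess_loss g (D i)) + 2 * ln (2 * N / \<delta>) / (s * real m)) \<and>
      1 / real m * (\<Sum>i<m. excess_loss f0 (D i)) \<le> 3 / 2 * (\<integral>z. excess_loss f0 z \<partial>\<rho>) + ln (2 / \<delta>) / (s * real m))"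
proof -
  let ?P = "PiM {..<m} (\<lambda>_::nat. \<rho>)"
  interpret P: prob_space ?P by (rule prob_space_PiM) (rule prob_\<rho>)
  have s: "0 < s" "s \<le> conc_rate 1" "s \<le> conc_rate M" using conc_rate_pos M by (auto simp: s_def)
  let ?E = "\<lambda>g. \<integral>z. excess_loss g z \<partial>\<rho>"
  define t where "t = ln (2 * N / \<delta>)"
  define t0 where "t0 = ln (2 / \<delta>)"
  define Bg where "Bg g = {D \<in> space ?P. real m * ((- s) * ?E g + \<bar>- s\<bar> * ?E g / 2) + t \<le> (\<Sum>i<m. (- s) * excess_loss g (D i))}" for g
  define B0 where "B0 = {D \<in> space ?P. real m * (s * ?E f0 + \<bar>s\<bar> * ?E f0 / 2) + t0 \<le> (\<Sum>i<m. s * excess_loss f0 (D i))}"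
  define Bc where "Bc = {D \<in> space ?P. \<exists>i<m. fst (D i) \<notin> unit_cube}"
  have Bg: "Bg g \<in> sets ?P" if "g \<in> T" for g
  proof -
    have [measurable]: "g \<in> borel_measurable borel" using T(2) that by blast
    show ?thesis unfolding Bg_def by measurable
  qed
  have B0: "B0 \<in> sets ?P" unfolding B0_def by measurable
  have Bc: "Bc \<in> sets ?P" unfolding Bc_def by measurable
  have mBg: "measure ?P (Bg g) \<le> \<delta> / (2 * N)" if g: "g \<in> T" for g
  proof -
    have "measure ?P (Bg g) \<le> exp (- t)" unfolding Bg_def
      by (rule excess_tail[OF bspec[OF T(2) g], of 1]) (use T(3) g s in auto)
    also have "\<dots> = \<delta> / (2 * N)" using N \<delta> by (simp add: t_def exp_minus)
    finally show ?thesis .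
  qed
  have mB0: "measure ?P B0 \<le> \<delta> / 2"
  proof -
    have "measure ?P B0 \<le> exp (- t0)" unfolding B0_def
      by (rule excess_tail[OF f0 M]) (use f0M s in auto)
    also have "\<dots> = \<delta> / 2" using \<delta> by (simp add: t0_def exp_minus)
    finally show ?thesis .
  qed
  have mBc: "measure ?P Bc = 0"
  proof -
    have "AE D in ?P. \<forall>i\<in>{..<m}. fst (D i) \<in> unit_cube"
      by (rule AE_finite_allI) (auto intro!: AE_PiM_component prob_\<rho> AE_\<rho>_cube)
    then have "AE D in ?P. \<not> (\<exists>i<m. fst (D i) \<notin> unit_cube)" by (rule eventually_mono) auto
    then have "emeasure ?P Bc = 0" unfolding Bc_def using Bc by (subst (asm) AE_iff_measurable[OF _ refl]) (auto simp: Bc_def)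
    then show ?thesis by (simp add: measure_def)
  qed
  let ?U = "((\<Union>g\<in>T. Bg g) \<union> B0) \<union> Bc"
  have U1: "(\<Union>g\<in>T. Bg g) \<in> sets ?P" by (rule sets.finite_UN[OF T(1) Bg])
  then have U: "?U \<in> sets ?P" by (intro sets.Un B0 Bc)
  have "measure ?P (\<Union>g\<in>T. Bg g) \<le> (\<Sum>g\<in>T. measure ?P (Bg g))"
    by (rule P.finite_measure_subadditive_finite) (use T Bg in auto)
  also have "\<dots> \<le> (\<Sum>g\<in>T. \<delta> / (2 * N))" by (intro sum_mono mBg)
  also have "\<dots> = real (card T) * (\<delta> / (2 * N))" by simp
  also have "\<dots> \<le> N * (\<delta> / (2 * N))" using N \<delta> by (intro mult_right_mono) auto
  also have "\<dots> = \<delta> / 2" using N by simp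
  finally have m1: "measure ?P (\<Union>g\<in>T. Bg g) \<le> \<delta> / 2" .
  have "measure ?P ?U \<le> measure ?P ((\<Union>g\<in>T. Bg g) \<union> B0) + measure ?P Bc"
    by (rule measure_Un_le) (use U1 B0 Bc in auto)
  also have "measure ?P ((\<Union>g\<in>T. Bg g) \<union> B0) \<le> measure ?P (\<Union>g\<in>T. Bg g) + measure ?P B0"
    by (rule measure_Un_le) (use U1 B0 in auto)
  finally have mU: "measure ?P ?U \<le> \<delta>" using m1 mB0 mBc by linarith
  let ?G = "space ?P - ?U"
  have sp: "sample_space \<rho>X \<eta> m = ?P" by (simp add: sample_space_def)
  have "measure ?P ?G = 1 - measure ?P ?U" using U by (rule P.prob_compl)
  then have mG: "1 - \<delta> \<le> measure ?P ?G" using mU by simp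
  have m0: "0 < real m" using m by simp
  have good: "(\<forall>i<m. fst (D i) \<in> unit_cube \<and> snd (D i) \<in> {-1, 1}) \<and>
      (\<forall>g\<in>T. ?E g \<le> 2 / real m * (\<Sum>i<m. excess_loss g (D i)) + 2 * t / (s * real m)) \<and>
      1 / real m * (\<Sum>i<m. excess_loss f0 (D i)) \<le> 3 / 2 * ?E f0 + t0 / (s * real m)" if D: "D \<in> ?G" for D
  proof (intro conjI allI impI ballI)
    have Dsp: "D \<in> space ?P" using D by blast
    fix i assume i: "i < m"
    show "fst (D i) \<in> unit_cube" using D i Dsp by (auto simp: Bc_def)
    have "D i \<in> space \<rho>" using Dsp i by (auto simp: space_PiM)
    then show "snd (D i) \<in> {-1, 1}" by (auto simp: space_\<rho>)
  next
    fix g assume g: "g \<in> T"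
    let ?S = "\<Sum>i<m. excess_loss g (D i)"
    have "\<not> (real m * ((- s) * ?E g + \<bar>- s\<bar> * ?E g / 2) + t \<le> (\<Sum>i<m. (- s) * excess_loss g (D i)))"
      using D g by (auto simp: Bg_def)
    moreover have "(\<Sum>i<m. (- s) * excess_loss g (D i)) = - s * ?S" by (simp only: sum_distrib_left)
    moreover have "real m * ((- s) * ?E g + \<bar>- s\<bar> * ?E g / 2) = - (s * real m * ?E g) / 2" using s(1) by (simp add: field_simps)
    ultimately have "- (s * ?S) < - (s * real m * ?E g) / 2 + t" by (simp only: not_le mult_minus_left)
    \<comment> \<open>Half of the mean is lost to the variance term, so the empirical mean and the
      deviation enter with a factor 2.\<close>
    then have "s * real m * ?E g \<le> 2 * s * ?S + 2 * t" by (simp add: field_simps)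
    then have "(s * real m * ?E g) / (s * real m) \<le> (2 * s * ?S + 2 * t) / (s * real m)"
      using s m0 by (intro divide_right_mono) auto
    then show "?E g \<le> 2 / real m * ?S + 2 * t / (s * real m)"
      using s m0 by (simp add: add_divide_distrib)
  next
    let ?S = "\<Sum>i<m. excess_loss f0 (D i)"
    have "\<not> (real m * (s * ?E f0 + \<bar>s\<bar> * ?E f0 / 2) + t0 \<le> (\<Sum>i<m. s * excess_loss f0 (D i)))"
      using D by (auto simp: B0_def)
    moreover have "(\<Sum>i<m. s * excess_loss f0 (D i)) = s * ?S" by (simp only: sum_distrib_left)
    moreover have "s * ?E f0 + \<bar>s\<bar> * ?E f0 / 2 = s * (3 / 2 * ?E f0)" using s(1) by simp
    ultimately have "s * ?S \<le> s * real m * (3 / 2 * ?E f0) + t0" by (simp add: not_le mult_ac)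
    then have "(s * ?S) / (s * real m) \<le> (s * real m * (3 / 2 * ?E f0) + t0) / (s * real m)"
      using s m0 by (intro divide_right_mono) auto
    then show "1 / real m * ?S \<le> 3 / 2 * ?E f0 + t0 / (s * real m)"
      using s m0 by (simp add: add_divide_distrib)
  qed
  have Gs: "?G \<in> sets ?P" using U by auto
  show ?thesis unfolding sp
    by (rule bexI[OF _ Gs], rule conjI[OF mG], rule ballI) (rule good[unfolded t_def t0_def])
qed

end

section \<open>Excess risk and the oracle inequality\<close>

lemma rkhs_norm_sq_nonneg: "0 \<le> rkhs_norm_sq K X f"
  unfolding rkhs_norm_sq_def by (rule Sup_upper) simp

lemma rkhs_norm_sq_zero: "rkhs_norm_sq K X (\<lambda>_. 0) = 0"
  using rkhs_norm_sq_le[of 0 X "\<lambda>_. 0" K] rkhs_norm_sq_nonneg[of K X "\<lambda>_. 0"]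
  by (simp add: zero_ereal_def)

lemma sign_fun_measurable [measurable]:
  "G \<in> borel_measurable borel \<Longrightarrow> sign_fun G \<in> borel_measurable borel"
  unfolding sign_fun_def[abs_def] by measurable

lemma bayes_rule_measurable [measurable]:
  "e \<in> borel_measurable borel \<Longrightarrow> bayes_rule e \<in> borel_measurable borel"
  unfolding bayes_rule_def[abs_def] by measurable

context classification
begin

lemma misclassified_sets:
  assumes [measurable]: "C \<in> borel_measurable borel"
  shows "{z \<in> space (borel \<Otimes>\<^sub>M Y). C (fst z) \<noteq> snd z} \<in> sets (borel \<Otimes>\<^sub>M Y)"
proof -
  have "(\<lambda>z. C (fst z)) \<in> borel_measurable (borel \<Otimes>\<^sub>M Y)" by measurable
  from borel_measurable_neq[OF this label_measurable] show ?thesis .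
qed

lemma risk_eq_integral:
  assumes C [measurable]: "C \<in> borel_measurable borel"
  shows "risk \<rho> C = (\<integral>x. \<eta> x * (if C x \<noteq> 1 then 1 else 0) + (1 - \<eta> x) * (if C x \<noteq> -1 then 1 else 0) \<partial>\<rho>X)"
proof -
  let ?g = "\<lambda>z. if C (fst z) \<noteq> snd z then 1 else 0 :: real"
  have "risk \<rho> C = (\<integral>z. ?g z \<partial>\<rho>)"
  proof -
    have "(\<integral>z. ?g z \<partial>\<rho>) = (\<integral>z. indicator {z \<in> space \<rho>. C (fst z) \<noteq> snd z} z \<partial>\<rho>)"
      by (rule Bochner_Integration.integral_cong) (auto simp: indicator_def)
    also have "\<dots> = measure \<rho> ({z \<in> space \<rho>. C (fst z) \<noteq> snd z} \<inter> space \<rho>)" by simp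
    also have "{z \<in> space \<rho>. C (fst z) \<noteq> snd z} \<inter> space \<rho> = {z \<in> space \<rho>. C (fst z) \<noteq> snd z}" by auto
    finally show ?thesis by (simp add: risk_def)
  qed
  also have "\<dots> = (\<integral>x. \<eta> x * ?g (x, 1) + (1 - \<eta> x) * ?g (x, -1) \<partial>\<rho>X)"
    by (rule integral_\<rho>_nonneg[where g = ?g]) (rule measurable_If[OF _ _ misclassified_sets[OF C]], auto)
  finally show ?thesis by simp
qed

lemma risk_nonneg: "0 \<le> risk \<rho> C" and risk_le_1: "risk \<rho> C \<le> 1"
  by (simp_all add: risk_def)

text \<open>If g is not measurable, its error set may have the junk measure 0.\<close>
lemma risk_sign_fun_le:
  assumes G [measurable]: "G \<in> borel_measurable borel" and eq: "\<And>x. x \<in> unit_cube \<Longrightarrow> 0 \<le> G x \<longleftrightarrow> 0 \<le> g x"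
  shows "risk \<rho> (sign_fun g) \<le> risk \<rho> (sign_fun G)"
proof (cases "{z \<in> space \<rho>. sign_fun g (fst z) \<noteq> snd z} \<in> sets \<rho>")
  case True
  have GS: "{z \<in> space \<rho>. sign_fun G (fst z) \<noteq> snd z} \<in> sets \<rho>"
  proof -
    have "{z \<in> space (borel \<Otimes>\<^sub>M Y). sign_fun G (fst z) \<noteq> snd z} \<in> sets (borel \<Otimes>\<^sub>M Y)"
      by (rule misclassified_sets) measurable
    then show ?thesis unfolding sets_\<rho> sets_eq_imp_space_eq[OF sets_\<rho>] .
  qed
  show ?thesis unfolding risk_def
  proof (rule Z.finite_measure_mono_AE[OF _ GS])
    show "AE z in \<rho>. z \<in> {z \<in> space \<rho>. sign_fun g (fst z) \<noteq> snd z} \<longrightarrow> z \<in> {z \<in> space \<rho>. sign_fun G (fst z) \<noteq> snd z}"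
      using AE_\<rho>_cube by (rule eventually_mono) (use eq in \<open>auto simp: sign_fun_def split: if_splits\<close>)
  qed
next
  case False
  then show ?thesis by (simp add: risk_def measure_notin_sets)
qed

end

context learning_problem
begin

text \<open>The pointwise excess is \<open>\<bar>2 \<eta> x - 1\<bar>\<close> where the signs
  disagree. If it is at most \<open>c t\<close>, the noise condition bounds the measure of such
  points; otherwise it is at most its square over \<open>c t\<close>, and the square is controlled
  by \<open>(G x - f x)^2\<close>.\<close>

lemma excess_risk_split:
  assumes G [measurable]: "G \<in> borel_measurable borel" and G1: "\<And>x. x \<in> unit_cube \<Longrightarrow> \<bar>G x\<bar> \<le> 1"
    and ct: "0 < c" "0 < t" and tsy: "measure \<rho>X {x \<in> space \<rho>X. \<bar>2 * \<eta> x - 1\<bar> \<le> c * t} \<le> t powr q"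
  shows "risk \<rho> (sign_fun G) - risk \<rho> (bayes_rule \<eta>) \<le> c * t * t powr q + margin_const\<^sup>2 / (c * t) * dist2 G"
proof -
  let ?a = "\<lambda>C x. \<eta> x * (if C x \<noteq> (1::real) then 1 else 0) + (1 - \<eta> x) * (if C x \<noteq> -1 then 1 else 0)"
  let ?d = "\<lambda>x. if x \<in> unit_cube then (G x - f x)\<^sup>2 else 0"
  let ?S = "{x \<in> space \<rho>X. \<bar>2 * \<eta> x - 1\<bar> \<le> c * t}"
  let ?u = "\<lambda>x. c * t * indicator ?S x + margin_const\<^sup>2 / (c * t) * ?d x"
  have ia: "integrable \<rho>X (?a C)" if [measurable]: "C \<in> borel_measurable borel" for C
  proof (rule X.integrable_const_bound[of _ 1])
    show "AE x in \<rho>X. norm (?a C x) \<le> 1"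
      by (rule AE_cubeI) (use eta_range in auto)
  qed measurable
  have S [measurable]: "?S \<in> sets \<rho>X" by measurable
  have iu: "integrable \<rho>X ?u"
    using dist2_integrable[OF G order_refl G1] S
    by (intro Bochner_Integration.integrable_add integrable_mult_right) (auto simp: X.emeasure_finite less_top[symmetric])
  have "risk \<rho> (sign_fun G) - risk \<rho> (bayes_rule \<eta>) = (\<integral>x. ?a (sign_fun G) x \<partial>\<rho>X) - (\<integral>x. ?a (bayes_rule \<eta>) x \<partial>\<rho>X)"
    by (simp only: risk_eq_integral[OF sign_fun_measurable[OF G]] risk_eq_integral[OF bayes_rule_measurable[OF eta_meas]])
  also have "\<dots> = (\<integral>x. ?a (sign_fun G) x - ?a (bayes_rule \<eta>) x \<partial>\<rho>X)"
    by (rule Bochner_Integration.integral_diff[symmetric]; rule ia; measurable)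
  also have "\<dots> \<le> (\<integral>x. ?u x \<partial>\<rho>X)"
  proof (rule integral_mono_AE[OF _ iu])
    show "integrable \<rho>X (\<lambda>x. ?a (sign_fun G) x - ?a (bayes_rule \<eta>) x)"
      by (rule Bochner_Integration.integrable_diff; rule ia; measurable)
    show "AE x in \<rho>X. ?a (sign_fun G) x - ?a (bayes_rule \<eta>) x \<le> ?u x"
    proof (rule AE_cubeI)
      fix x :: "real^'d" assume x: "x \<in> unit_cube"
      have d0: "0 \<le> margin_const\<^sup>2 / (c * t) * ?d x" using ct by simp
      show "?a (sign_fun G) x - ?a (bayes_rule \<eta>) x \<le> ?u x"
      proof (cases "(0 \<le> G x) = (1/2 \<le> \<eta> x)")
        case True
        then have "?a (sign_fun G) x - ?a (bayes_rule \<eta>) x = 0" by (auto simp: sign_fun_def bayes_rule_def)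
        also have "0 \<le> ?u x" using d0 ct by (auto intro!: add_nonneg_nonneg)
        finally show ?thesis .
      next
        case False
        then have e: "?a (sign_fun G) x - ?a (bayes_rule \<eta>) x = \<bar>2 * \<eta> x - 1\<bar>"
          by (auto simp: sign_fun_def bayes_rule_def)
        have le: "\<bar>2 * \<eta> x - 1\<bar> \<le> margin_const * \<bar>G x - f x\<bar>"
          by (rule noise_le_distance[OF eta_range[OF x] f_min[OF x] False])
        show ?thesis
        proof (cases "\<bar>2 * \<eta> x - 1\<bar> \<le> c * t")
          case True
          then show ?thesis unfolding e using d0 x by (simp add: indicator_def add_increasing2)
        next
          case big: False
          have "\<bar>2 * \<eta> x - 1\<bar> * (c * t) \<le> \<bar>2 * \<eta> x - 1\<bar> * \<bar>2 * \<eta> x - 1\<bar>" using big by (intro mult_left_mono) auto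
          also have "\<dots> \<le> (margin_const * \<bar>G x - f x\<bar>) * (margin_const * \<bar>G x - f x\<bar>)" using le by (intro mult_mono) auto
          also have "\<dots> = margin_const\<^sup>2 * (G x - f x)\<^sup>2" by (simp add: power2_eq_square)
          finally have "\<bar>2 * \<eta> x - 1\<bar> \<le> margin_const\<^sup>2 / (c * t) * (G x - f x)\<^sup>2" using ct by (simp add: field_simps)
          then show ?thesis unfolding e using x big by (simp add: indicator_def)
        qed
      qed
    qed
  qed
  also have "\<dots> = c * t * measure \<rho>X ?S + margin_const\<^sup>2 / (c * t) * dist2 G"
    using dist2_integrable[OF G order_refl G1] S unfolding dist2_def
    by (subst Bochner_Integration.integral_add) (auto simp: X.emeasure_finite less_top[symmetric])
  also have "\<dots> \<le> c * t * t powr q + margin_const\<^sup>2 / (c * t) * dist2 G"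
    using ct tsy by (intro add_right_mono mult_left_mono) auto
  finally show ?thesis .
qed

text \<open>An upper bound \<open>A > 0\<close> replaces the distance itself, which may be 0 and
  would leave no admissible threshold \<open>t\<close>.\<close>

lemma excess_risk_comparison:
  assumes q: "0 \<le> q" and tsy: "tsybakov \<rho>X \<eta> q"
  shows "\<exists>K>0. \<forall>G A. G \<in> borel_measurable borel \<longrightarrow> (\<forall>x\<in>unit_cube. \<bar>G x\<bar> \<le> 1) \<longrightarrow> 0 < A \<longrightarrow> dist2 G \<le> A \<longrightarrow>
    risk \<rho> (sign_fun G) - risk \<rho> (bayes_rule \<eta>) \<le> K * A powr ((q + 1) / (q + 2))"
proof -
  obtain c where c: "0 < c" "\<And>t. 0 < t \<Longrightarrow> measure \<rho>X {x \<in> space \<rho>X. \<bar>2 * \<eta> x - 1\<bar> \<le> c * t} \<le> t powr q"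
    using tsy unfolding tsybakov_def by blast
  define K where "K = c + margin_const\<^sup>2 / c"
  have K: "0 < K" using c by (simp add: K_def add_pos_nonneg)
  show ?thesis
  proof (intro exI[of _ K] conjI K allI impI)
    fix G :: "real^'d \<Rightarrow> real" and A :: real
    assume G: "G \<in> borel_measurable borel" and G1: "\<forall>x\<in>unit_cube. \<bar>G x\<bar> \<le> 1" and A: "0 < A" "dist2 G \<le> A"
    \<comment> \<open>Balances the two terms of \<open>excess_risk_split\<close>:
      \<open>t powr (q + 1) = A / t\<close>.\<close>
    define t where "t = A powr (1 / (q + 2))"
    let ?p = "A powr ((q + 1) / (q + 2))"
    have t: "0 < t" using A by (simp add: t_def)
    have t1: "t * t powr q = ?p"
    proof -
      have "t * t powr q = t powr (1 + q)" using t by (subst powr_mult_base) auto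
      also have "\<dots> = ?p" unfolding t_def powr_powr by (simp add: add.commute)
      finally show ?thesis .
    qed
    have t2: "A / t = ?p"
    proof -
      have "A / t = A powr 1 / A powr (1 / (q + 2))" using A by (simp add: t_def)
      also have "\<dots> = A powr (1 - 1 / (q + 2))" by (simp add: powr_diff)
      also have "1 - 1 / (q + 2) = (q + 1) / (q + 2)" using q by (simp add: field_simps)
      finally show ?thesis .
    qed
    have "risk \<rho> (sign_fun G) - risk \<rho> (bayes_rule \<eta>) \<le> c * t * t powr q + margin_const\<^sup>2 / (c * t) * dist2 G"
      by (rule excess_risk_split[OF G _ c(1) t c(2)[OF t]]) (use G1 in auto)
    also have "\<dots> \<le> c * t * t powr q + margin_const\<^sup>2 / (c * t) * A"
      using A c t by (intro add_left_mono mult_left_mono) auto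
    also have "\<dots> = c * (t * t powr q) + margin_const\<^sup>2 / c * (A / t)" by simp
    also have "\<dots> = K * ?p" unfolding t1 t2 K_def by (simp add: distrib_right)
    finally show "risk \<rho> (sign_fun G) - risk \<rho> (bayes_rule \<eta>) \<le> K * ?p" .
  qed
qed

text \<open>Minimality is tested against 0 for the norm bound and against \<open>f0\<close> for the
  empirical bound. Clipping can only lower the empirical loss, and the empirical loss of the target
  cancels.\<close>

lemma erm_empirical_bounds:
  assumes erm: "erm_solution \<phi> K unit_cube lam m D g" and lam: "0 < lam" and m: "1 \<le> m"
    and D: "\<forall>i<m. fst (D i) \<in> unit_cube \<and> snd (D i) \<in> {-1, 1}"
    and f0: "rkhs_norm_sq K unit_cube f0 \<le> ereal N0"
    and G: "\<And>x. x \<in> unit_cube \<Longrightarrow> G x = clip (g x)"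
  shows "rkhs_norm_sq K unit_cube g \<le> ereal (\<phi> 0 / lam)"
    and "1 / real m * (\<Sum>i<m. excess_loss G (D i)) \<le> 1 / real m * (\<Sum>i<m. excess_loss f0 (D i)) + lam * N0"
proof -
  let ?n = "\<lambda>g. real_of_ereal (rkhs_norm_sq K unit_cube g)"
  let ?S = "\<lambda>g. 1 / real m * (\<Sum>i<m. \<phi> (snd (D i) * g (fst (D i))))"
  have m0: "0 < real m" using m by simp
  have fin: "rkhs_norm_sq K unit_cube g < \<infinity>" using erm by (simp add: erm_solution_def in_rkhs_def)
  have opt: "?S g + lam * ?n g \<le> ?S g' + lam * ?n g'" if "in_rkhs K unit_cube g'" for g'
    using erm that unfolding erm_solution_def reg_objective_def by blast
  have n0: "0 \<le> ?n g" by (simp add: real_of_ereal_pos rkhs_norm_sq_nonneg)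
  have S0: "0 \<le> ?S g" by (simp add: sum_nonneg nonneg)
  have "?S g + lam * ?n g \<le> ?S (\<lambda>_. 0) + lam * ?n (\<lambda>_. 0)"
    by (rule opt) (simp add: in_rkhs_def rkhs_norm_sq_zero)
  then have "lam * ?n g \<le> \<phi> 0" using S0 m0 by (simp add: rkhs_norm_sq_zero)
  then have "?n g \<le> \<phi> 0 / lam" using lam by (simp add: field_simps)
  then show "rkhs_norm_sq K unit_cube g \<le> ereal (\<phi> 0 / lam)"
    using fin rkhs_norm_sq_nonneg[of K unit_cube g] by (cases "rkhs_norm_sq K unit_cube g") auto
  have in0: "in_rkhs K unit_cube f0" using f0 by (auto simp: in_rkhs_def less_le)
  have nf0: "?n f0 \<le> N0" using f0 rkhs_norm_sq_nonneg[of K unit_cube f0] by (cases "rkhs_norm_sq K unit_cube f0") auto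
  have "?S G \<le> ?S g"
  proof (intro mult_left_mono sum_mono)
    fix i assume "i \<in> {..<m}"
    then have "fst (D i) \<in> unit_cube" "snd (D i) = 1 \<or> snd (D i) = -1" using D by auto
    then show "\<phi> (snd (D i) * G (fst (D i))) \<le> \<phi> (snd (D i) * g (fst (D i)))" using G loss_clip_le by simp
  qed simp
  also have "\<dots> \<le> ?S g + lam * ?n g" using lam n0 by simp
  also have "\<dots> \<le> ?S f0 + lam * ?n f0" by (rule opt[OF in0])
  also have "\<dots> \<le> ?S f0 + lam * N0" using nf0 lam by simp
  finally have le: "?S G \<le> ?S f0 + lam * N0" .
  have ex: "1 / real m * (\<Sum>i<m. excess_loss h (D i)) = ?S h - ?S f" for h
  proof -
    have "(\<Sum>i<m. excess_loss h (D i)) = (\<Sum>i<m. \<phi> (snd (D i) * h (fst (D i))) - \<phi> (snd (D i) * f (fst (D i))))"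
      by (rule sum.cong) (use D in \<open>auto simp: excess_loss_def\<close>)
    then show ?thesis by (simp add: sum_subtractf right_diff_distrib diff_divide_distrib)
  qed
  show "1 / real m * (\<Sum>i<m. excess_loss G (D i)) \<le> 1 / real m * (\<Sum>i<m. excess_loss f0 (D i)) + lam * N0"
    unfolding ex using le by simp
qed

text \<open>For regularization \<open>1 / m\<close> the radius with
  \<open>B^2 = \<phi> 0 * m\<close> is the a priori norm bound of a minimizer. The estimate runs
  from the truncated minimizer to its net neighbour, to the sample, back to the minimizer, and by
  optimality to \<open>f0\<close>.\<close>

lemma oracle_inequality:
  fixes f0 :: "real^'d \<Rightarrow> real" and T0 :: "(real^'d \<Rightarrow> real) set"
  assumes f0: "f0 \<in> borel_measurable borel" and M: "1 \<le> M" and f0M: "\<And>x. x \<in> unit_cube \<Longrightarrow> \<bar>f0 x\<bar> \<le> M"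
    and f0f: "\<And>x. x \<in> unit_cube \<Longrightarrow> \<bar>f0 x - f x\<bar> \<le> e0" and N0: "rkhs_norm_sq (gauss_kernel \<sigma>) unit_cube f0 \<le> ereal N0"
    and \<sigma>: "0 < \<sigma>" and T0: "finite T0" "T0 \<subseteq> rkhs_ball (gauss_kernel \<sigma>) unit_cube B" and B: "B\<^sup>2 = \<phi> 0 * real m"
    and cover: "\<And>g. g \<in> rkhs_ball (gauss_kernel \<sigma>) unit_cube B \<Longrightarrow> \<exists>g'\<in>T0. \<forall>x\<in>unit_cube. \<bar>g x - g' x\<bar> \<le> e" and e: "0 \<le> e"
    and N: "real (card T0) \<le> N" "1 \<le> N" and \<delta>: "0 < \<delta>" and m: "1 \<le> m"
  defines "s \<equiv> min (conc_rate 1) (conc_rate M)"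
  shows "\<exists>E \<in> sets (sample_space \<rho>X \<eta> m). 1 - \<delta> \<le> measure (sample_space \<rho>X \<eta> m) E \<and>
    (\<forall>D\<in>E. \<forall>g. erm_solution \<phi> (gauss_kernel \<sigma>) unit_cube (1 / real m) m D g \<longrightarrow>
      (\<exists>G \<in> borel_measurable borel. (\<forall>x\<in>unit_cube. \<bar>G x\<bar> \<le> 1 \<and> (0 \<le> G x \<longleftrightarrow> 0 \<le> g x)) \<and>
        2 * \<mu> * dist2 G \<le> 3 * L * e0\<^sup>2 + 2 * N0 / real m + 3 * lip_const 1 * e
          + 2 * (ln (2 * N / \<delta>) + ln (2 / \<delta>)) / (s * real m)))"
proof -
  \<comment> \<open>Continuous on the cube and 0 elsewhere, hence Borel, whatever the minimizer does
    off the cube.\<close>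
  define tr where "tr g x = (if x \<in> unit_cube then clip (g x) else 0)" for g and x :: "real^'d"
  let ?H = "rkhs_ball (gauss_kernel \<sigma>) (unit_cube :: (real^'d) set) B"
  have tr_meas: "tr g \<in> borel_measurable borel" if "g \<in> ?H" for g
  proof -
    have "continuous_on unit_cube (\<lambda>x. clip (g x))" unfolding clip_def
      using gauss_rkhs_ball_continuous[OF that] by (intro continuous_intros)
    then have "(\<lambda>x. indicator unit_cube x *\<^sub>R clip (g x)) \<in> borel_measurable borel"
      by (rule borel_measurable_continuous_on_indicator[OF cube_sets])
    moreover have "(\<lambda>x. indicator unit_cube x *\<^sub>R clip (g x)) = tr g" by (auto simp: tr_def indicator_def)
    ultimately show ?thesis by simp
  qed
  have tr1: "\<bar>tr g x\<bar> \<le> 1" for g x by (simp add: tr_def abs_clip_le)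
  have "card (tr ` T0) \<le> card T0" by (rule card_image_le[OF T0(1)])
  then have cardN: "real (card (tr ` T0)) \<le> N" using N(1) by linarith
  have Tm: "\<forall>g\<in>tr ` T0. g \<in> borel_measurable borel" and T1: "\<forall>g\<in>tr ` T0. \<forall>x\<in>unit_cube. \<bar>g x\<bar> \<le> 1" and Tf: "finite (tr ` T0)"
    using T0 tr_meas tr1 by auto
  have f0M': "\<forall>x\<in>unit_cube. \<bar>f0 x\<bar> \<le> M" using f0M by blast
  obtain E where E: "E \<in> sets (sample_space \<rho>X \<eta> m)" "1 - \<delta> \<le> measure (sample_space \<rho>X \<eta> m) E"
    and EE: "\<forall>D\<in>E. (\<forall>i<m. fst (D i) \<in> unit_cube \<and> snd (D i) \<in> {-1, 1}) \<and>
      (\<forall>g\<in>tr ` T0. (\<integral>z. excess_loss g z \<partial>\<rho>) \<le> 2 / real m * (\<Sum>i<m. excess_loss g (D i)) + 2 * ln (2 * N / \<delta>) / (s * real m)) \<and>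
      1 / real m * (\<Sum>i<m. excess_loss f0 (D i)) \<le> 3 / 2 * (\<integral>z. excess_loss f0 z \<partial>\<rho>) + ln (2 / \<delta>) / (s * real m)"
    unfolding s_def
    using oracle_event[of "tr ` T0" f0 M N \<delta> m, OF Tf Tm T1 f0 M f0M' cardN N(2) \<delta> m] by (elim bexE conjE)
  have ED: "\<forall>i<m. fst (D i) \<in> unit_cube \<and> snd (D i) \<in> {-1, 1}" if "D \<in> E" for D
    using bspec[OF EE that] by (elim conjE)
  have ET: "(\<integral>z. excess_loss g z \<partial>\<rho>) \<le> 2 / real m * (\<Sum>i<m. excess_loss g (D i)) + 2 * ln (2 * N / \<delta>) / (s * real m)"
    if "D \<in> E" "g \<in> tr ` T0" for D g
    using bspec[OF conjunct1[OF conjunct2[OF bspec[OF EE that(1)]]] that(2)] .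
  have E0: "1 / real m * (\<Sum>i<m. excess_loss f0 (D i)) \<le> 3 / 2 * (\<integral>z. excess_loss f0 z \<partial>\<rho>) + ln (2 / \<delta>) / (s * real m)"
    if "D \<in> E" for D
    using bspec[OF EE that] by (elim conjE)
  have m0: "0 < real m" using m by simp
  have "\<exists>G \<in> borel_measurable borel. (\<forall>x\<in>unit_cube. \<bar>G x\<bar> \<le> 1 \<and> (0 \<le> G x \<longleftrightarrow> 0 \<le> g x)) \<and>
        2 * \<mu> * dist2 G \<le> 3 * L * e0\<^sup>2 + 2 * N0 / real m + 3 * lip_const 1 * e
          + 2 * (ln (2 * N / \<delta>) + ln (2 / \<delta>)) / (s * real m)"
    if D: "D \<in> E" and erm: "erm_solution \<phi> (gauss_kernel \<sigma>) unit_cube (1 / real m) m D g" for D g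
  proof -
    note bounds = erm_empirical_bounds[OF erm _ m ED[OF D] N0, of "tr g"]
    have "rkhs_norm_sq (gauss_kernel \<sigma>) unit_cube g \<le> ereal (B\<^sup>2)" using bounds(1) m0 by (simp add: tr_def B)
    then have gH: "g \<in> ?H" by (rule rkhs_norm_sq_imp_ball) (auto intro: gauss_kernel_psd[OF \<sigma>] gauss_kernel_sym)
    obtain g' where g': "g' \<in> T0" and gg': "\<forall>x\<in>unit_cube. \<bar>g x - g' x\<bar> \<le> e" using cover[OF gH] by blast
    have g'H: "g' \<in> ?H" using g' T0 by blast
    let ?G = "tr g" and ?G' = "tr g'" and ?C = "lip_const 1"
    have close: "\<bar>?G x - ?G' x\<bar> \<le> e" if "x \<in> unit_cube" for x
      using clip_diff_le[of "g x" "g' x"] gg' that by (force simp: tr_def)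
    have pt: "\<bar>excess_loss ?G (x, y) - excess_loss ?G' (x, y)\<bar> \<le> ?C * e" if "y \<in> {-1, 1}" for x y
      by (rule excess_loss_lipschitz[OF that order_refl tr1 tr1 close e])
    let ?E = "\<lambda>h. \<integral>z. excess_loss h z \<partial>\<rho>"
    have int: "integrable \<rho> (excess_loss (tr h))" if h: "h \<in> ?H" for h
    proof (rule Z.integrable_const_bound)
      show "AE z in \<rho>. norm (excess_loss (tr h) z) \<le> ?C * (2 * 1)"
        by (rule AE_I2) (use excess_loss_abs_le[OF tr_meas[OF h] order_refl tr1] in \<open>auto simp: space_\<rho>\<close>)
    qed (rule excess_loss_measurable[OF tr_meas[OF h]])
    have 1: "?E ?G \<le> ?E ?G' + ?C * e"
    proof -
      have "?E ?G \<le> (\<integral>z. excess_loss ?G' z + ?C * e \<partial>\<rho>)"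
      proof (rule integral_mono)
        fix z assume "z \<in> space \<rho>"
        then have "snd z \<in> {-1, 1}" by (auto simp: space_\<rho>)
        from pt[OF this, of "fst z"] show "excess_loss ?G z \<le> excess_loss ?G' z + ?C * e" by simp
      qed (use int[OF gH] int[OF g'H] in auto)
      also have "\<dots> = ?E ?G' + ?C * e"
        using Z.prob_space by (subst Bochner_Integration.integral_add[OF int[OF g'H]]) auto
      finally show ?thesis .
    qed
    have 2: "1 / real m * (\<Sum>i<m. excess_loss ?G' (D i)) \<le> 1 / real m * (\<Sum>i<m. excess_loss ?G (D i)) + ?C * e"
    proof -
      have "(\<Sum>i<m. excess_loss ?G' (D i)) \<le> (\<Sum>i<m. excess_loss ?G (D i) + ?C * e)"
      proof (rule sum_mono)
        fix i assume "i \<in> {..<m}"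
        then have "snd (D i) \<in> {-1, 1}" using ED[OF D] by auto
        from pt[OF this, of "fst (D i)"] show "excess_loss ?G' (D i) \<le> excess_loss ?G (D i) + ?C * e" by simp
      qed
      then have "1 / real m * (\<Sum>i<m. excess_loss ?G' (D i)) \<le> 1 / real m * ((\<Sum>i<m. excess_loss ?G (D i)) + real m * (?C * e))"
        using m0 by (intro mult_left_mono) (auto simp: sum.distrib)
      also have "\<dots> = 1 / real m * (\<Sum>i<m. excess_loss ?G (D i)) + ?C * e" using m0 by (simp add: field_simps)
      finally show ?thesis .
    qed
    have 3: "1 / real m * (\<Sum>i<m. excess_loss ?G (D i)) \<le> 1 / real m * (\<Sum>i<m. excess_loss f0 (D i)) + 1 / real m * N0"
      using bounds(2) m0 by (simp add: tr_def)
    have 4: "?E f0 \<le> L * e0\<^sup>2"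
    proof -
      have "dist2 f0 \<le> e0\<^sup>2" unfolding dist2_def
      proof (rule X.integral_le_const[OF dist2_integrable[OF f0 M f0M]])
        show "AE x in \<rho>X. (if x \<in> unit_cube then (f0 x - f x)\<^sup>2 else 0) \<le> e0\<^sup>2"
        proof (rule AE_cubeI)
          fix x :: "real^'d" assume x: "x \<in> unit_cube"
          have "\<bar>f0 x - f x\<bar> \<le> \<bar>e0\<bar>" using f0f[OF x] by linarith
          then show "(if x \<in> unit_cube then (f0 x - f x)\<^sup>2 else 0) \<le> e0\<^sup>2" using x by (simp add: abs_le_square_iff)
        qed
      qed
      then have "L * dist2 f0 \<le> L * e0\<^sup>2" using Lpos by simp
      with excess_expectation_bounds(2)[OF f0 M f0M] show ?thesis by simp
    qed
    have 5: "2 * \<mu> * dist2 ?G \<le> ?E ?G"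
      by (rule excess_expectation_bounds(1)[OF tr_meas[OF gH] order_refl tr1])
    have 6: "?E ?G' \<le> 2 * (1 / real m * (\<Sum>i<m. excess_loss ?G' (D i))) + 2 * ln (2 * N / \<delta>) / (s * real m)"
      using ET[OF D, of ?G'] g' by simp
    have 7: "2 * (ln (2 * N / \<delta>) + ln (2 / \<delta>)) / (s * real m) = 2 * ln (2 * N / \<delta>) / (s * real m) + 2 * (ln (2 / \<delta>) / (s * real m))"
      by (simp add: add_divide_distrib distrib_left)
    \<comment> \<open>Net error: once in the mean and twice in the doubled empirical mean. The
      doubled factor \<open>3 / 2\<close> of \<open>f0\<close> gives
      \<open>3 L e0^2\<close>.\<close>
    have "2 * \<mu> * dist2 ?G \<le> 3 * (L * e0\<^sup>2) + 2 * (1 / real m * N0) + 3 * (?C * e) + 2 * (ln (2 * N / \<delta>) + ln (2 / \<delta>)) / (s * real m)"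
      unfolding 7 using 1 2 3 4 5 6 E0[OF D] by linarith
    then have "2 * \<mu> * dist2 ?G \<le> 3 * L * e0\<^sup>2 + 2 * N0 / real m + 3 * ?C * e + 2 * (ln (2 * N / \<delta>) + ln (2 / \<delta>)) / (s * real m)"
      by simp
    moreover have "\<forall>x\<in>unit_cube. \<bar>?G x\<bar> \<le> 1 \<and> (0 \<le> ?G x \<longleftrightarrow> 0 \<le> g x)" by (simp add: tr_def clip_nonneg_iff abs_clip_le)
    ultimately show ?thesis using tr_meas[OF gH] by blast
  qed
  then show ?thesis using E by blast
qed

end

section \<open>Rates\<close>

text \<open>Relative to the ideal exponent \<open>- 2 r / P\<close>, approximation loses
  \<open>2 r \<kappa>\<close> and entropy loses \<open>(d + 1) \<kappa>\<close>, the extra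
  \<open>\<kappa>\<close> paying for the logarithm; both stay within \<open>\<nu>\<close>. The
  condition \<open>\<kappa> K \<ge> 2\<close> makes the interpolation error at most
  \<open>1 / x^2\<close>, small enough for a ball of radius up to order \<open>x\<close>.\<close>

lemma rate_arithmetic:
  fixes x \<kappa> \<nu> r :: real and d K :: nat
  assumes x: "1 \<le> x" and r: "0 < r" and \<kappa>: "0 < \<kappa>" "\<kappa> * (2 * r + real d + 1) \<le> \<nu>" and K: "2 \<le> \<kappa> * real K"
  defines "P \<equiv> 2 * r + real d"
  defines "\<sigma> \<equiv> x powr (- 1 / P)" and "R \<equiv> x powr \<kappa>" and "X \<equiv> x powr (- (2 * r / P) + \<nu>)"
  defines "n \<equiv> nat \<lceil>R / \<sigma>\<rceil>"
  shows "0 < \<sigma>" "1 \<le> R" "R * \<sigma> = x powr (\<kappa> - 1 / P)"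
    "((R * \<sigma>) powr r)\<^sup>2 \<le> X" "exp (- R\<^sup>2) \<le> real K ^ K * X" "1 / \<sigma> ^ d / x \<le> X" "1 / x \<le> X"
    "1 \<le> n" "1 \<le> real n * \<sigma>" "(1 / (real n * \<sigma>)) ^ K \<le> 1 / x\<^sup>2" "real n ^ d * R / x \<le> 2 ^ d * X"
proof -
  have x0: "0 < x" using x by simp
  have P: "0 < P" using r by (simp add: P_def add_pos_nonneg)
  have K1: "1 \<le> K" using K \<kappa> by (cases K) auto
  have \<kappa>\<nu>: "\<kappa> * (2 * r) \<le> \<nu>" "\<kappa> * (real d + 1) \<le> \<nu>" "0 \<le> \<nu>"
  proof -
    have "0 \<le> \<kappa> * (2 * r)" "0 \<le> \<kappa> * (real d + 1)" using \<kappa> r by auto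
    then show "\<kappa> * (2 * r) \<le> \<nu>" "\<kappa> * (real d + 1) \<le> \<nu>" "0 \<le> \<nu>" using \<kappa>(2) by (auto simp: distrib_left)
  qed
  have a: "real d / P - 1 = - (2 * r / P)" using P by (simp add: P_def field_simps)
  have mono: "x powr s \<le> x powr t" if "s \<le> t" for s t using x that by (intro powr_mono) auto
  show \<sigma>: "0 < \<sigma>" using x by (simp add: \<sigma>_def)
  have \<sigma>1: "\<sigma> \<le> 1" using mono[of "-1/P" 0] P x by (simp add: \<sigma>_def)
  show R: "1 \<le> R" using mono[of 0 \<kappa>] \<kappa> x by (simp add: R_def)
  show R\<sigma>: "R * \<sigma> = x powr (\<kappa> - 1 / P)" by (simp add: R_def \<sigma>_def flip: powr_add)
  have "((R * \<sigma>) powr r)\<^sup>2 = x powr (\<kappa> * (2 * r) - 2 * r / P)"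
    unfolding R\<sigma> powr_powr power2_eq_square powr_add[symmetric] by (simp add: algebra_simps)
  also have "\<dots> \<le> X" unfolding X_def by (rule mono) (use \<kappa>\<nu> in simp)
  finally show "((R * \<sigma>) powr r)\<^sup>2 \<le> X" .
  have "0 \<le> real d / P" using P by simp
  then have "- 1 \<le> - (2 * r / P) + \<nu>" using a \<kappa>\<nu>(3) by linarith
  then have "x powr (- 1) \<le> X" unfolding X_def by (rule mono)
  then show xX: "1 / x \<le> X" using x0 by (simp add: powr_minus_divide)
  have \<sigma>d: "\<sigma> ^ d = x powr (- (real d / P))" using x0 by (simp add: \<sigma>_def powr_realpow[symmetric] powr_powr)
  have "1 / \<sigma> ^ d / x = x powr (real d / P - 1)" unfolding \<sigma>d using x0 by (simp add: powr_minus powr_diff inverse_eq_divide)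
  also have "\<dots> \<le> X" unfolding X_def a by (rule mono) (use \<kappa>\<nu> in simp)
  finally show "1 / \<sigma> ^ d / x \<le> X" .
  show "exp (- R\<^sup>2) \<le> real K ^ K * X"
  proof -
    have R2: "0 < R\<^sup>2" using R by simp
    \<comment> \<open>From \<open>y \<le> exp y\<close> with \<open>y = R^2 / K\<close>, raised to
      the power \<open>K\<close>; as \<open>R ^ (2 K) \<ge> x\<close>, the Gaussian tail is at most
      \<open>K ^ K / x\<close>.\<close>
    have "(R\<^sup>2 / real K) ^ K \<le> exp (R\<^sup>2 / real K) ^ K"
    proof (rule power_mono)
      show "R\<^sup>2 / real K \<le> exp (R\<^sup>2 / real K)" using exp_ge_add_one_self[of "R\<^sup>2 / real K"] by linarith
    qed (use K1 in simp)
    also have "\<dots> = exp (R\<^sup>2)" using K1 by (simp flip: exp_of_nat_mult)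
    finally have e: "(R\<^sup>2 / real K) ^ K \<le> exp (R\<^sup>2)" .
    have "x powr 1 \<le> x powr (\<kappa> * real K * 2)" by (rule mono) (use K in simp)
    also have "\<dots> = (R\<^sup>2) ^ K" using x0 by (simp add: R_def powr_powr power_mult[symmetric] powr_realpow[symmetric] mult_ac)
    finally have "x / real K ^ K \<le> (R\<^sup>2 / real K) ^ K" using x0 by (simp add: power_divide divide_right_mono)
    with e have "x / real K ^ K \<le> exp (R\<^sup>2)" by simp
    then have "exp (- R\<^sup>2) \<le> real K ^ K * (1 / x)" using x0 K1 by (simp add: exp_minus field_simps)
    also have "\<dots> \<le> real K ^ K * X" using xX by (intro mult_left_mono) auto
    finally show ?thesis .
  qed
  have RS1: "1 \<le> R / \<sigma>" using R \<sigma> \<sigma>1 by (simp add: le_divide_eq)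
  have nR: "R / \<sigma> \<le> real n" unfolding n_def by (rule real_nat_ceiling_ge)
  have n2: "real n \<le> 2 * (R / \<sigma>)"
  proof -
    have "real n \<le> R / \<sigma> + 1" unfolding n_def using RS1 by (simp add: of_nat_nat)
    then show ?thesis using RS1 by simp
  qed
  have "1 \<le> real n" using nR RS1 by linarith
  then show "1 \<le> n" by simp
  have Rn: "R \<le> real n * \<sigma>" using nR \<sigma> by (simp add: field_simps)
  then show "1 \<le> real n * \<sigma>" using R by simp
  have "(1 / (real n * \<sigma>)) ^ K \<le> (1 / R) ^ K"
    using R Rn by (intro power_mono divide_left_mono) (auto intro!: mult_pos_pos)
  also have "\<dots> = 1 / R ^ K" by (simp add: power_divide)
  also have "R ^ K = x powr (\<kappa> * real K)" using x0 by (simp add: R_def powr_powr powr_realpow[symmetric])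
  also have "1 / x powr (\<kappa> * real K) \<le> 1 / x powr 2" using mono[OF K] x0 by (intro divide_left_mono) auto
  also have "x powr 2 = x\<^sup>2" using x0 by simp
  finally show "(1 / (real n * \<sigma>)) ^ K \<le> 1 / x\<^sup>2" .
  have "real n ^ d * R / x \<le> (2 * (R / \<sigma>)) ^ d * R / x"
    using n2 R x0 by (intro divide_right_mono mult_right_mono power_mono) auto
  also have "\<dots> = 2 ^ d * (R ^ d * R * (1 / \<sigma> ^ d / x))" by (simp add: power_mult_distrib power_divide)
  also have "R ^ d * R = x powr (\<kappa> * (real d + 1))"
    using x0 by (simp add: R_def powr_realpow[symmetric] powr_powr powr_add[symmetric] distrib_left mult_ac add_ac)
  also have "1 / \<sigma> ^ d / x = x powr (- (2 * r / P))" unfolding \<sigma>d a[symmetric] using x0 by (simp add: powr_minus powr_diff inverse_eq_divide)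
  also have "x powr (\<kappa> * (real d + 1)) * x powr (- (2 * r / P)) = x powr (\<kappa> * (real d + 1) - 2 * r / P)"
    by (simp flip: powr_add)
  also have "2 ^ d * x powr (\<kappa> * (real d + 1) - 2 * r / P) \<le> 2 ^ d * X"
    unfolding X_def by (intro mult_left_mono mono) (use \<kappa>\<nu> in auto)
  finally show "real n ^ d * R / x \<le> 2 ^ d * X" .
qed

text \<open>Lets the logarithm be multiplied onto terms free of \<open>\<delta>\<close>, and lets a
  power of it with exponent at most 1 be bounded by itself.\<close>

lemma one_le_ln_four_div:
  fixes \<delta> :: real assumes "0 < \<delta>" "\<delta> < 1" shows "1 \<le> ln (4 / \<delta>)"
proof -
  have "exp 1 \<le> (3 :: real)" by (rule exp_le)
  also have "3 \<le> 4 / \<delta>" using assms by (simp add: field_simps)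
  finally show ?thesis using assms by (subst ln_ge_iff) auto
qed

text \<open>As \<open>\<kappa>\<close> is at most half of \<open>1 / P\<close>, the scale
  \<open>R \<sigma>\<close> still decays like \<open>x powr (- 1 / (2 P))\<close>, which beats
  \<open>c\<close> past the stated threshold.\<close>

lemma small_bandwidth:
  fixes x \<kappa> P c :: real
  assumes P: "0 < P" and \<kappa>: "\<kappa> \<le> 1 / (2 * P)" and c: "0 < c" and x: "1 \<le> x" "c powr (2 * P) \<le> x"
  shows "c * x powr (\<kappa> - 1 / P) \<le> 1"
proof -
  have "c = (c powr (2 * P)) powr (1 / (2 * P))" using P c by (simp add: powr_powr)
  also have "\<dots> \<le> x powr (1 / (2 * P))" using P x by (intro powr_mono2) auto
  finally have c': "c \<le> x powr (1 / (2 * P))" .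
  have "x powr (\<kappa> - 1 / P) \<le> x powr (- (1 / (2 * P)))" using x \<kappa> P by (intro powr_mono) (auto simp: field_simps)
  then have "c * x powr (\<kappa> - 1 / P) \<le> x powr (1 / (2 * P)) * x powr (- (1 / (2 * P)))" using c' c by (intro mult_mono) auto
  also have "\<dots> = 1" using x by (simp flip: powr_add)
  finally show ?thesis .
qed

context learning_problem
begin

lemma erm_distance_rate:
  fixes Df :: "('d \<Rightarrow> nat) \<Rightarrow> real^'d \<Rightarrow> real" and r \<nu> :: real
  assumes tower: "hoelder_tower u v c0 Df" and v: "0 < v" and c0: "0 \<le> c0"
    and Df: "\<forall>x\<in>unit_cube. Df (\<lambda>_. 0) x = f x" and r: "r = real u + v" and \<nu>: "0 < \<nu>"
  shows "\<exists>C>0. \<exists>m0\<ge>1. \<forall>m::nat. \<forall>\<delta>. m0 \<le> m \<longrightarrow> 0 < \<delta> \<longrightarrow> \<delta> < 1 \<longrightarrow>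
    (\<exists>E \<in> sets (sample_space \<rho>X \<eta> m). 1 - \<delta> \<le> measure (sample_space \<rho>X \<eta> m) E \<and>
      (\<forall>D\<in>E. \<forall>g. erm_solution \<phi> (gauss_kernel (real m powr (- 1 / (2 * r + real CARD('d))))) unit_cube (1 / real m) m D g \<longrightarrow>
        (\<exists>G \<in> borel_measurable borel. (\<forall>x\<in>unit_cube. \<bar>G x\<bar> \<le> 1 \<and> (0 \<le> G x \<longleftrightarrow> 0 \<le> g x)) \<and>
          dist2 G \<le> C * real m powr (- (2 * r / (2 * r + real CARD('d))) + \<nu>) * ln (4 / \<delta>))))"
proof -
  let ?d = "CARD('d)"
  let ?P = "2 * r + real ?d"
  have r0: "0 < r" using r v by simp
  have P: "0 < ?P" using r0 by (simp add: add_pos_pos)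
  \<comment> \<open>The first entry keeps the total loss within \<open>\<nu>\<close>, the second
    forces \<open>R \<sigma>\<close> to tend to 0.\<close>
  define \<kappa> where "\<kappa> = min (\<nu> / (?P + 1)) (1 / (2 * ?P))"
  have \<kappa>: "0 < \<kappa>" "\<kappa> \<le> 1 / (2 * ?P)" using \<nu> P by (auto simp: \<kappa>_def)
  have "\<kappa> \<le> \<nu> / (?P + 1)" by (simp add: \<kappa>_def)
  then have \<kappa>\<nu>: "\<kappa> * (2 * r + real ?d + 1) \<le> \<nu>" using P by (simp add: field_simps)
  define K where "K = nat \<lceil>2 / \<kappa>\<rceil>"
  have "2 / \<kappa> \<le> real K" unfolding K_def by (rule real_nat_ceiling_ge)
  then have K2: "2 \<le> \<kappa> * real K" using \<kappa> by (simp add: field_simps)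
  then have K1: "1 \<le> K" by (cases K) auto
  define N' where "N' = 2 * K"
  define \<Lambda> where "\<Lambda> = 1 + lebesgue_const N'"
  have \<Lambda>: "1 \<le> \<Lambda>" by (simp add: \<Lambda>_def lebesgue_const_def)
  obtain C1 where C1: "0 < C1" and approx: "\<And>\<sigma> R. 0 < \<sigma> \<Longrightarrow> 0 < R \<Longrightarrow> 4 * real (Suc u) * R * \<sigma> \<le> 1 \<Longrightarrow>
    (\<exists>f0. f0 \<in> borel_measurable borel \<and> (\<forall>x. \<bar>f0 x\<bar> \<le> C1) \<and>
       (\<forall>x\<in>unit_cube. \<bar>f0 x - f x\<bar> \<le> C1 * ((R * \<sigma>) powr r + exp (- R\<^sup>2))) \<and>
       rkhs_norm_sq (gauss_kernel \<sigma>) unit_cube f0 \<le> ereal (C1 / \<sigma> ^ ?d))"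
    using gaussian_approximation[OF tower v c0 Df] f_abs_le unfolding r by blast
  define M where "M = max 1 C1"
  have M: "1 \<le> M" "C1 \<le> M" by (auto simp: M_def)
  define s where "s = min (conc_rate 1) (conc_rate M)"
  have s: "0 < s" using conc_rate_pos M by (simp add: s_def)
  define F where "F = sqrt (\<phi> 0)"
  have F: "0 < F" using pos[of 0] by (simp add: F_def)
  \<comment> \<open>Bounds the logarithm of the base of the covering number by
    \<open>c5 * R\<close>, using \<open>ln x \<le> x powr \<kappa> / \<kappa>\<close>.\<close>
  define c5 where "c5 = ln (2 * F + 3) + 2 / \<kappa>"
  have c5: "0 < c5" using F \<kappa> by (auto simp: c5_def intro!: add_nonneg_pos)
  define Ce where "Ce = \<Lambda> ^ ?d * (1 + 4 * real ?d * F * \<Lambda>)"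
  have Ce: "0 < Ce" using \<Lambda> F by (auto simp: Ce_def intro!: mult_pos_pos add_pos_nonneg)
  define Cn where "Cn = real N' ^ ?d * c5 * 2 ^ ?d"
  have Cn: "0 \<le> Cn" using c5 by (simp add: Cn_def)
  define C where "C = (3 * L * (2 * C1\<^sup>2 * (1 + real K ^ K)) + 2 * C1 + 3 * lip_const 1 * Ce + 2 * Cn / s + 4 / s) / (2 * \<mu>)"
  have Cpos: "0 < C"
  proof -
    have "0 \<le> 3 * L * (2 * C1\<^sup>2 * (1 + real K ^ K))" using Lpos by simp
    moreover have "0 \<le> 3 * lip_const 1 * Ce" using lip_const_pos[of 1] Ce by simp
    moreover have "0 \<le> 2 * Cn / s" "0 < 4 / s" using Cn s by auto
    ultimately have "0 < 3 * L * (2 * C1\<^sup>2 * (1 + real K ^ K)) + 2 * C1 + 3 * lip_const 1 * Ce + 2 * Cn / s + 4 / s"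
      using C1 by linarith
    then show ?thesis using mupos by (simp add: C_def)
  qed
  \<comment> \<open>From this sample size on, \<open>4 (u + 1) R \<sigma> \<le> 1\<close>, as the
    approximation lemma requires.\<close>
  define m0 where "m0 = Suc (nat \<lceil>(4 * real (Suc u)) powr (2 * ?P)\<rceil>)"
  show ?thesis
  proof (rule exI[of _ C], rule conjI[OF Cpos], rule exI[of _ m0], intro conjI allI impI)
    show "1 \<le> m0" by (simp add: m0_def)
    fix m :: nat and \<delta> :: real assume m: "m0 \<le> m" and \<delta>: "0 < \<delta>" "\<delta> < 1"
    define x where "x = real m"
    have m1: "1 \<le> m" using m by (simp add: m0_def)
    then have x: "1 \<le> x" by (simp add: x_def)
    then have x0: "0 < x" by simp
    have "(4 * real (Suc u)) powr (2 * ?P) \<le> real (nat \<lceil>(4 * real (Suc u)) powr (2 * ?P)\<rceil>)" by (rule real_nat_ceiling_ge)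
    also have "\<dots> \<le> x" using m by (simp add: m0_def x_def)
    finally have xbig: "(4 * real (Suc u)) powr (2 * ?P) \<le> x" .
    define \<sigma> where "\<sigma> = x powr (- 1 / ?P)"
    define R where "R = x powr \<kappa>"
    define X where "X = x powr (- (2 * r / ?P) + \<nu>)"
    define n where "n = nat \<lceil>R / \<sigma>\<rceil>"
    note ra = rate_arithmetic[OF x r0 \<kappa>(1) \<kappa>\<nu> K2, folded \<sigma>_def R_def X_def, folded n_def]
    have X0: "0 < X" using x0 by (simp add: X_def)
    have "4 * real (Suc u) * R * \<sigma> = 4 * real (Suc u) * x powr (\<kappa> - 1 / ?P)" using ra(3) by (simp only: mult.assoc)
    also have "\<dots> \<le> 1" by (rule small_bandwidth[OF P \<kappa>(2) _ x xbig]) simp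
    finally have small: "4 * real (Suc u) * R * \<sigma> \<le> 1" .
    define e0 where "e0 = C1 * ((R * \<sigma>) powr r + exp (- R\<^sup>2))"
    have "0 < R" using ra(2) by simp
    from approx[OF ra(1) this small, folded e0_def] obtain f0 where f0: "f0 \<in> borel_measurable borel" "\<forall>x. \<bar>f0 x\<bar> \<le> C1"
       "\<forall>x\<in>unit_cube. \<bar>f0 x - f x\<bar> \<le> e0" "rkhs_norm_sq (gauss_kernel \<sigma>) unit_cube f0 \<le> ereal (C1 / \<sigma> ^ ?d)" by blast
    define B where "B = F * sqrt x"
    have B: "0 < B" using F x0 by (simp add: B_def)
    have B2: "B\<^sup>2 = \<phi> 0 * real m" using nonneg[of 0] by (simp add: B_def F_def x_def power_mult_distrib)
    have Bx: "B \<le> F * x"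
    proof -
      have "sqrt x \<le> sqrt (x * x)" using x by (intro real_sqrt_le_mono) simp
      then show ?thesis using F x0 by (simp add: B_def)
    qed
    define e where "e = \<Lambda> ^ ?d * (1 / x + real ?d * (4 * B * \<Lambda> * (1 / (real n * \<sigma>)) ^ K))"
    \<comment> \<open>The net rounds values at resolution \<open>1 / x\<close>, which is below the
      target rate \<open>X\<close>.\<close>
    define N where "N = (2 * B / (1 / x) + 3) ^ ((n * N') ^ ?d)"
    have "0 < 1 / x" using x0 by simp
    from gauss_rkhs_ball_covering[OF B ra(8) K1 N'_def ra(1) ra(9) this, where 'd = 'd, folded \<Lambda>_def, folded e_def N_def]
    obtain T0 where T0: "finite T0" "T0 \<subseteq> rkhs_ball (gauss_kernel \<sigma>) (unit_cube :: (real^'d) set) B" "real (card T0) \<le> N"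
      "\<forall>g\<in>rkhs_ball (gauss_kernel \<sigma>) unit_cube B. \<exists>g'\<in>T0. \<forall>x\<in>unit_cube. \<bar>g x - g' x\<bar> \<le> e" by blast
    have e_nonneg: "0 \<le> e" using \<Lambda> B ra(1) x0 by (simp add: e_def)
    have b3: "1 \<le> 2 * B / (1 / x) + 3" using B x0 by simp
    then have N1: "1 \<le> N" unfolding N_def by (rule one_le_power)
    have ln4: "1 \<le> ln (4 / \<delta>)" by (rule one_le_ln_four_div[OF \<delta>])
    have ln2: "ln (2 / \<delta>) \<le> ln (4 / \<delta>)" using \<delta> by (intro ln_mono) (auto simp: divide_right_mono)
    have eX: "e \<le> Ce * X"
    proof -
      have "4 * B * \<Lambda> * (1 / (real n * \<sigma>)) ^ K \<le> 4 * (F * x) * \<Lambda> * (1 / x\<^sup>2)"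
        using Bx \<Lambda> F x0 B ra(1) ra(10) by (intro mult_mono) auto
      also have "\<dots> = 4 * F * \<Lambda> * (1 / x)" using x0 by (simp add: power2_eq_square)
      finally have "real ?d * (4 * B * \<Lambda> * (1 / (real n * \<sigma>)) ^ K) \<le> real ?d * (4 * F * \<Lambda> * (1 / x))" by (intro mult_left_mono) auto
      then have "e \<le> \<Lambda> ^ ?d * (1 / x + real ?d * (4 * F * \<Lambda> * (1 / x)))"
        unfolding e_def using \<Lambda> by (intro mult_left_mono[OF add_left_mono]) auto
      also have "\<dots> = Ce * (1 / x)" by (simp add: Ce_def distrib_right distrib_left add_divide_distrib)
      also have "\<dots> \<le> Ce * X" using Ce ra(7) by (intro mult_left_mono) auto
      finally show ?thesis .
    qed
    have e0X: "e0\<^sup>2 \<le> 2 * C1\<^sup>2 * (1 + real K ^ K) * X"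
    proof -
      let ?p = "(R * \<sigma>) powr r" and ?q = "exp (- R\<^sup>2)"
      have "(?p + ?q)\<^sup>2 \<le> 2 * ?p\<^sup>2 + 2 * ?q\<^sup>2"
        using zero_le_power2[of "?p - ?q"] by (simp add: power2_sum power2_diff)
      \<comment> \<open>As \<open>?q \<le> 1\<close>, the square may be dropped, leaving the tail
        bound of \<open>rate_arithmetic\<close>.\<close>
      also have "?q\<^sup>2 \<le> ?q" by (simp add: power2_eq_square mult_le_cancel_left1)
      finally have "(?p + ?q)\<^sup>2 \<le> 2 * ((1 + real K ^ K) * X)" using ra(4,5) by (simp add: distrib_right)
      then have "C1\<^sup>2 * (?p + ?q)\<^sup>2 \<le> C1\<^sup>2 * (2 * ((1 + real K ^ K) * X))" by (intro mult_left_mono) auto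
      then have "e0\<^sup>2 \<le> C1\<^sup>2 * (2 * ((1 + real K ^ K) * X))" unfolding e0_def power_mult_distrib .
      also have "\<dots> = 2 * C1\<^sup>2 * (1 + real K ^ K) * X" by (simp only: mult_ac)
      finally show ?thesis .
    qed
    have N0X: "C1 / \<sigma> ^ ?d / x \<le> C1 * X"
      using mult_left_mono[OF ra(6), of C1] C1 by simp
    have lnN: "ln N / x \<le> Cn * X"
    proof -
      have "2 * B / (1 / x) + 3 \<le> (2 * F + 3) * x\<^sup>2"
      proof -
        have "2 * B * x \<le> 2 * (F * x) * x" using Bx x0 by (intro mult_right_mono) auto
        moreover have "3 \<le> 3 * x\<^sup>2" using x by (simp add: one_le_power)
        ultimately show ?thesis by (simp add: power2_eq_square algebra_simps)
      qed
      then have "ln (2 * B / (1 / x) + 3) \<le> ln ((2 * F + 3) * x\<^sup>2)" using b3 by (intro ln_mono) auto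
      also have "\<dots> = ln (2 * F + 3) + 2 * ln x" using F x0 by (simp add: ln_mult ln_realpow)
      also have "\<dots> \<le> ln (2 * F + 3) * R + 2 * (R / \<kappa>)"
      proof (intro add_mono mult_left_mono)
        have "0 \<le> ln (2 * F + 3)" using F by (intro ln_ge_zero) auto
        then show "ln (2 * F + 3) \<le> ln (2 * F + 3) * R" using ra(2) by (simp add: mult_le_cancel_left1)
        show "ln x \<le> R / \<kappa>" unfolding R_def by (rule ln_powr_bound[OF x \<kappa>(1)])
      qed simp
      also have "\<dots> = c5 * R" by (simp add: c5_def distrib_right)
      finally have l: "ln (2 * B / (1 / x) + 3) \<le> c5 * R" .
      have "ln N = real ((n * N') ^ ?d) * ln (2 * B / (1 / x) + 3)"
        unfolding N_def by (rule ln_realpow)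
      also have "\<dots> \<le> real ((n * N') ^ ?d) * (c5 * R)" by (intro mult_left_mono l) auto
      also have "\<dots> = real N' ^ ?d * c5 * (real n ^ ?d * R)" by (simp add: power_mult_distrib)
      finally have "ln N / x \<le> real N' ^ ?d * c5 * (real n ^ ?d * R) / x" using x0 by (intro divide_right_mono) auto
      also have "\<dots> = real N' ^ ?d * c5 * (real n ^ ?d * R / x)" by simp
      also have "\<dots> \<le> real N' ^ ?d * c5 * (2 ^ ?d * X)" using c5 ra(11) by (intro mult_left_mono) auto
      finally show ?thesis by (simp add: Cn_def mult_ac)
    qed
    let ?bd = "3 * L * e0\<^sup>2 + 2 * (C1 / \<sigma> ^ ?d) / x + 3 * lip_const 1 * e + 2 * (ln (2 * N / \<delta>) + ln (2 / \<delta>)) / (s * x)"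
    have total: "?bd \<le> (2 * \<mu> * C) * X * ln (4 / \<delta>)"
    proof -
      have X1: "X \<le> X * ln (4 / \<delta>)" using ln4 X0 by (simp add: mult_le_cancel_left1)
      have up: "y \<le> c * (X * ln (4 / \<delta>))" if "y \<le> c * X" "0 \<le> c" for y c
        using that X1 mult_left_mono[OF X1 that(2)] by linarith
      have 1: "3 * L * e0\<^sup>2 \<le> (3 * L * (2 * C1\<^sup>2 * (1 + real K ^ K))) * (X * ln (4 / \<delta>))"
      proof (rule up)
        show "3 * L * e0\<^sup>2 \<le> (3 * L * (2 * C1\<^sup>2 * (1 + real K ^ K))) * X"
          using mult_left_mono[OF e0X, of "3 * L"] Lpos by (simp add: mult_ac)
      qed (use Lpos in simp)
      have 2: "2 * (C1 / \<sigma> ^ ?d) / x \<le> (2 * C1) * (X * ln (4 / \<delta>))"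
        by (rule up) (use N0X C1 in auto)
      have 3: "3 * lip_const 1 * e \<le> (3 * lip_const 1 * Ce) * (X * ln (4 / \<delta>))"
      proof (rule up)
        show "3 * lip_const 1 * e \<le> (3 * lip_const 1 * Ce) * X"
          using mult_left_mono[OF eX, of "3 * lip_const 1"] lip_const_pos[of 1] by (simp add: mult_ac)
      qed (use lip_const_pos[of 1] Ce in simp)
      have 4: "2 * (ln N / x) / s \<le> (2 * Cn / s) * (X * ln (4 / \<delta>))"
      proof (rule up)
        show "2 * (ln N / x) / s \<le> (2 * Cn / s) * X"
          using divide_right_mono[OF lnN, of s] s by simp
      qed (use Cn s in simp)
      have 5: "4 * (ln (2 / \<delta>) / x) / s \<le> (4 / s) * (X * ln (4 / \<delta>))"
      proof -
        have "ln (2 / \<delta>) / x \<le> ln (4 / \<delta>) * (1 / x)" using ln2 x0 by (simp add: divide_right_mono)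
        also have "\<dots> \<le> ln (4 / \<delta>) * X" using ra(7) ln4 by (intro mult_left_mono) auto
        finally have "4 * (ln (2 / \<delta>) / x) / s \<le> 4 * (ln (4 / \<delta>) * X) / s" using s by (intro divide_right_mono mult_left_mono) auto
        also have "\<dots> = (4 / s) * (X * ln (4 / \<delta>))" by simp
        finally show ?thesis .
      qed
      have "ln (2 * N / \<delta>) = ln N + ln (2 / \<delta>)"
        using N1 \<delta> ln_mult[of N "2 / \<delta>"] by (simp add: mult.commute)
      then have 6: "2 * (ln (2 * N / \<delta>) + ln (2 / \<delta>)) / (s * x) = 2 * (ln N / x) / s + 4 * (ln (2 / \<delta>) / x) / s"
        using s x0 by (simp add: field_simps)
      have "2 * \<mu> * C = 3 * L * (2 * C1\<^sup>2 * (1 + real K ^ K)) + 2 * C1 + 3 * lip_const 1 * Ce + 2 * Cn / s + 4 / s"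
        using mupos by (simp add: C_def)
      then have "(2 * \<mu> * C) * X * ln (4 / \<delta>) = (3 * L * (2 * C1\<^sup>2 * (1 + real K ^ K))) * (X * ln (4 / \<delta>)) + (2 * C1) * (X * ln (4 / \<delta>))
         + (3 * lip_const 1 * Ce) * (X * ln (4 / \<delta>)) + (2 * Cn / s) * (X * ln (4 / \<delta>)) + (4 / s) * (X * ln (4 / \<delta>))"
        by (simp only: mult.assoc distrib_right)
      then show ?thesis unfolding 6 using 1 2 3 4 5 by linarith
    qed
    have f0M: "\<And>x. x \<in> unit_cube \<Longrightarrow> \<bar>f0 x\<bar> \<le> M" using f0(2) M(2) order_trans by blast
    have cover: "\<And>g. g \<in> rkhs_ball (gauss_kernel \<sigma>) unit_cube B \<Longrightarrow> \<exists>g'\<in>T0. \<forall>x\<in>unit_cube. \<bar>g x - g' x\<bar> \<le> e" using T0(4) by blast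
    have f0f: "\<And>x. x \<in> unit_cube \<Longrightarrow> \<bar>f0 x - f x\<bar> \<le> e0" using f0(3) by blast
    from oracle_inequality[OF f0(1) M(1) f0M f0f f0(4) ra(1) T0(1,2) B2 cover e_nonneg T0(3) N1 \<delta>(1) m1, folded s_def x_def]
    obtain E where E: "E \<in> sets (sample_space \<rho>X \<eta> m)" "1 - \<delta> \<le> measure (sample_space \<rho>X \<eta> m) E"
      and ED: "\<forall>D\<in>E. \<forall>g. erm_solution \<phi> (gauss_kernel \<sigma>) unit_cube (1 / x) m D g \<longrightarrow>
        (\<exists>G \<in> borel_measurable borel. (\<forall>x\<in>unit_cube. \<bar>G x\<bar> \<le> 1 \<and> (0 \<le> G x \<longleftrightarrow> 0 \<le> g x)) \<and> 2 * \<mu> * dist2 G \<le> ?bd)" by blast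
    show "\<exists>E \<in> sets (sample_space \<rho>X \<eta> m). 1 - \<delta> \<le> measure (sample_space \<rho>X \<eta> m) E \<and>
      (\<forall>D\<in>E. \<forall>g. erm_solution \<phi> (gauss_kernel (real m powr (- 1 / (2 * r + real CARD('d))))) unit_cube (1 / real m) m D g \<longrightarrow>
        (\<exists>G \<in> borel_measurable borel. (\<forall>x\<in>unit_cube. \<bar>G x\<bar> \<le> 1 \<and> (0 \<le> G x \<longleftrightarrow> 0 \<le> g x)) \<and>
          dist2 G \<le> C * real m powr (- (2 * r / (2 * r + real CARD('d))) + \<nu>) * ln (4 / \<delta>)))"
      unfolding x_def[symmetric] \<sigma>_def[symmetric] X_def[symmetric]
    proof (rule bexI[OF _ E(1)], rule conjI[OF E(2)], intro ballI allI impI)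
      fix D g assume "D \<in> E" "erm_solution \<phi> (gauss_kernel \<sigma>) unit_cube (1 / x) m D g"
      then obtain G where G: "G \<in> borel_measurable borel" "\<forall>x\<in>unit_cube. \<bar>G x\<bar> \<le> 1 \<and> (0 \<le> G x \<longleftrightarrow> 0 \<le> g x)" "2 * \<mu> * dist2 G \<le> ?bd"
        using ED by blast
      have "2 * \<mu> * dist2 G \<le> 2 * \<mu> * (C * X * ln (4 / \<delta>))" using G(3) total by (simp add: mult_ac)
      then have "dist2 G \<le> C * X * ln (4 / \<delta>)" using mupos by simp
      then show "\<exists>G \<in> borel_measurable borel. (\<forall>x\<in>unit_cube. \<bar>G x\<bar> \<le> 1 \<and> (0 \<le> G x \<longleftrightarrow> 0 \<le> g x)) \<and> dist2 G \<le> C * X * ln (4 / \<delta>)"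
        using G by blast
    qed
  qed
qed

end

text \<open>The probability is expressed by a measurable event on which the bound holds for all
  minimizers at once, so no measurable choice of a minimizer is involved. The rate for
  \<open>dist2\<close> raised to the power \<open>(q + 1) / (q + 2)\<close> is the claimed
  rate.\<close>

theorem theorem2:
  fixes \<phi> :: "real \<Rightarrow> real"
    and \<rho>X :: "(real^'d) measure"
    and \<eta> :: "real^'d \<Rightarrow> real"
    and f\<rho> :: "real^'d \<Rightarrow> real"
    and r c0 q :: real
  assumes loss: "twice_smooth_classifying_loss \<phi>"
    and marg: "prob_space \<rho>X" "sets \<rho>X = sets borel" "measure \<rho>X unit_cube = 1"
    and eta: "\<eta> \<in> borel_measurable borel" "\<forall>x\<in>unit_cube. 0 \<le> \<eta> x \<and> \<eta> x \<le> 1"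
    and target: "\<forall>x\<in>unit_cube. phi_minimizer \<phi> (\<eta> x) (f\<rho> x)"
    and smooth: "r > 0" "c0 > 0" "hoelder_class r c0 unit_cube f\<rho>"
    and noise: "q \<ge> 0" "tsybakov \<rho>X \<eta> q"
  shows "\<forall>\<nu>. 0 < \<nu> \<and> \<nu> < 2 * r * (q + 1) / ((2 * r + CARD('d)) * (q + 2)) \<longrightarrow>
    (\<exists>C. \<forall>(m::nat) \<delta>. m \<ge> 1 \<and> 0 < \<delta> \<and> \<delta> < 1 \<longrightarrow>
       (\<exists>E \<in> sets (sample_space \<rho>X \<eta> m).
          measure (sample_space \<rho>X \<eta> m) E \<ge> 1 - \<delta> \<and>
          (\<forall>D\<in>E. \<forall>f. erm_solution \<phi> (gauss_kernel (real m powr (- 1 / (2 * r + CARD('d)))))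
                         unit_cube (1 / real m) m D f \<longrightarrow>
             risk (rho_meas \<rho>X \<eta>) (sign_fun f) - risk (rho_meas \<rho>X \<eta>) (bayes_rule \<eta>)
               \<le> C * real m powr (- (2 * r * (q + 1) / ((2 * r + CARD('d)) * (q + 2))) + \<nu>)
                   * ln (4 / \<delta>))))"
proof (intro allI impI, elim conjE)
  fix \<nu> :: real assume \<nu>: "0 < \<nu>"
  let ?P = "2 * r + real CARD('d)" and ?\<theta> = "(q + 1) / (q + 2)"
  let ?Q = "2 * r * (q + 1) / (?P * (q + 2))"
  obtain L \<mu> where "smooth_loss \<phi> (deriv \<phi>) L \<mu>" using twice_smooth_imp_smooth_loss[OF loss] by blast
  then interpret smooth_loss \<phi> "deriv \<phi>" L \<mu> .
  obtain u v Df where r: "r = real u + v" and v: "0 < v" and tower: "hoelder_tower u v c0 Df"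
    and Df: "\<forall>x\<in>unit_cube. Df (\<lambda>_. 0) x = f\<rho> x"
    using hoelder_class_tower[OF smooth(3)] by blast
  \<comment> \<open>The target is constrained on the cube only; this modification off the cube is
    Borel.\<close>
  define f where "f x = (if x \<in> unit_cube then f\<rho> x else 0)" for x
  have f_meas: "f \<in> borel_measurable borel"
  proof -
    have "continuous_on unit_cube f\<rho>"
      using hoelder_tower_continuous[OF tower v] Df by (subst continuous_on_cong[of _ unit_cube f\<rho> "Df (\<lambda>_. 0)"]) auto
    then have "(\<lambda>x. indicator unit_cube x *\<^sub>R f\<rho> x) \<in> borel_measurable borel"
      by (intro borel_measurable_continuous_on_indicator) (simp add: unit_cube_eq_cbox)
    moreover have "(\<lambda>x. indicator unit_cube x *\<^sub>R f\<rho> x) = f" by (auto simp: f_def indicator_def)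
    ultimately show ?thesis by simp
  qed
  interpret classification \<rho>X \<eta>
    by (rule classification.intro[OF marg eta(1)]) (use eta(2) in blast)+
  interpret learning_problem \<phi> "deriv \<phi>" L \<mu> \<rho>X \<eta> f
    by unfold_locales (use f_meas target in \<open>auto simp: f_def\<close>)
  have Df': "\<forall>x\<in>unit_cube. Df (\<lambda>_. 0) x = f x" using Df by (simp add: f_def)
  obtain C m0 where C: "0 < C" and m0: "1 \<le> (m0::nat)" and rate: "\<And>m \<delta>. m0 \<le> m \<Longrightarrow> 0 < \<delta> \<Longrightarrow> \<delta> < 1 \<Longrightarrow>
    (\<exists>E \<in> sets (sample_space \<rho>X \<eta> m). 1 - \<delta> \<le> measure (sample_space \<rho>X \<eta> m) E \<and>
      (\<forall>D\<in>E. \<forall>g. erm_solution \<phi> (gauss_kernel (real m powr (- 1 / ?P))) unit_cube (1 / real m) m D g \<longrightarrow>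
        (\<exists>G \<in> borel_measurable borel. (\<forall>x\<in>unit_cube. \<bar>G x\<bar> \<le> 1 \<and> (0 \<le> G x \<longleftrightarrow> 0 \<le> g x)) \<and>
          dist2 G \<le> C * real m powr (- (2 * r / ?P) + \<nu>) * ln (4 / \<delta>))))"
    using erm_distance_rate[OF tower v less_imp_le[OF smooth(2)] Df' r \<nu>] by blast
  obtain K where K: "0 < K" and comp: "\<And>G A. G \<in> borel_measurable borel \<Longrightarrow> \<forall>x\<in>unit_cube. \<bar>G x\<bar> \<le> 1 \<Longrightarrow> 0 < A \<Longrightarrow> dist2 G \<le> A \<Longrightarrow>
    risk (rho_meas \<rho>X \<eta>) (sign_fun G) - risk (rho_meas \<rho>X \<eta>) (bayes_rule \<eta>) \<le> K * A powr ?\<theta>"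
    using excess_risk_comparison[OF noise] by blast
  \<comment> \<open>The second summand serves \<open>m < m0\<close>: there it makes the right side
    at least 1, the largest possible excess risk.\<close>
  define C' where "C' = K * C powr ?\<theta> + real m0 powr ?Q"
  have P: "0 < ?P" using smooth(1) by (simp add: add_pos_pos)
  have Q: "0 \<le> ?Q" "?Q = 2 * r / ?P * ?\<theta>" using smooth(1) noise(1) P by auto
  have \<theta>: "0 < ?\<theta>" "?\<theta> \<le> 1" using noise(1) by auto
  have part: "K * C powr ?\<theta> \<le> C'" "real m0 powr ?Q \<le> C'" "0 \<le> C'" using K by (auto simp: C'_def)
  show "\<exists>C. \<forall>(m::nat) \<delta>. m \<ge> 1 \<and> 0 < \<delta> \<and> \<delta> < 1 \<longrightarrow>
       (\<exists>E \<in> sets (sample_space \<rho>X \<eta> m). measure (sample_space \<rho>X \<eta> m) E \<ge> 1 - \<delta> \<and>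
          (\<forall>D\<in>E. \<forall>f. erm_solution \<phi> (gauss_kernel (real m powr (- 1 / ?P))) unit_cube (1 / real m) m D f \<longrightarrow>
             risk (rho_meas \<rho>X \<eta>) (sign_fun f) - risk (rho_meas \<rho>X \<eta>) (bayes_rule \<eta>)
               \<le> C * real m powr (- ?Q + \<nu>) * ln (4 / \<delta>)))"
  proof (intro exI[of _ C'] allI impI, elim conjE)
    fix m :: nat and \<delta> :: real assume m: "1 \<le> m" and \<delta>: "0 < \<delta>" "\<delta> < 1"
    have ln4: "1 \<le> ln (4 / \<delta>)" by (rule one_le_ln_four_div[OF \<delta>])
    show "\<exists>E \<in> sets (sample_space \<rho>X \<eta> m). measure (sample_space \<rho>X \<eta> m) E \<ge> 1 - \<delta> \<and>
          (\<forall>D\<in>E. \<forall>f. erm_solution \<phi> (gauss_kernel (real m powr (- 1 / ?P))) unit_cube (1 / real m) m D f \<longrightarrow>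
             risk (rho_meas \<rho>X \<eta>) (sign_fun f) - risk (rho_meas \<rho>X \<eta>) (bayes_rule \<eta>)
               \<le> C' * real m powr (- ?Q + \<nu>) * ln (4 / \<delta>))"
    proof (cases "m0 \<le> m")
      case True
      let ?X = "real m powr (- (2 * r / ?P) + \<nu>)"
      obtain E where E: "E \<in> sets (sample_space \<rho>X \<eta> m)" "1 - \<delta> \<le> measure (sample_space \<rho>X \<eta> m) E"
        and ED: "\<forall>D\<in>E. \<forall>g. erm_solution \<phi> (gauss_kernel (real m powr (- 1 / ?P))) unit_cube (1 / real m) m D g \<longrightarrow>
        (\<exists>G \<in> borel_measurable borel. (\<forall>x\<in>unit_cube. \<bar>G x\<bar> \<le> 1 \<and> (0 \<le> G x \<longleftrightarrow> 0 \<le> g x)) \<and> dist2 G \<le> C * ?X * ln (4 / \<delta>))"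
        using rate[OF True \<delta>] by blast
      have X0: "0 < ?X" using m by simp
      show ?thesis
      proof (rule bexI[OF _ E(1)], rule conjI[OF E(2)], intro ballI allI impI)
        fix D g assume "D \<in> E" "erm_solution \<phi> (gauss_kernel (real m powr (- 1 / ?P))) unit_cube (1 / real m) m D g"
        then obtain G where G: "G \<in> borel_measurable borel" "\<forall>x\<in>unit_cube. \<bar>G x\<bar> \<le> 1 \<and> (0 \<le> G x \<longleftrightarrow> 0 \<le> g x)"
          "dist2 G \<le> C * ?X * ln (4 / \<delta>)" using ED by blast
        have A: "0 < C * ?X * ln (4 / \<delta>)" using C X0 ln4 by simp
        have "risk (rho_meas \<rho>X \<eta>) (sign_fun g) \<le> risk (rho_meas \<rho>X \<eta>) (sign_fun G)"
          by (rule risk_sign_fun_le[OF G(1)]) (use G(2) in blast)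
        moreover have "risk (rho_meas \<rho>X \<eta>) (sign_fun G) - risk (rho_meas \<rho>X \<eta>) (bayes_rule \<eta>) \<le> K * (C * ?X * ln (4 / \<delta>)) powr ?\<theta>"
          using G(2) by (intro comp[OF G(1) _ A G(3)]) auto
        moreover have "(C * ?X * ln (4 / \<delta>)) powr ?\<theta> \<le> C powr ?\<theta> * (real m powr (- ?Q + \<nu>) * ln (4 / \<delta>))"
        proof -
          have "(C * ?X * ln (4 / \<delta>)) powr ?\<theta> = C powr ?\<theta> * (?X powr ?\<theta> * ln (4 / \<delta>) powr ?\<theta>)"
            using C X0 ln4 by (simp add: powr_mult mult.assoc)
          also have "\<dots> \<le> C powr ?\<theta> * (real m powr (- ?Q + \<nu>) * ln (4 / \<delta>))"
          proof (intro mult_left_mono mult_mono)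
            \<comment> \<open>The power \<open>?\<theta> \<le> 1\<close> shrinks the loss
              \<open>\<nu>\<close>, so the same \<open>\<nu>\<close> suffices for the distance and
              for the risk.\<close>
            have "\<nu> * ?\<theta> \<le> \<nu> * 1" using \<nu> \<theta> by (intro mult_left_mono) auto
            then have "(- (2 * r / ?P) + \<nu>) * ?\<theta> \<le> - ?Q + \<nu>" unfolding Q(2) by (simp only: distrib_right mult_minus_left)
            then show "?X powr ?\<theta> \<le> real m powr (- ?Q + \<nu>)" unfolding powr_powr using m by (intro powr_mono) auto
            show "ln (4 / \<delta>) powr ?\<theta> \<le> ln (4 / \<delta>)" using powr_mono[OF \<theta>(2) ln4] ln4 by simp
          qed auto
          finally show ?thesis .
        qed
        ultimately have "risk (rho_meas \<rho>X \<eta>) (sign_fun g) - risk (rho_meas \<rho>X \<eta>) (bayes_rule \<eta>)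
          \<le> K * (C powr ?\<theta> * (real m powr (- ?Q + \<nu>) * ln (4 / \<delta>)))"
          using K by (meson diff_right_mono mult_left_mono less_imp_le order_trans)
        also have "\<dots> = K * C powr ?\<theta> * (real m powr (- ?Q + \<nu>) * ln (4 / \<delta>))" by (simp only: mult.assoc)
        also have "\<dots> \<le> C' * (real m powr (- ?Q + \<nu>) * ln (4 / \<delta>))" using part(1) ln4 by (intro mult_right_mono) auto
        finally show "risk (rho_meas \<rho>X \<eta>) (sign_fun g) - risk (rho_meas \<rho>X \<eta>) (bayes_rule \<eta>)
          \<le> C' * real m powr (- ?Q + \<nu>) * ln (4 / \<delta>)" by (simp only: mult.assoc)
      qed
    next
      case False
      interpret S: prob_space "sample_space \<rho>X \<eta> m"
        unfolding sample_space_def by (rule prob_space_PiM) (rule prob_\<rho>)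
      \<comment> \<open>For small samples the whole sample space serves as the event.\<close>
      have "1 = real m0 powr ?Q * real m0 powr (- ?Q)" using m0 by (simp flip: powr_add)
      also have "\<dots> \<le> C' * real m powr (- ?Q + \<nu>)"
      proof (intro mult_mono part)
        have "real m0 powr (- ?Q) \<le> real m powr (- ?Q)" using m False Q(1) by (intro powr_mono2') auto
        also have "\<dots> \<le> real m powr (- ?Q + \<nu>)" using m \<nu> by (intro powr_mono) auto
        finally show "real m0 powr (- ?Q) \<le> real m powr (- ?Q + \<nu>)" .
      qed auto
      also have "\<dots> \<le> C' * real m powr (- ?Q + \<nu>) * ln (4 / \<delta>)"
        using part(3) ln4 mult_left_mono[OF ln4, of "C' * real m powr (- ?Q + \<nu>)"] by simp
      finally have one: "1 \<le> C' * real m powr (- ?Q + \<nu>) * ln (4 / \<delta>)" .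
      show ?thesis
      proof (rule bexI[OF _ sets.top], rule conjI, simp add: S.prob_space \<delta> less_imp_le, intro ballI allI impI)
        fix D g
        show "risk (rho_meas \<rho>X \<eta>) (sign_fun g) - risk (rho_meas \<rho>X \<eta>) (bayes_rule \<eta>) \<le> C' * real m powr (- ?Q + \<nu>) * ln (4 / \<delta>)"
          using one risk_le_1[of "sign_fun g"] risk_nonneg[of "bayes_rule \<eta>"] by linarith
      qed
    qed
  qed
qed

end
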